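(* For $G=GL(n)$ or $SL(n)$ let $A=\mathcal O_R(G)$ be as described in the context, with all the standing assumptions on $R$ listed there, and let $\mathfrak g_\Gamma$ be the quantum Lie algebra (tangent space) of the bicovariant first order differential calculus $\Gamma=\Gamma(\mathbf r)$ over $A$ with associated left ideal $\ker\varepsilon_A\,\underline{.}\,\ker\varepsilon_A$. (i) Assume $R_{21}R=1$. For $G=GL(n)$ one has $\dim\mathfrak g_\Gamma=n^2$, with basis $\{\chi_i{}^j:i,j=1,\dots,n\}$ such that $\langle t^a{}_b,\chi_i{}^j\rangle=\delta^a_i\delta^j_b$. Let $\omega^a{}_b=\omega_R(t^a{}_b)$, $\omega=(\omega^a{}_b)$ and $\mathbf t=(t^a{}_b)$. The left crossed module structure of $\Gamma_R$ and the corresponding crossed module braiding $\sigma^t$ are given by $$\mathbf t_1\triangleright\omega_2=R_{21}\,\omega_2\,R,\qquad \Delta_L(\omega^i{}_j)=t^i{}_a\,S(t^b{}_j)\otimes\omega^a{}_b,\qquad \sigma^t(\omega_1\otimes R_{21}\omega_2R)=R_{21}\omega_2R\otimes\omega_1.$$ Equivalently, the first relation is $R\,\mathrm d(\mathbf t_1)\,\mathbf t_2=\mathbf t_2\,\mathrm d(\mathbf t_1)\,R$. The quantum Lie algebra structure of $\mathfrak g_\Gamma$ is given by $$\sigma(\chi_i{}^j\otimes\chi_k{}^l)=(\sigma_i{}^j{}_k{}^l)_b{}^a{}_d{}^c\;\chi_a{}^b\otimes\chi_c{}^d,\qquad [\chi_i{}^j,\chi_k{}^l]=\delta^j_k\,\chi_i{}^l-(\sigma_i{}^j{}_k{}^l)_r{}^a{}_b{}^r\;\chi_a{}^b,$$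 where $(\sigma_i{}^j{}_k{}^l)_b{}^a{}_d{}^c=(R_{21})^j{}_\beta{}^\alpha{}_b\,R^\gamma{}_i{}^l{}_\alpha\,R^\beta{}_d{}^a{}_\delta\,(R_{21})^c{}_\gamma{}^\delta{}_k$. The quantum Lie algebra for $SL(n)$ is the quantum Lie subalgebra $\mathfrak g_\Gamma^+=\{\chi\in\mathfrak g_\Gamma:\langle\underline{\mathrm{tr}},\chi\rangle=0\}$, of dimension $n^2-1$. (ii) If $q$ is not a root of unity, the quantum Lie algebra of $\mathcal O_q(SL(n))$ obtained in this way is zero.
   Context: Summation over repeated indices; $k$ is a field. A co-quasitriangular structure on a Hopf algebra $A$ is a linear map $\mathbf r:A\otimes A\to k$ with $b_{(1)}a_{(1)}\mathbf r(a_{(2)},b_{(2)})=\mathbf r(a_{(1)},b_{(1)})a_{(2)}b_{(2)}$, $\mathbf r(ab,c)=\mathbf r(a,c_{(1)})\mathbf r(b,c_{(2)})$, $\mathbf r(a,bc)=\mathbf r(a_{(1)},c)\mathbf r(a_{(2)},b)$. $\underline A$ is $A$ with product $a\,\underline{.}\,b=a_{(1)}b_{(2)}\mathbf r(b_{(1)}S(b_{(3)}),S(a_{(2)}))$. $\ker\varepsilon_A\,\underline{.}\,\ker\varepsilon_A$ is an $\mathrm{ad}_L$-invariant left ideal of $A$, where $\mathrm{ad}_L(a)=a_{(1)}S(a_{(3)})\otimes a_{(2)}$. Calculi: for a bicovariant first order differential calculus $(\Gamma,\mathrm d)$ over $A$, $\Gamma_R$ is the space of right-invariant elements, $\omega_R(a)=\mathrm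 d(a_{(1)})S(a_{(2)})$, and the associated left ideal is $\mathcal I_\Gamma=\ker\omega_R\cap\ker\varepsilon_A$ (such calculi correspond bijectively, up to isomorphism, to $\mathrm{ad}_L$-invariant left ideals of $A$ contained in $\ker\varepsilon_A$); $\Gamma_R$ is a left crossed module with $a\triangleright\eta=a_{(1)}\eta S(a_{(2)})$ and coaction $\Delta_L$, with braiding $\sigma^t(v\otimes w)=v^{(-1)}\triangleright w\otimes v^{(0)}$. The tangent space is $\mathfrak g_\Gamma=\{\chi\in A^*:\chi(1)=0,\ \chi(\mathcal I_\Gamma)=0\}$, paired with $\Gamma_R$ by $(\omega_R(a),\chi)=\chi(a)$; for finite dimensional $\Gamma_R$ it is the dual of $\Gamma_R$ as a crossed module, with bracket $[x,y]=x_{(1)}\,y\,S(x_{(2)})$ and crossed module braiding $\sigma(x\otimes y)=[x_{(1)},y]\otimes x_{(2)}-[x,y]\otimes1$ (coproducts in the Hopf dual $A^\circ$). For $\mathcal I_\Gamma=\ker\varepsilon_A\,\underline{.}\,\ker\varepsilon_A$ one has $\mathfrak g_\Gamma=\{\chi\in A^*:\chi(a\,\underline{.}\,b)=\chi(a)\varepsilon(b)+\varepsilon(a)\chi(b)\}$. The Hopf algebras: $R=(R^i{}_j{}^k{}_l)$ is a solution of the Yang–Baxter equation on $k^n\otimes k^n$, with inverse $R^{-1}$ ($R^i{}_a{}^k{}_b(R^{-1})^a{}_j{}^b{}_l=\delta^i_j\delta^k_l$) and second inverse $\tilde R$ ($\tilde R^i{}_a{}^b{}_l\,R^a{}_j{}^k{}_b=\delta^i_j\delta^k_l$);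 $(R_{21})^i{}_j{}^k{}_l=R^k{}_l{}^i{}_j$. $A(R)$ is the bialgebra generated by $t^i{}_j$ with $R\mathbf t_1\mathbf t_2=\mathbf t_2\mathbf t_1R$, $\Delta t^i{}_j=t^i{}_k\otimes t^k{}_j$ (subscripts $1,2$ indicate the tensor leg in $\mathrm{Mat}_n\otimes\mathrm{Mat}_n$). Assume there is a central grouplike $\det\in A(R)$ of degree $n$ such that: $\det$ is not a zero divisor and there is a bialgebra automorphism $f$ of $A(R)$ with $\det a=f(a)\det$ for all $a$; and there are elements $\tilde t^i{}_j\in A(R)$ with $t^i{}_a\tilde t^a{}_j=\delta^i_j\det$. $\mathcal O_R(GL(n))$ is the localization of $A(R)$ at $\det$, a Hopf algebra with $S(t^i{}_j)=\tilde t^i{}_j\det^{-1}$, co-quasitriangular with $\mathbf r(t^i{}_j,t^k{}_l)=z\,R^i{}_j{}^k{}_l$ for arbitrary $z\in k^\times$ (the choice of $z$ does not affect $\underline A$). If $\det$ is central in $A(R)$ and $\det-1$ lies in the left and right radicals of $\mathbf r$, $\mathcal O_R(SL(n))=A(R)/\langle\det-1\rangle$. The left quantum trace is $\underline{\mathrm{tr}}=\tilde R^a{}_i{}^j{}_a\,t^i{}_j$. Standing assumptions on $R$: the $\mathcal O_R(G)$ are well defined Hopf algebras, $\varepsilon(\underline{\mathrm{tr}})\neq0$, and for $A=\mathcal O_R(GL(n))$ every $\chi\in\mathfrak g_\Gamma$ satisfies $\chi(\det)=\frac{n}{\varepsilon(\underline{\mathrm{tr}})}\chi(\underline{\mathrm{tr}})$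 (in particular $\chi(\det)=0$ iff $\chi(\underline{\mathrm{tr}})=0$). $\mathcal O_q(SL(n))$ is the case over $\mathbb C$ where $R=R_q$ is the standard Drinfel'd–Jimbo $R$-matrix of $SL(n)$ type. The quantum Lie algebra for $SL(n)$ is viewed inside that of $GL(n)$ via the projection $\mathcal O_R(GL(n))\to\mathcal O_R(SL(n))$.
   Formalization: The printed array for σ and the bracket is false (fails for diagonal R, n=3). It is replaced by (R_{21})^l_β^α_d R^γ_k^j_α R̃^c_δ^β_b (R_{21})^a_γ^δ_i, with R̃ the second inverse; all other claims are unchanged. *)

theory Defs
  imports Complex_Main "HOL-Library.Function_Algebras" "HOL-Library.Cardinality"
begin

section \<open>Tensor products over a field\<close>

text \<open>
  Vector spaces over \<open>'k\<close> are types with an explicit scalar multiplication; function spaces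
  (in particular linear duals) carry the pointwise one, \<open>fscale\<close>.

  The tensor product \<open>A \<otimes> B\<close> is realised inside the dual of the space of bilinear forms
  \<open>A \<times> B \<rightarrow> k\<close>: the pure tensor \<open>a \<otimes> b\<close> is evaluation at \<open>(a, b)\<close>. Over a field bilinear forms
  separate the points of the algebraic tensor product, so the span of these functionals is
  \<open>A \<otimes> B\<close>. The value \<open>0\<close> on non-bilinear arguments only makes \<open>tens\<close> total.
\<close>

definition fscale :: "'k::field \<Rightarrow> ('x \<Rightarrow> 'k) \<Rightarrow> ('x \<Rightarrow> 'k)" where
  "fscale c f = (\<lambda>x. c * f x)"

definition bilin ::
  "('k::field \<Rightarrow> 'a::ab_group_add \<Rightarrow> 'a) \<Rightarrow> ('k \<Rightarrow> 'b::ab_group_add \<Rightarrow> 'b) \<Rightarrow>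
   ('k \<Rightarrow> 'c::ab_group_add \<Rightarrow> 'c) \<Rightarrow> ('a \<Rightarrow> 'b \<Rightarrow> 'c) \<Rightarrow> bool" where
  "bilin sA sB sC f \<longleftrightarrow>
     (\<forall>b. Vector_Spaces.linear sA sC (\<lambda>a. f a b)) \<and> (\<forall>a. Vector_Spaces.linear sB sC (f a))"

definition trilin ::
  "('k::field \<Rightarrow> 'a::ab_group_add \<Rightarrow> 'a) \<Rightarrow> ('k \<Rightarrow> 'b::ab_group_add \<Rightarrow> 'b) \<Rightarrow>
   ('k \<Rightarrow> 'c::ab_group_add \<Rightarrow> 'c) \<Rightarrow> ('a \<Rightarrow> 'b \<Rightarrow> 'c \<Rightarrow> 'k) \<Rightarrow> bool" where
  "trilin sA sB sC f \<longleftrightarrow>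
     (\<forall>b c. Vector_Spaces.linear sA (*) (\<lambda>a. f a b c)) \<and>
     (\<forall>a c. Vector_Spaces.linear sB (*) (\<lambda>b. f a b c)) \<and>
     (\<forall>a b. Vector_Spaces.linear sC (*) (f a b))"

type_synonym ('k, 'a, 'b) tensor = "('a \<Rightarrow> 'b \<Rightarrow> 'k) \<Rightarrow> 'k"

definition tens ::
  "('k::field \<Rightarrow> 'a::ab_group_add \<Rightarrow> 'a) \<Rightarrow> ('k \<Rightarrow> 'b::ab_group_add \<Rightarrow> 'b) \<Rightarrow>
   'a \<Rightarrow> 'b \<Rightarrow> ('k, 'a, 'b) tensor" where
  "tens sA sB a b = (\<lambda>\<beta>. if bilin sA sB (*) \<beta> then \<beta> a b else 0)"

definition tens3 ::
  "('k::field \<Rightarrow> 'a::ab_group_add \<Rightarrow> 'a) \<Rightarrow> ('k \<Rightarrow> 'b::ab_group_add \<Rightarrow> 'b) \<Rightarrow>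
   ('k \<Rightarrow> 'c::ab_group_add \<Rightarrow> 'c) \<Rightarrow> 'a \<Rightarrow> 'b \<Rightarrow> 'c \<Rightarrow> ('a \<Rightarrow> 'b \<Rightarrow> 'c \<Rightarrow> 'k) \<Rightarrow> 'k" where
  "tens3 sA sB sC a b c = (\<lambda>\<beta>. if trilin sA sB sC \<beta> then \<beta> a b c else 0)"

text \<open>\<open>V \<otimes> W\<close> for subspaces \<open>V\<close>, \<open>W\<close>, as a subspace of \<open>A \<otimes> B\<close>.\<close>

definition tensor_space ::
  "('k::field \<Rightarrow> 'a::ab_group_add \<Rightarrow> 'a) \<Rightarrow> ('k \<Rightarrow> 'b::ab_group_add \<Rightarrow> 'b) \<Rightarrow>
   'a set \<Rightarrow> 'b set \<Rightarrow> ('k, 'a, 'b) tensor set" where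
  "tensor_space sA sB V W = module.span fscale {tens sA sB v w | v w. v \<in> V \<and> w \<in> W}"

text \<open>
  The linear map \<open>V \<otimes> W \<rightarrow> C\<close> induced by a map \<open>f\<close> that is bilinear on \<open>V \<times> W\<close>, computed on any
  representation of the tensor by pure tensors of elements of \<open>V\<close> and \<open>W\<close>. It is only
  meaningful for tensors in \<open>V \<otimes> W\<close>. All Sweedler sums below are of this form.
\<close>

definition tlift ::
  "('k::field \<Rightarrow> 'a::ab_group_add \<Rightarrow> 'a) \<Rightarrow> ('k \<Rightarrow> 'b::ab_group_add \<Rightarrow> 'b) \<Rightarrow>
   'a set \<Rightarrow> 'b set \<Rightarrow> ('a \<Rightarrow> 'b \<Rightarrow> 'c::ab_group_add) \<Rightarrow> ('k, 'a, 'b) tensor \<Rightarrow> 'c" where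
  "tlift sA sB V W f T =
     (\<Sum>(v, w) \<leftarrow> (SOME ps. set ps \<subseteq> V \<times> W \<and> T = (\<Sum>(v, w) \<leftarrow> ps. tens sA sB v w)). f v w)"


section \<open>Bialgebras and Hopf algebras\<close>

record ('k, 'a) bialg =
  scl :: "'k \<Rightarrow> 'a \<Rightarrow> 'a"
  cop :: "'a \<Rightarrow> ('k, 'a, 'a) tensor"
  cou :: "'a \<Rightarrow> 'k"

record ('k, 'a) hopf = "('k, 'a) bialg" +
  antip :: "'a \<Rightarrow> 'a"

text \<open>\<open>sw B f a\<close> is \<open>f(a\<^sub>(\<^sub>1\<^sub>), a\<^sub>(\<^sub>2\<^sub>))\<close>, and \<open>sw3 B f a\<close> is \<open>f(a\<^sub>(\<^sub>1\<^sub>), a\<^sub>(\<^sub>2\<^sub>), a\<^sub>(\<^sub>3\<^sub>))\<close>.\<close>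

definition sw ::
  "('k::field, 'a::ab_group_add, 'z) bialg_scheme \<Rightarrow> ('a \<Rightarrow> 'a \<Rightarrow> 'c::ab_group_add) \<Rightarrow> 'a \<Rightarrow> 'c" where
  "sw B f a = tlift (scl B) (scl B) UNIV UNIV f (cop B a)"

definition sw3 ::
  "('k::field, 'a::ab_group_add, 'z) bialg_scheme \<Rightarrow> ('a \<Rightarrow> 'a \<Rightarrow> 'a \<Rightarrow> 'c::ab_group_add) \<Rightarrow> 'a \<Rightarrow> 'c"
  where "sw3 B f a = sw B (\<lambda>x y. sw B (\<lambda>u v. f u v y) x) a"

definition algebra :: "('k::field \<Rightarrow> 'a::ring_1 \<Rightarrow> 'a) \<Rightarrow> bool" where
  "algebra s \<longleftrightarrow> vector_space s \<and>
     (\<forall>c a b. s c a * b = s c (a * b)) \<and> (\<forall>c a b. a * s c b = s c (a * b))"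

definition bialgebra :: "('k::field, 'a::ring_1, 'z) bialg_scheme \<Rightarrow> bool" where
  "bialgebra B \<longleftrightarrow>
     algebra (scl B) \<and>
     Vector_Spaces.linear (scl B) fscale (cop B) \<and>
     (\<forall>a. cop B a \<in> tensor_space (scl B) (scl B) UNIV UNIV) \<and>
     Vector_Spaces.linear (scl B) (*) (cou B) \<and>
     (\<forall>a. sw B (\<lambda>x y. sw B (\<lambda>u v. tens3 (scl B) (scl B) (scl B) u v y) x) a =
          sw B (\<lambda>x y. sw B (\<lambda>u v. tens3 (scl B) (scl B) (scl B) x u v) y) a) \<and>
     (\<forall>a. sw B (\<lambda>x y. scl B (cou B x) y) a = a) \<and>
     (\<forall>a. sw B (\<lambda>x y. scl B (cou B y) x) a = a) \<and>
     cop B 1 = tens (scl B) (scl B) 1 1 \<and>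
     (\<forall>a b. cop B (a * b) =
        sw B (\<lambda>x y. sw B (\<lambda>u v. tens (scl B) (scl B) (x * u) (y * v)) b) a) \<and>
     cou B 1 = 1 \<and>
     (\<forall>a b. cou B (a * b) = cou B a * cou B b)"

definition hopf_algebra :: "('k::field, 'a::ring_1, 'z) hopf_scheme \<Rightarrow> bool" where
  "hopf_algebra H \<longleftrightarrow>
     bialgebra H \<and>
     Vector_Spaces.linear (scl H) (scl H) (antip H) \<and>
     (\<forall>a. sw H (\<lambda>x y. antip H x * y) a = scl H (cou H a) 1) \<and>
     (\<forall>a. sw H (\<lambda>x y. x * antip H y) a = scl H (cou H a) 1)"

definition bialgebra_hom ::
  "('k::field, 'a::ring_1, 'y) bialg_scheme \<Rightarrow> ('k, 'b::ring_1, 'z) bialg_scheme \<Rightarrow>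
   ('a \<Rightarrow> 'b) \<Rightarrow> bool" where
  "bialgebra_hom B C f \<longleftrightarrow>
     Vector_Spaces.linear (scl B) (scl C) f \<and>
     f 1 = 1 \<and> (\<forall>a b. f (a * b) = f a * f b) \<and>
     (\<forall>a. cop C (f a) = sw B (\<lambda>x y. tens (scl C) (scl C) (f x) (f y)) a) \<and>
     (\<forall>a. cou C (f a) = cou B a)"

definition grouplike :: "('k::field, 'a::ring_1, 'z) bialg_scheme \<Rightarrow> 'a \<Rightarrow> bool" where
  "grouplike B g \<longleftrightarrow> cop B g = tens (scl B) (scl B) g g \<and> cou B g = 1"

definition coquasitriangular ::
  "('k::field, 'a::ring_1, 'z) bialg_scheme \<Rightarrow> ('a \<Rightarrow> 'a \<Rightarrow> 'k) \<Rightarrow> bool" where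
  "coquasitriangular B r \<longleftrightarrow>
     bilin (scl B) (scl B) (*) r \<and>
     (\<forall>a b. sw B (\<lambda>a1 a2. sw B (\<lambda>b1 b2. scl B (r a2 b2) (b1 * a1)) b) a =
            sw B (\<lambda>a1 a2. sw B (\<lambda>b1 b2. scl B (r a1 b1) (a2 * b2)) b) a) \<and>
     (\<forall>a b c. r (a * b) c = sw B (\<lambda>c1 c2. r a c1 * r b c2) c) \<and>
     (\<forall>a b c. r a (b * c) = sw B (\<lambda>a1 a2. r a1 c * r a2 b) a)"

definition uprod ::
  "('k::field, 'a::ring_1, 'z) hopf_scheme \<Rightarrow> ('a \<Rightarrow> 'a \<Rightarrow> 'k) \<Rightarrow> 'a \<Rightarrow> 'a \<Rightarrow> 'a" where
  "uprod H r a b =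
     sw H (\<lambda>a1 a2. sw3 H (\<lambda>b1 b2 b3.
       scl H (r (b1 * antip H b3) (antip H a2)) (a1 * b2)) b) a"

definition ker_uprod_ker ::
  "('k::field, 'a::ring_1, 'z) hopf_scheme \<Rightarrow> ('a \<Rightarrow> 'a \<Rightarrow> 'k) \<Rightarrow> 'a set" where
  "ker_uprod_ker H r = module.span (scl H) {uprod H r a b | a b. cou H a = 0 \<and> cou H b = 0}"


section \<open>Bicovariant first order differential calculi\<close>

record ('k, 'a, 'g) calculus =
  gscl :: "'k \<Rightarrow> 'g \<Rightarrow> 'g"
  lmul :: "'a \<Rightarrow> 'g \<Rightarrow> 'g"
  rmul :: "'g \<Rightarrow> 'a \<Rightarrow> 'g"
  dif  :: "'a \<Rightarrow> 'g"
  lco  :: "'g \<Rightarrow> ('k, 'a, 'g) tensor"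
  rco  :: "'g \<Rightarrow> ('k, 'g, 'a) tensor"

definition fodc ::
  "('k::field, 'a::ring_1, 'y) hopf_scheme \<Rightarrow> ('k, 'a, 'g::ab_group_add, 'z) calculus_scheme \<Rightarrow> bool"
  where
  "fodc H G \<longleftrightarrow>
     bilin (scl H) (gscl G) (gscl G) (lmul G) \<and>
     bilin (gscl G) (scl H) (gscl G) (rmul G) \<and>
     (\<forall>v. lmul G 1 v = v) \<and> (\<forall>v. rmul G v 1 = v) \<and>
     (\<forall>a b v. lmul G (a * b) v = lmul G a (lmul G b v)) \<and>
     (\<forall>a b v. rmul G v (a * b) = rmul G (rmul G v a) b) \<and>
     (\<forall>a b v. rmul G (lmul G a v) b = lmul G a (rmul G v b)) \<and>
     Vector_Spaces.linear (scl H) (gscl G) (dif G) \<and>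
     (\<forall>a b. dif G (a * b) = rmul G (dif G a) b + lmul G a (dif G b)) \<and>
     module.span (gscl G) {lmul G a (dif G b) | a b. True} = UNIV"

definition lcol ::
  "('k::field, 'a::ring_1, 'y) hopf_scheme \<Rightarrow> ('k, 'a, 'g::ab_group_add, 'z) calculus_scheme \<Rightarrow>
   ('a \<Rightarrow> 'g \<Rightarrow> 'c::ab_group_add) \<Rightarrow> 'g \<Rightarrow> 'c" where
  "lcol H G f v = tlift (scl H) (gscl G) UNIV UNIV f (lco G v)"

definition rcol ::
  "('k::field, 'a::ring_1, 'y) hopf_scheme \<Rightarrow> ('k, 'a, 'g::ab_group_add, 'z) calculus_scheme \<Rightarrow>
   ('g \<Rightarrow> 'a \<Rightarrow> 'c::ab_group_add) \<Rightarrow> 'g \<Rightarrow> 'c" where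
  "rcol H G f v = tlift (gscl G) (scl H) UNIV UNIV f (rco G v)"

text \<open>
  \<open>\<Gamma>\<close> is an \<open>A\<close>-bicomodule whose coactions are compatible with the bimodule structure, and
  \<open>d\<close> intertwines them with the coproduct of \<open>A\<close>.
\<close>

definition bicovariant_fodc ::
  "('k::field, 'a::ring_1, 'y) hopf_scheme \<Rightarrow> ('k, 'a, 'g::ab_group_add, 'z) calculus_scheme \<Rightarrow> bool"
  where
  "bicovariant_fodc H G \<longleftrightarrow>
     fodc H G \<and>
     Vector_Spaces.linear (gscl G) fscale (lco G) \<and>
     Vector_Spaces.linear (gscl G) fscale (rco G) \<and>
     (\<forall>v. lco G v \<in> tensor_space (scl H) (gscl G) UNIV UNIV) \<and>
     (\<forall>v. rco G v \<in> tensor_space (gscl G) (scl H) UNIV UNIV) \<and>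
     (\<forall>v. lcol H G (\<lambda>a w. gscl G (cou H a) w) v = v) \<and>
     (\<forall>v. rcol H G (\<lambda>w a. gscl G (cou H a) w) v = v) \<and>
     (\<forall>v. lcol H G (\<lambda>a w. sw H (\<lambda>x y. tens3 (scl H) (scl H) (gscl G) x y w) a) v =
          lcol H G (\<lambda>a w. lcol H G (\<lambda>b u. tens3 (scl H) (scl H) (gscl G) a b u) w) v) \<and>
     (\<forall>v. rcol H G (\<lambda>w a. sw H (\<lambda>x y. tens3 (gscl G) (scl H) (scl H) w x y) a) v =
          rcol H G (\<lambda>w a. rcol H G (\<lambda>u b. tens3 (gscl G) (scl H) (scl H) u b a) w) v) \<and>
     (\<forall>v. lcol H G (\<lambda>a w. rcol H G (\<lambda>u b. tens3 (scl H) (gscl G) (scl H) a u b) w) v =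
          rcol H G (\<lambda>w b. lcol H G (\<lambda>a u. tens3 (scl H) (gscl G) (scl H) a u b) w) v) \<and>
     (\<forall>a v. lco G (lmul G a v) =
        sw H (\<lambda>x y. lcol H G (\<lambda>b w. tens (scl H) (gscl G) (x * b) (lmul G y w)) v) a) \<and>
     (\<forall>a v. lco G (rmul G v a) =
        sw H (\<lambda>x y. lcol H G (\<lambda>b w. tens (scl H) (gscl G) (b * x) (rmul G w y)) v) a) \<and>
     (\<forall>a v. rco G (lmul G a v) =
        sw H (\<lambda>x y. rcol H G (\<lambda>w b. tens (gscl G) (scl H) (lmul G x w) (y * b)) v) a) \<and>
     (\<forall>a v. rco G (rmul G v a) =
        sw H (\<lambda>x y. rcol H G (\<lambda>w b. tens (gscl G) (scl H) (rmul G w x) (b * y)) v) a) \<and>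
     (\<forall>a. lco G (dif G a) = sw H (\<lambda>x y. tens (scl H) (gscl G) x (dif G y)) a) \<and>
     (\<forall>a. rco G (dif G a) = sw H (\<lambda>x y. tens (gscl G) (scl H) (dif G x) y) a)"

definition right_invariant ::
  "('k::field, 'a::ring_1, 'y) hopf_scheme \<Rightarrow> ('k, 'a, 'g::ab_group_add, 'z) calculus_scheme \<Rightarrow> 'g set"
  where "right_invariant H G = {v. rco G v = tens (gscl G) (scl H) v 1}"

definition omega_R ::
  "('k::field, 'a::ring_1, 'y) hopf_scheme \<Rightarrow> ('k, 'a, 'g::ab_group_add, 'z) calculus_scheme \<Rightarrow> 'a \<Rightarrow> 'g"
  where "omega_R H G a = sw H (\<lambda>x y. rmul G (dif G x) (antip H y)) a"

definition left_ideal ::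
  "('k::field, 'a::ring_1, 'y) hopf_scheme \<Rightarrow> ('k, 'a, 'g::ab_group_add, 'z) calculus_scheme \<Rightarrow> 'a set"
  where "left_ideal H G = {a. omega_R H G a = 0 \<and> cou H a = 0}"

definition act ::
  "('k::field, 'a::ring_1, 'y) hopf_scheme \<Rightarrow> ('k, 'a, 'g::ab_group_add, 'z) calculus_scheme \<Rightarrow>
   'a \<Rightarrow> 'g \<Rightarrow> 'g" where
  "act H G a v = sw H (\<lambda>x y. rmul G (lmul G x v) (antip H y)) a"

definition sigma_t ::
  "('k::field, 'a::ring_1, 'y) hopf_scheme \<Rightarrow> ('k, 'a, 'g::ab_group_add, 'z) calculus_scheme \<Rightarrow>
   ('k, 'g, 'g) tensor \<Rightarrow> ('k, 'g, 'g) tensor" where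
  "sigma_t H G =
     tlift (gscl G) (gscl G) (right_invariant H G) (right_invariant H G)
       (\<lambda>v w. lcol H G (\<lambda>a v0. tens (gscl G) (gscl G) (act H G a w) v0) v)"


section \<open>Hopf dual and quantum Lie algebra\<close>

definition functionals :: "('k::field, 'a::ring_1, 'y) bialg_scheme \<Rightarrow> ('a \<Rightarrow> 'k) set" where
  "functionals H = {x. Vector_Spaces.linear (scl H) (*) x}"

text \<open>
  A tensor of functionals \<open>\<Sum> f \<otimes> g\<close> is regarded as the functional
  \<open>a \<otimes> b \<mapsto> \<Sum> f a * g b\<close>, that is, it is evaluated at the bilinear form \<open>\<lambda>f g. f a * g b\<close>.
\<close>

definition hopf_dual :: "('k::field, 'a::ring_1, 'y) bialg_scheme \<Rightarrow> ('a \<Rightarrow> 'k) set" where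
  "hopf_dual H = {x \<in> functionals H.
     \<exists>T \<in> tensor_space fscale fscale (functionals H) (functionals H).
       \<forall>a b. x (a * b) = T (\<lambda>f g. f a * g b)}"

definition dual_cop ::
  "('k::field, 'a::ring_1, 'y) bialg_scheme \<Rightarrow> ('a \<Rightarrow> 'k) \<Rightarrow> ('k, 'a \<Rightarrow> 'k, 'a \<Rightarrow> 'k) tensor" where
  "dual_cop H x = (THE T. T \<in> tensor_space fscale fscale (hopf_dual H) (hopf_dual H) \<and>
     (\<forall>a b. x (a * b) = T (\<lambda>f g. f a * g b)))"

definition dual_sw ::
  "('k::field, 'a::ring_1, 'y) bialg_scheme \<Rightarrow> (('a \<Rightarrow> 'k) \<Rightarrow> ('a \<Rightarrow> 'k) \<Rightarrow> 'c::ab_group_add) \<Rightarrow>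
   ('a \<Rightarrow> 'k) \<Rightarrow> 'c" where
  "dual_sw H f x = tlift fscale fscale (hopf_dual H) (hopf_dual H) f (dual_cop H x)"

definition conv ::
  "('k::field, 'a::ring_1, 'y) bialg_scheme \<Rightarrow> ('a \<Rightarrow> 'k) \<Rightarrow> ('a \<Rightarrow> 'k) \<Rightarrow> 'a \<Rightarrow> 'k" where
  "conv H f g = (\<lambda>a. sw H (\<lambda>x y. f x * g y) a)"

definition bracket ::
  "('k::field, 'a::ring_1, 'y) hopf_scheme \<Rightarrow> ('a \<Rightarrow> 'k) \<Rightarrow> ('a \<Rightarrow> 'k) \<Rightarrow> 'a \<Rightarrow> 'k" where
  "bracket H x y = dual_sw H (\<lambda>x1 x2. conv H (conv H x1 y) (x2 \<circ> antip H)) x"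

text \<open>The unit of the Hopf dual is the counit of \<open>A\<close>.\<close>

definition braiding ::
  "('k::field, 'a::ring_1, 'y) hopf_scheme \<Rightarrow> ('a \<Rightarrow> 'k) \<Rightarrow> ('a \<Rightarrow> 'k) \<Rightarrow>
   ('k, 'a \<Rightarrow> 'k, 'a \<Rightarrow> 'k) tensor" where
  "braiding H x y =
     dual_sw H (\<lambda>x1 x2. tens fscale fscale (bracket H x1 y) x2) x
     - tens fscale fscale (bracket H x y) (cou H)"

definition tangent ::
  "('k::field, 'a::ring_1, 'y) hopf_scheme \<Rightarrow> ('k, 'a, 'g::ab_group_add, 'z) calculus_scheme \<Rightarrow>
   ('a \<Rightarrow> 'k) set" where
  "tangent H G = {x \<in> functionals H. x 1 = 0 \<and> (\<forall>a \<in> left_ideal H G. x a = 0)}"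


section \<open>R-matrices\<close>

text \<open>\<open>R i j k l\<close> is \<open>R\<^sup>i\<^sub>j\<^sup>k\<^sub>l\<close>; the index type \<open>'n\<close> has \<open>n\<close> elements.\<close>

type_synonym ('k, 'n) rmat = "'n \<Rightarrow> 'n \<Rightarrow> 'n \<Rightarrow> 'n \<Rightarrow> 'k"

definition kd :: "'n \<Rightarrow> 'n \<Rightarrow> 'k::zero_neq_one" where
  "kd i j = (if i = j then 1 else 0)"

definition flip_rmat :: "('k, 'n) rmat \<Rightarrow> ('k, 'n) rmat" where
  "flip_rmat R i j k l = R k l i j"

definition rmat_mult ::
  "('k::field, 'n::finite) rmat \<Rightarrow> ('k, 'n) rmat \<Rightarrow> ('k, 'n) rmat" where
  "rmat_mult P Q i j k l = (\<Sum>a\<in>UNIV. \<Sum>b\<in>UNIV. P i a k b * Q a j b l)"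

definition rmat_one :: "('k::field, 'n) rmat" where
  "rmat_one i j k l = kd i j * kd k l"

definition yang_baxter :: "('k::field, 'n::finite) rmat \<Rightarrow> bool" where
  "yang_baxter R \<longleftrightarrow> (\<forall>i j k l m p.
     (\<Sum>a\<in>UNIV. \<Sum>b\<in>UNIV. \<Sum>c\<in>UNIV. R i a j b * R a l k c * R b m c p) =
     (\<Sum>a\<in>UNIV. \<Sum>b\<in>UNIV. \<Sum>c\<in>UNIV. R j b k c * R i a c p * R a l b m))"

definition second_inverse :: "('k::field, 'n::finite) rmat \<Rightarrow> ('k, 'n) rmat \<Rightarrow> bool" where
  "second_inverse R Rt \<longleftrightarrow> (\<forall>i j k l.
     (\<Sum>a\<in>UNIV. \<Sum>b\<in>UNIV. Rt i a b l * R a j k b) = kd i j * kd k l)"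

text \<open>
  The standard R-matrix
  \<open>q \<Sum>\<^sub>i E\<^sub>i\<^sub>i \<otimes> E\<^sub>i\<^sub>i + \<Sum>\<^sub>i\<^sub>\<noteq>\<^sub>j E\<^sub>i\<^sub>i \<otimes> E\<^sub>j\<^sub>j + (q - q\<^sup>-\<^sup>1) \<Sum>\<^sub>i\<^sub><\<^sub>j E\<^sub>i\<^sub>j \<otimes> E\<^sub>j\<^sub>i\<close> of type \<open>SL(n)\<close>, times a normalisation \<open>c\<close>.
  The \<open>SL(n)\<close> normalisation is \<open>c\<^sup>n = q\<^sup>-\<^sup>1\<close>; the algebra \<open>A(R)\<close> does not depend on \<open>c\<close>.
\<close>

definition dj_rmat :: "complex \<Rightarrow> complex \<Rightarrow> (complex, 'n::linorder) rmat" where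
  "dj_rmat c q i j k l = c *
     (if i = j \<and> k = l then (if i = k then q else 1)
      else if i = l \<and> j = k \<and> i < j then q - inverse q
      else 0)"


section \<open>The bialgebra \<open>A(R)\<close>\<close>

text \<open>
  The free algebra on the \<open>t\<^sup>i\<^sub>j\<close> is the space of finitely supported functions on words in the
  index pairs. \<open>frt_relator u v i j k l\<close> is \<open>u \<cdot> \<rho> \<cdot> v\<close>, where \<open>\<rho>\<close> is the \<open>(i, j, k, l)\<close>-entry of
  \<open>R t\<^sub>1 t\<^sub>2 - t\<^sub>2 t\<^sub>1 R\<close>; over all words \<open>u\<close>, \<open>v\<close> these span the two-sided ideal of relations.
\<close>

type_synonym ('k, 'n) free_elt = "('n \<times> 'n) list \<Rightarrow> 'k"

definition eval_free ::
  "('k::field \<Rightarrow> 'a::ring_1 \<Rightarrow> 'a) \<Rightarrow> ('n \<Rightarrow> 'n \<Rightarrow> 'a) \<Rightarrow> ('k, 'n) free_elt \<Rightarrow> 'a" where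
  "eval_free s t p = (\<Sum>w | p w \<noteq> 0. s (p w) (prod_list (map (\<lambda>(i, j). t i j) w)))"

definition frt_relator ::
  "('k::field, 'n::finite) rmat \<Rightarrow> ('n \<times> 'n) list \<Rightarrow> ('n \<times> 'n) list \<Rightarrow>
   'n \<Rightarrow> 'n \<Rightarrow> 'n \<Rightarrow> 'n \<Rightarrow> ('k, 'n) free_elt" where
  "frt_relator R u v i j k l =
     (\<Sum>a\<in>UNIV. \<Sum>b\<in>UNIV. fscale (R i a k b) (kd (u @ [(a, j), (b, l)] @ v)))
     - (\<Sum>a\<in>UNIV. \<Sum>b\<in>UNIV. fscale (R a j b l) (kd (u @ [(k, b), (i, a)] @ v)))"

locale frt_bialgebra =
  fixes R :: "('k::field, 'n::finite) rmat"
    and Rt :: "('k, 'n) rmat"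
    and M :: "('k, 'm::ring_1) bialg"
    and t :: "'n \<Rightarrow> 'n \<Rightarrow> 'm"
  assumes yang_baxter: "yang_baxter R"
    and invertible: "\<exists>Ri. rmat_mult R Ri = rmat_one"
    and second_inverse: "second_inverse R Rt"
    and bialgebra: "bialgebra M"
    and generated: "\<And>a. \<exists>p. finite {w. p w \<noteq> 0} \<and> eval_free (scl M) t p = a"
    and relations: "\<And>p. finite {w. p w \<noteq> 0} \<Longrightarrow>
      eval_free (scl M) t p = 0 \<longleftrightarrow>
        p \<in> module.span fscale {frt_relator R u v i j k l | u v i j k l. True}"
    and cop_t: "\<And>i j. cop M (t i j) = (\<Sum>a\<in>UNIV. tens (scl M) (scl M) (t i a) (t a j))"
    and cou_t: "\<And>i j. cou M (t i j) = kd i j"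
begin

definition qtr :: 'm where
  "qtr = (\<Sum>i\<in>UNIV. \<Sum>j\<in>UNIV. scl M (\<Sum>a\<in>UNIV. Rt a i j a) (t i j))"

end

section \<open>The Hopf algebras of type \<open>GL(n)\<close> and \<open>SL(n)\<close>\<close>

text \<open>
  \<open>H\<close> is the localisation of \<open>A(R)\<close> at the regular element \<open>det\<close>: \<open>\<iota>\<close> is injective, \<open>\<iota> det\<close> is
  invertible with inverse \<open>deti\<close>, and every element is a fraction. \<open>tt\<close> is the matrix of the
  elements with \<open>t tt = det\<close>, and \<open>G\<close> is the calculus whose left ideal is the one
  determined by \<open>r\<close>.
\<close>

locale quantum_GL = frt_bialgebra R Rt M t
  for R :: "('k::field, 'n::finite) rmat"
    and Rt :: "('k, 'n) rmat"
    and M :: "('k, 'm::ring_1) bialg"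
    and t :: "'n \<Rightarrow> 'n \<Rightarrow> 'm" +
  fixes det :: 'm
    and tt :: "'n \<Rightarrow> 'n \<Rightarrow> 'm"
    and H :: "('k, 'h::ring_1) hopf"
    and \<iota> :: "'m \<Rightarrow> 'h"
    and deti :: 'h
    and z :: 'k
    and r :: "'h \<Rightarrow> 'h \<Rightarrow> 'k"
    and G :: "('k, 'h, 'g::ab_group_add) calculus"
  assumes det_grouplike: "grouplike M det"
    and det_degree: "\<exists>p. finite {w. p w \<noteq> 0} \<and> (\<forall>w. p w \<noteq> 0 \<longrightarrow> length w = CARD('n)) \<and>
      eval_free (scl M) t p = det"
    and det_central: "\<And>a. det * a = a * det"
    and det_regular: "\<And>a. det * a = 0 \<or> a * det = 0 \<Longrightarrow> a = 0"
    and det_normal: "\<exists>f. bialgebra_hom M M f \<and> bij f \<and> (\<forall>a. det * a = f a * det)"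
    and tt: "\<And>i j. (\<Sum>a\<in>UNIV. t i a * tt a j) = (if i = j then det else 0)"
    and hopf: "hopf_algebra H"
    and iota_hom: "bialgebra_hom M H \<iota>"
    and iota_inj: "inj \<iota>"
    and deti: "\<iota> det * deti = 1" "deti * \<iota> det = 1"
    and fractions: "\<And>h. \<exists>a m. h = \<iota> a * deti ^ m"
    and antip_t: "\<And>i j. antip H (\<iota> (t i j)) = \<iota> (tt i j) * deti"
    and z_nonzero: "z \<noteq> 0"
    and coquasi: "coquasitriangular H r"
    and r_t: "\<And>i j k l. r (\<iota> (t i j)) (\<iota> (t k l)) = z * R i j k l"
    and calculus: "bicovariant_fodc H G"
    and calculus_ideal: "left_ideal H G = ker_uprod_ker H r"
    and qtr_nonzero: "cou M qtr \<noteq> 0"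
    and det_qtr: "\<And>x. x \<in> tangent H G \<Longrightarrow>
      x (\<iota> det) = of_nat CARD('n) / cou M qtr * x (\<iota> qtr)"
    and det_qtr_zero: "\<And>x. x \<in> tangent H G \<Longrightarrow> x (\<iota> det) = 0 \<longleftrightarrow> x (\<iota> qtr) = 0"

text \<open>
  \<open>H'\<close> is \<open>A(R) / \<langle>det - 1\<rangle>\<close> with quotient map \<open>\<pi>\<close>, and \<open>p\<close> is the projection \<open>H \<rightarrow> H'\<close>. The
  structure \<open>rM\<close> on \<open>A(R)\<close> has its own normalisation \<open>\<zeta>\<close>, which the radical conditions
  restrict, whereas \<open>z\<close> above is arbitrary.
\<close>

locale quantum_SL = quantum_GL R Rt M t det tt H \<iota> deti z r G
  for R :: "('k::field, 'n::finite) rmat"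
    and Rt :: "('k, 'n) rmat"
    and M :: "('k, 'm::ring_1) bialg"
    and t :: "'n \<Rightarrow> 'n \<Rightarrow> 'm"
    and det :: 'm
    and tt :: "'n \<Rightarrow> 'n \<Rightarrow> 'm"
    and H :: "('k, 'h::ring_1) hopf"
    and \<iota> :: "'m \<Rightarrow> 'h"
    and deti :: 'h
    and z :: 'k
    and r :: "'h \<Rightarrow> 'h \<Rightarrow> 'k"
    and G :: "('k, 'h, 'g::ab_group_add) calculus" +
  fixes \<zeta> :: 'k
    and rM :: "'m \<Rightarrow> 'm \<Rightarrow> 'k"
    and H' :: "('k, 's::ring_1) hopf"
    and \<pi> :: "'m \<Rightarrow> 's"
    and r' :: "'s \<Rightarrow> 's \<Rightarrow> 'k"
    and p :: "'h \<Rightarrow> 's"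
    and G' :: "('k, 's, 'e::ab_group_add) calculus"
  assumes zeta_nonzero: "\<zeta> \<noteq> 0"
    and coquasi_M: "coquasitriangular M rM"
    and rM_t: "\<And>i j k l. rM (t i j) (t k l) = \<zeta> * R i j k l"
    and radicals: "\<And>a. rM (det - 1) a = 0" "\<And>a. rM a (det - 1) = 0"
    and hopf': "hopf_algebra H'"
    and pi_hom: "bialgebra_hom M H' \<pi>"
    and pi_surj: "surj \<pi>"
    and pi_kernel: "{a. \<pi> a = 0} = module.span (scl M) {a * (det - 1) * b | a b. True}"
    and coquasi': "coquasitriangular H' r'"
    and r'_pi: "\<And>a b. r' (\<pi> a) (\<pi> b) = rM a b"
    and p_hom: "bialgebra_hom H H' p"
    and p_iota: "\<And>a. p (\<iota> a) = \<pi> a"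
    and calculus': "bicovariant_fodc H' G'"
    and calculus'_ideal: "left_ideal H' G' = ker_uprod_ker H' r'"


section \<open>Explicit formulae\<close>

text \<open>The \<open>(i, j, k, l)\<close>-entry of the matrix \<open>R\<^sub>2\<^sub>1 \<omega>\<^sub>2 R\<close>.\<close>

definition R21_w2_R ::
  "('k::field, 'h::ring_1, 'g::ab_group_add, 'z) calculus_scheme \<Rightarrow> ('k, 'n::finite) rmat \<Rightarrow>
   ('n \<Rightarrow> 'n \<Rightarrow> 'g) \<Rightarrow> 'n \<Rightarrow> 'n \<Rightarrow> 'n \<Rightarrow> 'n \<Rightarrow> 'g" where
  "R21_w2_R G R w i j k l =
     (\<Sum>a\<in>UNIV. \<Sum>b\<in>UNIV. \<Sum>c\<in>UNIV.
       gscl G (flip_rmat R i a k b * R a j c l) (w b c))"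

text \<open>\<open>R d(t\<^sub>1) t\<^sub>2 = t\<^sub>2 d(t\<^sub>1) R\<close>\<close>

definition R_dt_relation ::
  "('k::field, 'h::ring_1, 'g::ab_group_add, 'z) calculus_scheme \<Rightarrow> ('k, 'n::finite) rmat \<Rightarrow>
   ('n \<Rightarrow> 'n \<Rightarrow> 'h) \<Rightarrow> bool" where
  "R_dt_relation G R t \<longleftrightarrow> (\<forall>i j k l.
     (\<Sum>a\<in>UNIV. \<Sum>b\<in>UNIV. gscl G (R i a k b) (rmul G (dif G (t a j)) (t b l))) =
     (\<Sum>a\<in>UNIV. \<Sum>b\<in>UNIV. gscl G (R a j b l) (lmul G (t k b) (dif G (t i a)))))"

text \<open>\<open>t\<^sub>1 \<triangleright> \<omega>\<^sub>2 = R\<^sub>2\<^sub>1 \<omega>\<^sub>2 R\<close>\<close>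

definition t_omega_relation ::
  "('k::field, 'h::ring_1, 'y) hopf_scheme \<Rightarrow> ('k, 'h, 'g::ab_group_add, 'z) calculus_scheme \<Rightarrow>
   ('k, 'n::finite) rmat \<Rightarrow> ('n \<Rightarrow> 'n \<Rightarrow> 'h) \<Rightarrow> bool" where
  "t_omega_relation H G R t \<longleftrightarrow> (\<forall>i j k l.
     act H G (t i j) (omega_R H G (t k l)) =
     R21_w2_R G R (\<lambda>a b. omega_R H G (t a b)) i j k l)"

text \<open>
  \<open>braid_coeff R Rt i j k l b a d c\<close> is the coefficient
  \<open>(\<sigma>\<^sub>i\<^sup>j\<^sub>k\<^sup>l)\<^sub>b\<^sup>a\<^sub>d\<^sup>c\<close> of \<open>\<chi>\<^sub>a\<^sup>b \<otimes> \<chi>\<^sub>c\<^sup>d\<close> in \<open>\<sigma>(\<chi>\<^sub>i\<^sup>j \<otimes> \<chi>\<^sub>k\<^sup>l)\<close>, namely the pairing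
  of \<open>t\<^sup>a\<^sub>k S(t\<^sup>l\<^sub>b) \<triangleright> \<omega>\<^sup>c\<^sub>d\<close> with \<open>\<chi>\<^sub>i\<^sup>j\<close>. The action of \<open>S(t)\<close> brings in the second inverse of
  \<open>R\<close>, which differs from \<open>R\<^sub>2\<^sub>1\<close> when \<open>S\<^sup>2\<close> is not the identity (Jordanian \<open>GL(2)\<close>). The
  array printed in the source is this one with \<open>(R\<^sub>2\<^sub>1)\<close> in place of the second inverse and with the
  pairs \<open>(i, j), (k, l)\<close> and \<open>(a, b), (c, d)\<close> interchanged. It does not agree with
  \<open>\<sigma>(x \<otimes> y) = [x\<^sub>(\<^sub>1\<^sub>), y] \<otimes> x\<^sub>(\<^sub>2\<^sub>) - [x, y] \<otimes> 1\<close>: for \<open>n = 3\<close> and diagonal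
  \<open>R\<^sup>i\<^sub>i\<^sup>k\<^sub>k = \<rho>\<^sub>i\<^sub>k\<close>, \<open>\<rho>\<^sub>i\<^sub>i = 1\<close>, \<open>\<rho>\<^sub>1\<^sub>2 = \<rho>\<^sub>2\<^sub>3 = \<rho>\<^sub>3\<^sub>1 = \<lambda>\<close>, \<open>\<rho>\<^sub>k\<^sub>i = 1 / \<rho>\<^sub>i\<^sub>k\<close>, it gives
  \<open>\<lambda>\<^sup>-\<^sup>3\<close> instead of \<open>\<lambda>\<^sup>3\<close> for the coefficient of \<open>\<chi>\<^sub>2\<^sup>3 \<otimes> \<chi>\<^sub>1\<^sup>2\<close> in \<open>\<sigma>(\<chi>\<^sub>1\<^sup>2 \<otimes> \<chi>\<^sub>2\<^sup>3)\<close>.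
\<close>

definition braid_coeff ::
  "('k::field, 'n::finite) rmat \<Rightarrow> ('k, 'n) rmat \<Rightarrow>
   'n \<Rightarrow> 'n \<Rightarrow> 'n \<Rightarrow> 'n \<Rightarrow> 'n \<Rightarrow> 'n \<Rightarrow> 'n \<Rightarrow> 'n \<Rightarrow> 'k" where
  "braid_coeff R Rt i j k l b a d c =
     (\<Sum>\<alpha>\<in>UNIV. \<Sum>\<beta>\<in>UNIV. \<Sum>\<gamma>\<in>UNIV. \<Sum>\<delta>\<in>UNIV.
       flip_rmat R l \<beta> \<alpha> d * R \<gamma> k j \<alpha> * Rt c \<delta> \<beta> b * flip_rmat R a \<gamma> \<delta> i)"

end

theory Submission
  imports Defs
begin

text \<open>
  The product of \<open>A\<close> is recovered from the transmuted one by \<open>ab = a\<^sub>(\<^sub>1\<^sub>) . b\<^sub>(\<^sub>2\<^sub>) r(b\<^sub>(\<^sub>1\<^sub>) S(b\<^sub>(\<^sub>3\<^sub>)), a\<^sub>(\<^sub>2\<^sub>))\<close>. Hence a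
  linear map \<open>x\<close> with \<open>x(1) = 0\<close> that kills \<open>ker \<epsilon> . ker \<epsilon>\<close> is a cocycle,
  \<open>x(ab) = x(a) \<epsilon>(b) + r(b\<^sub>(\<^sub>1\<^sub>) S(b\<^sub>(\<^sub>3\<^sub>)), a) x(b\<^sub>(\<^sub>2\<^sub>))\<close>, and this applies both to tangent vectors and to
  \<open>\<omega>\<^sub>R\<close>. For \<open>b = t\<^sup>k\<^sub>l\<close> the coefficients are \<open>L(a) = r(t S(t), a)\<close>, with \<open>L(t\<^sub>1)\<close> conjugation of the second
  leg by \<open>R\<^sub>2\<^sub>1\<close>, so \<open>x\<close> is determined by the matrix \<open>x(t)\<close>.

  If \<open>R\<^sub>2\<^sub>1 R = 1\<close>, every matrix occurs: the cocycle rule defines \<open>\<chi>\<close> on words, and it respects the FRT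
  relations because both sides of \<open>R t\<^sub>1 t\<^sub>2 = t\<^sub>2 t\<^sub>1 R\<close> linearise to \<open>R \<chi>\<^sub>1 + \<chi>\<^sub>2 R\<close>. Compatibility with the
  adjoint coaction makes \<open>\<chi>(det)\<close> an \<open>L\<close>-invariant vector, whence \<open>L(det) = 1\<close> and \<open>\<chi>\<close> extends to the
  localisation by \<open>\<chi>(a det\<^sup>-\<^sup>m) = \<chi>(a) - m \<epsilon>(a) \<chi>(det)\<close>. The structure maps are then read off from
  \<open>\<omega>\<^sub>R(a) = \<chi>(a) \<omega>\<close>, \<open>\<Delta>\<chi> = \<chi> \<otimes> 1 + L \<otimes> \<chi>\<close> and \<open>[x, y](a) = x(a\<^sub>(\<^sub>1\<^sub>) S(a\<^sub>(\<^sub>3\<^sub>))) y(a\<^sub>(\<^sub>2\<^sub>))\<close>. Tangent vectors of \<open>SL(n)\<close>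
  are those that vanish at \<open>det\<close>.

  For general \<open>R\<close> the FRT relations force \<open>x(t\<^sub>2)\<close> to commute with \<open>R R\<^sub>2\<^sub>1\<close>. For the standard \<open>R\<close> with
  \<open>q\<^sup>2 \<noteq> 1\<close> this makes \<open>x(t)\<close> a scalar \<open>\<mu>\<close>, and \<open>0 = x(det) = n \<mu>\<close> because \<open>det\<close> has degree \<open>n\<close>.
\<close>

section \<open>Linear maps and tensors\<close>

text \<open>Two obstacles shape the development. The first is choice. Every Sweedler sum is a
  \<open>tlift\<close> over a representation picked by \<open>SOME\<close>: it is additive in its
  integrand for free, but it can be evaluated on another representation only when the integrand is
  bilinear, so each computation carries linearity conditions. Likewise the coproduct of the Hopf
  dual is a definite description, and bracket and braiding become accessible only after existence
  and uniqueness have been settled in the tensor square of the dual.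

  The second is normalisation. The forms r on GL(n) and r' on SL(n) carry independent constants z
  and \<zeta>, so r need not be the pullback of r' and the two transmuted products cannot be
  compared directly. What rescues the comparison is that the transmuted product feeds only elements
  \<open>b1 S(b3)\<close> into the first slot of its form; for these the constants cancel in the
  triangular case, and L is common to both groups.\<close>

abbreviation lin ::
  "('k::field \<Rightarrow> 'a::ab_group_add \<Rightarrow> 'a) \<Rightarrow> ('k \<Rightarrow> 'b::ab_group_add \<Rightarrow> 'b) \<Rightarrow> ('a \<Rightarrow> 'b) \<Rightarrow> bool"
  where "lin \<equiv> Vector_Spaces.linear"

text \<open>Rules closed under composition: each locale contributes its structure maps in the form
  "if f is linear, so is z \<mapsto> map (f z)", so that the side conditions of the Sweedler
  calculus are settled by the shape of the term.\<close>

named_theorems lin_rules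

lemma vector_space_times [lin_rules]: "vector_space ((*) :: 'k::field \<Rightarrow> 'k \<Rightarrow> 'k)"
  by unfold_locales (auto simp: algebra_simps)

lemma vector_space_fscale [lin_rules]: "vector_space (fscale :: 'k::field \<Rightarrow> ('x \<Rightarrow> 'k) \<Rightarrow> _)"
  by unfold_locales (auto simp: fscale_def algebra_simps fun_eq_iff)

interpretation fs: vector_space "fscale :: 'k::field \<Rightarrow> ('x \<Rightarrow> 'k) \<Rightarrow> _"
  by (rule vector_space_fscale)

lemma linI:
  assumes "vector_space s1" "vector_space s2"
    and "\<And>x y. f (x + y) = f x + f y" and "\<And>c x. f (s1 c x) = s2 c (f x)"
  shows "lin s1 s2 f"
  using assms by (auto simp: Vector_Spaces.linear_iff)

lemma lin_vs:
  assumes "lin s1 s2 f"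
  shows "vector_space s1" "vector_space s2"
  using assms by (auto simp: Vector_Spaces.linear_iff)

lemma lin_add: "lin s1 s2 f \<Longrightarrow> f (x + y) = f x + f y"
  by (auto simp: Vector_Spaces.linear_iff)

lemma lin_scale: "lin s1 s2 f \<Longrightarrow> f (s1 c x) = s2 c (f x)"
  by (auto simp: Vector_Spaces.linear_iff)

lemma lin_module_hom: "lin s1 s2 f \<Longrightarrow> module_hom s1 s2 f"
  by (simp add: module_hom_iff_linear)

lemma lin_zero: "lin s1 s2 f \<Longrightarrow> f 0 = 0"
  by (rule module_hom.zero[OF lin_module_hom])

lemma lin_diff: "lin s1 s2 f \<Longrightarrow> f (x - y) = f x - f y"
  by (rule module_hom.diff[OF lin_module_hom])

lemma lin_sum: "lin s1 s2 f \<Longrightarrow> f (sum g S) = (\<Sum>x\<in>S. f (g x))"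
  by (rule module_hom.sum[OF lin_module_hom])

lemma lin_const_zero [lin_rules]:
  "vector_space s1 \<Longrightarrow> vector_space s2 \<Longrightarrow> lin s1 s2 (\<lambda>x. 0)"
  by (rule linI) (auto simp: module.scale_zero_right module_iff_vector_space)

lemma lin_ident [lin_rules]: "vector_space s \<Longrightarrow> lin s s (\<lambda>x. x)"
  by (rule linI) auto

lemma lin_plus [lin_rules]: "lin s1 s2 f \<Longrightarrow> lin s1 s2 g \<Longrightarrow> lin s1 s2 (\<lambda>x. f x + g x)"
  by (rule linI) (auto simp: lin_vs lin_add lin_scale algebra_simps
      module.scale_right_distrib[OF module_iff_vector_space[THEN iffD2]])

lemma lin_minus [lin_rules]: "lin s1 s2 f \<Longrightarrow> lin s1 s2 g \<Longrightarrow> lin s1 s2 (\<lambda>x. f x - g x)"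
  by (rule linI) (auto simp: lin_vs lin_add lin_scale algebra_simps
      module.scale_right_diff_distrib[OF module_iff_vector_space[THEN iffD2]])

lemma lin_comp: "lin s2 s3 g \<Longrightarrow> lin s1 s2 f \<Longrightarrow> lin s1 s3 (\<lambda>x. g (f x))"
  by (rule linI) (auto simp: lin_vs lin_add lin_scale)

lemma lin_smult [lin_rules]: "lin s1 s2 f \<Longrightarrow> lin s1 s2 (\<lambda>x. s2 c (f x))"
  by (rule linI) (auto simp: lin_vs lin_add lin_scale algebra_simps
      module.scale_right_distrib[OF module_iff_vector_space[THEN iffD2]]
      module.scale_left_commute[OF module_iff_vector_space[THEN iffD2]])

lemma lin_coeff [lin_rules]:
  "vector_space s2 \<Longrightarrow> lin s1 (*) f \<Longrightarrow> lin s1 s2 (\<lambda>x. s2 (f x) v)"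
  by (rule linI) (auto simp: lin_vs lin_add lin_scale algebra_simps
      module.scale_left_distrib[OF module_iff_vector_space[THEN iffD2]]
      module.scale_scale[OF module_iff_vector_space[THEN iffD2]])

lemma lin_times_right [lin_rules]: "lin s1 (*) f \<Longrightarrow> lin s1 (*) (\<lambda>x. f x * (c::'k::field))"
  by (rule linI) (auto simp: lin_vs lin_add lin_scale algebra_simps)

lemma lin_finite_sum [lin_rules]:
  "vector_space s1 \<Longrightarrow> vector_space s2 \<Longrightarrow> (\<And>i. lin s1 s2 (\<lambda>x. f i x)) \<Longrightarrow>
   lin s1 s2 (\<lambda>x. \<Sum>i\<in>I. f i x)"
  by (induction I rule: infinite_finite_induct) (auto intro: lin_rules)

lemma lin_eval: "lin s1 fscale f \<Longrightarrow> lin s1 (*) (\<lambda>x. f x y)"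
  by (rule linI) (auto simp: lin_vs lin_rules lin_add lin_scale, simp add: fscale_def)

lemma lin_fun_pointwise:
  assumes "vector_space s1" "\<And>y. lin s1 (*) (\<lambda>x. f x y)"
  shows "lin s1 fscale f"
  using lin_add[OF assms(2)] lin_scale[OF assms(2)]
  by (intro linI assms(1) vector_space_fscale) (auto simp: fun_eq_iff fscale_def)

section \<open>Separating functionals, complements and subspaces\<close>

lemma linear_functional_separates:
  assumes "vector_space s" "c \<noteq> 0"
  shows "\<exists>\<phi>. lin s (*) \<phi> \<and> \<phi> c \<noteq> (0::'k::field)"
proof -
  interpret vector_space_pair s "(*) :: 'k \<Rightarrow> 'k \<Rightarrow> 'k"
    unfolding vector_space_pair_def using assms vector_space_times by auto
  have "vs1.independent {c}"
    using assms(2) by simp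
  from linear_independent_extend[OF this, of "\<lambda>_. 1"] show ?thesis
    by auto
qed

text \<open>Tensors are tested against scalar-valued forms only. Composing with linear functionals
  is how the axioms of a bialgebra yield Sweedler identities with values in an arbitrary
  space.\<close>

lemma eq_by_functionals:
  fixes s :: "'k::field \<Rightarrow> 'c::ab_group_add \<Rightarrow> 'c"
  assumes "vector_space s" "\<And>\<phi> :: 'c \<Rightarrow> 'k. lin s (*) \<phi> \<Longrightarrow> \<phi> x = \<phi> y"
  shows "x = y"
proof (rule ccontr)
  assume "x \<noteq> y"
  then obtain \<phi> :: "'c \<Rightarrow> 'k" where "lin s (*) \<phi>" "\<phi> (x - y) \<noteq> 0"
    using linear_functional_separates[OF assms(1), of "x - y"] by auto
  with assms(2)[of \<phi>] show False
    by (simp add: lin_diff)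
qed

text \<open>Over a field every subspace has a complement. Composing with such projections turns a
  map bilinear on V x W alone into one bilinear everywhere, which is an admissible argument of
  \<open>tens\<close>.\<close>

lemma subspace_projection:
  assumes "vector_space s" "module.subspace s V"
  shows "\<exists>\<pi>. lin s s \<pi> \<and> range \<pi> \<subseteq> V \<and> (\<forall>v\<in>V. \<pi> v = v)"
proof -
  interpret vector_space_pair s s
    unfolding vector_space_pair_def using assms by auto
  show ?thesis
    using linear_exists_left_inverse_on[of "\<lambda>x. x" V] lin_ident[OF assms(1)] assms(2) by auto
qed

lemma subspace_univ: "vector_space s \<Longrightarrow> module.subspace s UNIV"
  by (simp add: module.subspace_UNIV module_iff_vector_space)

lemma
  assumes "vector_space s" "module.subspace s V"
  shows subspace_zeroD: "0 \<in> V"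
    and subspace_addD: "x \<in> V \<Longrightarrow> y \<in> V \<Longrightarrow> x + y \<in> V"
    and subspace_scaleD: "x \<in> V \<Longrightarrow> s c x \<in> V"
    and subspace_diffD: "x \<in> V \<Longrightarrow> y \<in> V \<Longrightarrow> x - y \<in> V"
proof -
  interpret vector_space s by (rule assms)
  show "0 \<in> V" "x \<in> V \<Longrightarrow> y \<in> V \<Longrightarrow> x + y \<in> V" "x \<in> V \<Longrightarrow> s c x \<in> V"
    "x \<in> V \<Longrightarrow> y \<in> V \<Longrightarrow> x - y \<in> V"
    using assms(2) by (auto simp: subspace_0 subspace_add subspace_scale subspace_diff)
qed

lemma subspace_sumD:
  "vector_space s \<Longrightarrow> module.subspace s V \<Longrightarrow> (\<And>i. i \<in> I \<Longrightarrow> f i \<in> V) \<Longrightarrow> (\<Sum>i\<in>I. f i) \<in> V"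
  by (induction I rule: infinite_finite_induct) (auto simp: subspace_zeroD subspace_addD)

lemma subspaceI:
  assumes "vector_space s" "0 \<in> V" "\<And>x y. x \<in> V \<Longrightarrow> y \<in> V \<Longrightarrow> x + y \<in> V"
    "\<And>c x. x \<in> V \<Longrightarrow> s c x \<in> V"
  shows "module.subspace s V"
  using assms by (simp add: module.subspace_def module_iff_vector_space)

lemma subspace_zero_set: "vector_space s \<Longrightarrow> module.subspace s {0}"
  by (simp add: module.subspace_single_0 module_iff_vector_space)

lemma subspace_vimage:
  assumes "lin s1 s2 f" "module.subspace s2 V"
  shows "module.subspace s1 {x. f x \<in> V}"
  using assms subspace_zeroD[OF lin_vs(2)[OF assms(1)] assms(2)]
    subspace_addD[OF lin_vs(2)[OF assms(1)] assms(2)]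
    subspace_scaleD[OF lin_vs(2)[OF assms(1)] assms(2)]
  by (intro subspaceI) (auto simp: lin_vs lin_zero lin_add lin_scale)

section \<open>Sums of pure tensors and lifts of bilinear maps\<close>

abbreviation lsum :: "('a \<Rightarrow> 'b \<Rightarrow> 'c::comm_monoid_add) \<Rightarrow> ('a \<times> 'b) list \<Rightarrow> 'c" where
  "lsum f ps \<equiv> (\<Sum>(v, w) \<leftarrow> ps. f v w)"

lemma sum_fun_apply: "(\<Sum>i\<in>I. f i) x = (\<Sum>i\<in>I. f i x)"
  by (induction I rule: infinite_finite_induct) auto

lemma lsum_apply: "lsum f ps x = lsum (\<lambda>v w. f v w x) ps"
  by (induction ps) auto

lemma lsum_cong: "(\<And>v w. (v, w) \<in> set ps \<Longrightarrow> f v w = g v w) \<Longrightarrow> lsum f ps = lsum g ps"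
  by (intro arg_cong[of _ _ sum_list] map_cong) auto

lemma lin_lsum: "lin s1 s2 h \<Longrightarrow> h (lsum f ps) = lsum (\<lambda>v w. h (f v w)) ps"
  by (induction ps) (auto simp: lin_zero lin_add)

lemma lsum_Nil: "lsum f [] = 0" and lsum_Cons: "lsum f ((v, w) # ps) = f v w + lsum f ps"
  by simp_all

lemma lsum_map_left: "lsum f (map (\<lambda>(v, w). (g v, w)) ps) = lsum (\<lambda>v w. f (g v) w) ps"
  by (induction ps) auto

lemma lsum_add: "lsum (\<lambda>v w. f v w + g v w) ps = lsum f ps + lsum g ps"
  by (induction ps) (auto simp: algebra_simps)

lemma lsum_zero: "lsum (\<lambda>v w. 0) ps = 0"
  by (induction ps) auto

lemma lsum_sum: "lsum (\<lambda>v w. \<Sum>i\<in>I. f i v w) ps = (\<Sum>i\<in>I. lsum (f i) ps)"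
  by (induction ps) (auto simp: sum.distrib)

lemma lsum_swap:
  "lsum (\<lambda>v w. lsum (\<lambda>x y. f v w x y) qs) ps = lsum (\<lambda>x y. lsum (\<lambda>v w. f v w x y) ps) qs"
  by (induction ps) (auto simp: lsum_add lsum_zero)

lemma bilinI:
  "(\<And>b. lin sA sC (\<lambda>a. f a b)) \<Longrightarrow> (\<And>a. lin sB sC (\<lambda>b. f a b)) \<Longrightarrow> bilin sA sB sC f"
  by (simp add: bilin_def)

lemma bilinD:
  assumes "bilin sA sB sC f"
  shows "lin sA sC (\<lambda>a. f a b)" "lin sB sC (\<lambda>b. f a b)"
  using assms by (auto simp: bilin_def)

text \<open>The subspaces matter for \<open>sigma_t\<close> and for the Hopf dual, whose lifts are
  taken over right-invariant elements and over functionals rather than over a whole type.\<close>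

definition bil_on ::
  "('k::field \<Rightarrow> 'a::ab_group_add \<Rightarrow> 'a) \<Rightarrow> ('k \<Rightarrow> 'b::ab_group_add \<Rightarrow> 'b) \<Rightarrow>
   ('k \<Rightarrow> 'c::ab_group_add \<Rightarrow> 'c) \<Rightarrow> 'a set \<Rightarrow> 'b set \<Rightarrow> ('a \<Rightarrow> 'b \<Rightarrow> 'c) \<Rightarrow> bool" where
  "bil_on sA sB sC V W f \<longleftrightarrow>
     vector_space sA \<and> vector_space sB \<and> vector_space sC \<and>
     module.subspace sA V \<and> module.subspace sB W \<and>
     (\<forall>v\<in>V. \<forall>v'\<in>V. \<forall>w\<in>W. f (v + v') w = f v w + f v' w) \<and>
     (\<forall>c. \<forall>v\<in>V. \<forall>w\<in>W. f (sA c v) w = sC c (f v w)) \<and>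
     (\<forall>v\<in>V. \<forall>w\<in>W. \<forall>w'\<in>W. f v (w + w') = f v w + f v w') \<and>
     (\<forall>c. \<forall>v\<in>V. \<forall>w\<in>W. f v (sB c w) = sC c (f v w))"

lemma bil_onI:
  assumes "bilin sA sB sC f" "module.subspace sA V" "module.subspace sB W"
  shows "bil_on sA sB sC V W f"
  using assms bilinD[OF assms(1)]
  by (auto simp: bil_on_def lin_vs[OF bilinD(1)[OF assms(1)]] lin_vs[OF bilinD(2)[OF assms(1)]]
      lin_add[OF bilinD(1)[OF assms(1)]] lin_add[OF bilinD(2)[OF assms(1)]]
      lin_scale[OF bilinD(1)[OF assms(1)]] lin_scale[OF bilinD(2)[OF assms(1)]])

lemma bil_on_UNIV: "bilin sA sB sC f \<Longrightarrow> bil_on sA sB sC UNIV UNIV f"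
  by (rule bil_onI) (auto intro: subspace_univ dest: bilinD lin_vs)

lemma lsum_tens:
  "lsum (tens sA sB) ps \<beta> = (if bilin sA sB (*) \<beta> then lsum \<beta> ps else 0)"
  unfolding lsum_apply by (auto simp: tens_def lsum_zero)

text \<open>This is the well-definedness of the lift. Composed with a functional on the target and
  with projections onto V and W, f becomes a scalar bilinear form, and equal tensors agree on every
  such form by construction.\<close>

lemma lsum_cong_tens:
  fixes sA :: "'k::field \<Rightarrow> 'a::ab_group_add \<Rightarrow> 'a" and sB :: "'k \<Rightarrow> 'b::ab_group_add \<Rightarrow> 'b"
    and sC :: "'k \<Rightarrow> 'c::ab_group_add \<Rightarrow> 'c"
  assumes f: "bil_on sA sB sC V W f" and sub: "set ps \<subseteq> V \<times> W" "set qs \<subseteq> V \<times> W"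
    and eq: "lsum (tens sA sB) ps = lsum (tens sA sB) qs"
  shows "lsum f ps = lsum f qs"
proof -
  have vs: "vector_space sA" "vector_space sB" "vector_space sC"
    "module.subspace sA V" "module.subspace sB W"
    using f by (auto simp: bil_on_def)
  obtain \<pi> where \<pi>: "lin sA sA \<pi>" "range \<pi> \<subseteq> V" "\<And>v. v \<in> V \<Longrightarrow> \<pi> v = v"
    using subspace_projection[OF vs(1,4)] by blast
  obtain \<rho> where \<rho>: "lin sB sB \<rho>" "range \<rho> \<subseteq> W" "\<And>v. v \<in> W \<Longrightarrow> \<rho> v = v"
    using subspace_projection[OF vs(2,5)] by blast
  have inV: "\<pi> v \<in> V" "\<rho> w \<in> W" for v w
    using \<pi>(2) \<rho>(2) by auto
  have lin1: "lin sA sC (\<lambda>v. f (\<pi> v) (\<rho> w))" and lin2: "lin sB sC (\<lambda>w. f (\<pi> v) (\<rho> w))" for v w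
    using f inV by (auto intro!: linI simp: vs lin_add[OF \<pi>(1)] lin_add[OF \<rho>(1)]
        lin_scale[OF \<pi>(1)] lin_scale[OF \<rho>(1)] bil_on_def)
  show ?thesis
  proof (rule eq_by_functionals[OF vs(3)])
    fix \<phi> :: "'c \<Rightarrow> 'k" assume \<phi>: "lin sC (*) \<phi>"
    define \<beta> where "\<beta> = (\<lambda>v w. \<phi> (f (\<pi> v) (\<rho> w)))"
    have bil: "bilin sA sB (*) \<beta>"
      unfolding \<beta>_def by (intro bilinI lin_comp[OF \<phi>] lin1 lin2)
    have "\<phi> (lsum f ps) = lsum \<beta> ps" if "set ps \<subseteq> V \<times> W" for ps
      unfolding lin_lsum[OF \<phi>] \<beta>_def using that \<pi>(3) \<rho>(3) by (intro lsum_cong) auto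
    moreover have "lsum \<beta> ps = lsum \<beta> qs"
      using fun_cong[OF eq, of \<beta>] bil by (simp add: lsum_tens)
    ultimately show "\<phi> (lsum f ps) = \<phi> (lsum f qs)"
      using sub by simp
  qed
qed

lemma tlift_lsum:
  assumes f: "bil_on sA sB sC V W f" and sub: "set ps \<subseteq> V \<times> W"
  shows "tlift sA sB V W f (lsum (tens sA sB) ps) = lsum f ps"
proof -
  let ?P = "\<lambda>qs. set qs \<subseteq> V \<times> W \<and> lsum (tens sA sB) ps = lsum (tens sA sB) qs"
  have P: "?P (SOME qs. ?P qs)"
    by (rule someI[where P = ?P and x = ps]) (use sub in auto)
  show ?thesis
    unfolding tlift_def by (rule lsum_cong_tens[OF f, symmetric]) (use sub P in blast)+
qed

lemma bilin_tens:
  fixes sA :: "'k::field \<Rightarrow> 'a::ab_group_add \<Rightarrow> 'a"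
  assumes "vector_space sA" "vector_space sB"
  shows "bilin sA sB fscale (tens sA sB)"
proof (intro bilinI lin_fun_pointwise assms)
  fix b and \<beta> :: "'a \<Rightarrow> 'b \<Rightarrow> 'k"
  show "lin sA (*) (\<lambda>a. tens sA sB a b \<beta>)"
    by (cases "bilin sA sB (*) \<beta>") (auto simp: tens_def assms intro: bilinD lin_rules)
next
  fix a and \<beta> :: "'a \<Rightarrow> 'b \<Rightarrow> 'k"
  show "lin sB (*) (\<lambda>b. tens sA sB a b \<beta>)"
    by (cases "bilin sA sB (*) \<beta>") (auto simp: tens_def assms intro: bilinD lin_rules)
qed

lemma tens_linear [lin_rules]:
  fixes sA :: "'k::field \<Rightarrow> 'a::ab_group_add \<Rightarrow> 'a"
  assumes "vector_space sA" "vector_space sB"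
  shows "lin s sA f \<Longrightarrow> lin s fscale (\<lambda>z. tens sA sB (f z) b)"
    "lin s sB g \<Longrightarrow> lin s fscale (\<lambda>z. tens sA sB a (g z))"
  using bilinD[OF bilin_tens[OF assms]] lin_comp by blast+

text \<open>Scalars can be absorbed into the left factor, so lists of pure tensors without
  coefficients already exhaust the span.\<close>

lemma tensor_space_list:
  assumes vs: "vector_space sA" "vector_space sB"
    and V: "module.subspace sA V" "module.subspace sB W"
  shows "T \<in> tensor_space sA sB V W \<longleftrightarrow> (\<exists>ps. set ps \<subseteq> V \<times> W \<and> T = lsum (tens sA sB) ps)"
proof
  note [simp] = lin_scale[OF bilinD(1)[OF bilin_tens[OF vs]], symmetric]
  assume "T \<in> tensor_space sA sB V W"
  then show "\<exists>ps. set ps \<subseteq> V \<times> W \<and> T = lsum (tens sA sB) ps"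
    unfolding tensor_space_def
  proof (induction rule: fs.span_induct_alt)
    case base
    show ?case by (intro exI[of _ "[]"]) simp
  next
    case (step c x y)
    then obtain v w ps where
      "v \<in> V" "w \<in> W" "x = tens sA sB v w" "set ps \<subseteq> V \<times> W" "y = lsum (tens sA sB) ps"
      by auto
    then show ?case
      using subspace_scaleD[OF vs(1) V(1)] by (intro exI[of _ "(sA c v, w) # ps"]) auto
  qed
next
  assume "\<exists>ps. set ps \<subseteq> V \<times> W \<and> T = lsum (tens sA sB) ps"
  then obtain ps where ps: "set ps \<subseteq> V \<times> W" and T: "T = lsum (tens sA sB) ps"
    by blast
  show "T \<in> tensor_space sA sB V W"
    unfolding T tensor_space_def using ps
  proof (induction ps)
    case (Cons p ps)
    obtain v w where p: "p = (v, w)"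
      by (cases p)
    have "tens sA sB v w \<in> fs.span {tens sA sB v w |v w. v \<in> V \<and> w \<in> W}"
      using Cons(2) p by (intro fs.span_base) auto
    then show ?case
      using Cons unfolding p lsum_Cons by (intro fs.span_add) auto
  qed (simp only: lsum_Nil fs.span_zero)
qed

lemma tensor_space_subspace: "module.subspace fscale (tensor_space sA sB V W)"
  unfolding tensor_space_def by (rule fs.subspace_span)

lemma tens_in_tensor_space: "v \<in> V \<Longrightarrow> w \<in> W \<Longrightarrow> tens sA sB v w \<in> tensor_space sA sB V W"
  unfolding tensor_space_def by (intro fs.span_base) blast

lemmas tensor_space_zeroI = subspace_zeroD[OF vector_space_fscale tensor_space_subspace]
lemmas tensor_space_addI = subspace_addD[OF vector_space_fscale tensor_space_subspace]
lemmas tensor_space_sumI = subspace_sumD[OF vector_space_fscale tensor_space_subspace]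

lemma lsum_in_tensor_space:
  assumes T: "\<And>v w. T v w \<in> tensor_space sA sB V W"
  shows "lsum T ps \<in> tensor_space sA sB V W"
proof (induction ps)
  case Nil
  show ?case
    unfolding lsum_Nil by (rule tensor_space_zeroI)
next
  case (Cons p ps)
  then show ?case
    using tensor_space_addI[OF T Cons] by (cases p) (simp only: lsum_Cons)
qed

text \<open>The list chosen inside \<open>tlift\<close> does not involve the map being lifted, so
  one representation serves every f of the given type, bilinear or not. This permits lifting along
  maps, such as the bracket, whose bilinearity is not known beforehand.\<close>

lemma tlift_rep:
  assumes "vector_space sA" "vector_space sB" "module.subspace sA V" "module.subspace sB W"
    and "T \<in> tensor_space sA sB V W"
  obtains ps where "set ps \<subseteq> V \<times> W" "T = lsum (tens sA sB) ps"
    "\<And>f :: 'a::ab_group_add \<Rightarrow> 'b::ab_group_add \<Rightarrow> 'c::ab_group_add. tlift sA sB V W f T = lsum f ps"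
proof -
  let ?P = "\<lambda>qs. set qs \<subseteq> V \<times> W \<and> T = lsum (tens sA sB) qs"
  have "\<exists>qs. ?P qs"
    using assms by (simp add: tensor_space_list)
  then have "?P (SOME qs. ?P qs)"
    by (rule someI_ex)
  then show ?thesis
    by (intro that[of "SOME qs. ?P qs"]) (auto simp: tlift_def)
qed

lemma
  assumes f: "bil_on sA sB sC V W f"
  shows tlift_tens: "v \<in> V \<Longrightarrow> w \<in> W \<Longrightarrow> tlift sA sB V W f (tens sA sB v w) = f v w"
    and tlift_add: "T \<in> tensor_space sA sB V W \<Longrightarrow> T' \<in> tensor_space sA sB V W \<Longrightarrow>
      tlift sA sB V W f (T + T') = tlift sA sB V W f T + tlift sA sB V W f T'"
    and tlift_zero: "tlift sA sB V W f 0 = 0"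
    and tlift_scale: "T \<in> tensor_space sA sB V W \<Longrightarrow>
      tlift sA sB V W f (fscale c T) = sC c (tlift sA sB V W f T)"
proof -
  have vs: "vector_space sA" "vector_space sB" "module.subspace sA V" "module.subspace sB W"
    and C: "vector_space sC"
    using f by (auto simp: bil_on_def)
  show "tlift sA sB V W f (tens sA sB v w) = f v w" if "v \<in> V" "w \<in> W"
    using tlift_lsum[OF f, of "[(v, w)]"] that by simp
  show "tlift sA sB V W f 0 = 0"
    using tlift_lsum[OF f, of "[]"] by simp
  show "tlift sA sB V W f (T + T') = tlift sA sB V W f T + tlift sA sB V W f T'"
    if T: "T \<in> tensor_space sA sB V W" "T' \<in> tensor_space sA sB V W"
  proof -
    obtain ps qs where "set ps \<subseteq> V \<times> W" "T = lsum (tens sA sB) ps"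
      "set qs \<subseteq> V \<times> W" "T' = lsum (tens sA sB) qs"
      using T by (auto simp: tensor_space_list[OF vs])
    then show ?thesis
      using tlift_lsum[OF f, of ps] tlift_lsum[OF f, of qs] tlift_lsum[OF f, of "ps @ qs"] by simp
  qed
  show "tlift sA sB V W f (fscale c T) = sC c (tlift sA sB V W f T)"
    if T: "T \<in> tensor_space sA sB V W"
  proof -
    obtain ps where ps: "set ps \<subseteq> V \<times> W" "T = lsum (tens sA sB) ps"
      using T by (auto simp: tensor_space_list[OF vs])
    define qs where "qs = map (\<lambda>(v, w). (sA c v, w)) ps"
    have qs: "set qs \<subseteq> V \<times> W"
      using ps(1) subspace_scaleD[OF vs(1,3)] by (auto simp: qs_def)
    have "fscale c T = lsum (tens sA sB) qs"
      unfolding ps(2) qs_def lsum_map_left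
      unfolding lin_lsum[OF lin_smult[OF lin_ident[OF vector_space_fscale]]]
        lin_scale[OF bilinD(1)[OF bilin_tens[OF vs(1,2)]]] ..
    moreover have "lsum f qs = sC c (lsum f ps)"
    proof -
      have "lsum f qs = lsum (\<lambda>v w. f (sA c v) w) ps"
        unfolding qs_def by (rule lsum_map_left)
      also have "\<dots> = lsum (\<lambda>v w. sC c (f v w)) ps"
        using ps(1) f by (intro lsum_cong) (auto simp: bil_on_def)
      also have "\<dots> = sC c (lsum f ps)"
        by (rule lin_lsum[OF lin_smult[OF lin_ident[OF C]], symmetric])
      finally show ?thesis .
    qed
    ultimately show ?thesis
      using tlift_lsum[OF f ps(1)] tlift_lsum[OF f qs] ps(2) by simp
  qed
qed

lemma tlift_sum:
  assumes f: "bil_on sA sB sC V W f" and T: "\<And>i. i \<in> I \<Longrightarrow> T i \<in> tensor_space sA sB V W"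
  shows "tlift sA sB V W f (\<Sum>i\<in>I. T i) = (\<Sum>i\<in>I. tlift sA sB V W f (T i))"
  using T
  by (induction I rule: infinite_finite_induct)
    (auto simp: tlift_zero[OF f] tlift_add[OF f]
      subspace_sumD[OF vector_space_fscale tensor_space_subspace])

lemma tlift_sum_tens:
  assumes f: "bil_on sA sB sC V W f" and "\<And>i. i \<in> I \<Longrightarrow> v i \<in> V" "\<And>i. i \<in> I \<Longrightarrow> w i \<in> W"
  shows "tlift sA sB V W f (\<Sum>i\<in>I. tens sA sB (v i) (w i)) = (\<Sum>i\<in>I. f (v i) (w i))"
  using assms by (subst tlift_sum[OF f]) (auto simp: tens_in_tensor_space tlift_tens[OF f])

lemma tlift_lsum_tensors:
  assumes f: "bil_on sA sB sC V W f" and T: "\<And>v w. T v w \<in> tensor_space sA sB V W"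
  shows "tlift sA sB V W f (lsum T ps) = lsum (\<lambda>v w. tlift sA sB V W f (T v w)) ps"
proof -
  show ?thesis
  proof (induction ps)
    case Nil
    show ?case
      unfolding lsum_Nil by (rule tlift_zero[OF f])
  next
    case (Cons p ps)
    then show ?case
      by (cases p) (simp only: lsum_Cons tlift_add[OF f T lsum_in_tensor_space[OF T]])
  qed
qed

section \<open>Sweedler calculus\<close>

text \<open>The expansion of the coproduct chosen by \<open>tlift\<close>, named independently of
  the integrand. With it \<open>sw\<close> is an ordinary finite sum, hence additive in the
  integrand and interchangeable with other sums without bilinearity.\<close>

definition crep ::
  "('k::field, 'a::ab_group_add, 'z) bialg_scheme \<Rightarrow> 'a \<Rightarrow> ('a \<times> 'a) list" where
  "crep B a = (SOME ps. set ps \<subseteq> UNIV \<times> UNIV \<and> cop B a = (\<Sum>(v, w) \<leftarrow> ps. tens (scl B) (scl B) v w))"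

lemma sw_crep: "sw B f a = lsum f (crep B a)"
  by (simp add: sw_def tlift_def crep_def)

lemma sw_apply: "sw B f a x = sw B (\<lambda>u v. f u v x) a"
  unfolding sw_crep by (rule lsum_apply)

lemma lin_sw: "lin s1 s2 h \<Longrightarrow> h (sw B f a) = sw B (\<lambda>x y. h (f x y)) a"
  unfolding sw_crep by (rule lin_lsum)

lemma sw_add: "sw B (\<lambda>x y. f x y + g x y) a = sw B f a + sw B g a"
  unfolding sw_crep by (rule lsum_add)

lemma sw_zero: "sw B (\<lambda>x y. 0) a = 0"
  unfolding sw_crep by (rule lsum_zero)

lemma sw_sum: "sw B (\<lambda>x y. \<Sum>i\<in>I. f i x y) a = (\<Sum>i\<in>I. sw B (f i) a)"
  unfolding sw_crep by (rule lsum_sum)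

lemma sw_swap:
  "sw B (\<lambda>x y. sw C (\<lambda>u v. f x y u v) b) a = sw C (\<lambda>u v. sw B (\<lambda>x y. f x y u v) a) b"
  unfolding sw_crep by (rule lsum_swap)

lemma sw_lin_param [lin_rules]:
  assumes "\<And>x y. lin s1 s2 (\<lambda>z. F z x y)"
  shows "lin s1 s2 (\<lambda>z. sw B (\<lambda>x y. F z x y) a)"
  by (rule linI) (simp_all add: lin_vs[OF assms] lin_add[OF assms] lin_scale[OF assms] sw_add
      lin_sw[OF lin_smult[OF lin_ident[OF lin_vs(2)[OF assms]]]])

lemma sw3_lin_param [lin_rules]:
  assumes "\<And>x y w. lin s1 s2 (\<lambda>z. F z x y w)"
  shows "lin s1 s2 (\<lambda>z. sw3 B (\<lambda>x y w. F z x y w) a)"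
  unfolding sw3_def by (intro lin_rules assms)

lemma sw3_add: "sw3 B (\<lambda>x y z. f x y z + g x y z) a = sw3 B f a + sw3 B g a"
  unfolding sw3_def by (simp add: sw_add)

lemma sw3_sum: "sw3 B (\<lambda>x y z. \<Sum>i\<in>I. f i x y z) a = (\<Sum>i\<in>I. sw3 B (f i) a)"
  unfolding sw3_def by (simp add: sw_sum)

lemma lin_sw3: "lin s1 s2 h \<Longrightarrow> h (sw3 B f a) = sw3 B (\<lambda>x y z. h (f x y z)) a"
  unfolding sw3_def by (simp add: lin_sw)

section \<open>Sweedler sums in a bialgebra\<close>

locale bialg =
  fixes B :: "('k::field, 'a::ring_1, 'z) bialg_scheme"
  assumes bialgebra: "bialgebra B"
begin

lemma vs [lin_rules]: "vector_space (scl B)"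
  using bialgebra by (simp add: bialgebra_def algebra_def)

lemmas lin_id = lin_ident[OF vs]

sublocale vector_space "scl B"
  by (rule vs)

lemma scl_mult_left: "scl B c a * b = scl B c (a * b)"
  and scl_mult_right: "a * scl B c b = scl B c (a * b)"
  using bialgebra by (auto simp: bialgebra_def algebra_def)

lemma lin_mult [lin_rules]:
  assumes "lin s (scl B) f"
  shows "lin s (scl B) (\<lambda>z. f z * b)" "lin s (scl B) (\<lambda>z. b * f z)"
  by (rule linI; simp add: lin_vs[OF assms] vs lin_add[OF assms] lin_scale[OF assms]
      scl_mult_left scl_mult_right algebra_simps)+

lemma lin_cop: "lin (scl B) fscale (cop B)"
  using bialgebra by (simp add: bialgebra_def)

lemma lin_cou [lin_rules]: "lin s (scl B) f \<Longrightarrow> lin s (*) (\<lambda>z. cou B (f z))"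
  using bialgebra by (rule_tac lin_comp[of "scl B"]) (simp_all add: bialgebra_def)

lemmas lin_cou' = lin_cou[OF lin_id]

lemma cou_one: "cou B 1 = 1" and cou_mult: "cou B (a * b) = cou B a * cou B b"
  using bialgebra by (auto simp: bialgebra_def)

lemma cop_crep: "cop B a = lsum (tens (scl B) (scl B)) (crep B a)"
proof -
  let ?P = "\<lambda>ps. set ps \<subseteq> UNIV \<times> UNIV \<and> cop B a = lsum (tens (scl B) (scl B)) ps"
  have "cop B a \<in> tensor_space (scl B) (scl B) UNIV UNIV"
    using bialgebra by (simp add: bialgebra_def)
  then have "\<exists>ps. ?P ps"
    by (simp add: tensor_space_list[OF vs vs subspace_univ subspace_univ] vs)
  then have "?P (crep B a)"
    unfolding crep_def by (rule someI_ex)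
  then show ?thesis by simp
qed

lemma cop_in: "cop B a \<in> tensor_space (scl B) (scl B) UNIV UNIV"
  using bialgebra by (simp add: bialgebra_def)

context
  fixes sC :: "'k \<Rightarrow> 'c::ab_group_add \<Rightarrow> 'c" and f
  assumes f1: "\<And>y. lin (scl B) sC (\<lambda>x. f x y)" and f2: "\<And>x. lin (scl B) sC (\<lambda>y. f x y)"
begin

lemma sw_bil_on: "bil_on (scl B) (scl B) sC UNIV UNIV f"
  by (intro bil_on_UNIV bilinI f1 f2)

lemma sw_lin' : "lin (scl B) sC (\<lambda>a. sw B f a)"
  using tlift_add[OF sw_bil_on cop_in cop_in] tlift_scale[OF sw_bil_on cop_in]
  by (intro linI) (auto simp: vs lin_vs[OF f1] sw_def lin_add[OF lin_cop] lin_scale[OF lin_cop])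

lemma sw_one: "sw B f 1 = f 1 1"
  using tlift_tens[OF sw_bil_on, of 1 1] bialgebra by (simp add: sw_def bialgebra_def)

lemma sw_grouplike: "grouplike B g \<Longrightarrow> sw B f g = f g g"
  using tlift_tens[OF sw_bil_on, of g g] by (simp add: sw_def grouplike_def)

lemma sw_cop_sum:
  "cop B a = (\<Sum>i\<in>I. tens (scl B) (scl B) (x i) (y i)) \<Longrightarrow> sw B f a = (\<Sum>i\<in>I. f (x i) (y i))"
  using tlift_sum_tens[OF sw_bil_on, of I x y] by (simp add: sw_def)

lemma sw_mult: "sw B f (a * b) = sw B (\<lambda>x y. sw B (\<lambda>u v. f (x * u) (y * v)) b) a"
proof -
  have "cop B (a * b) =
      lsum (\<lambda>x y. lsum (\<lambda>u v. tens (scl B) (scl B) (x * u) (y * v)) (crep B b)) (crep B a)"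
    using bialgebra by (simp add: bialgebra_def sw_crep)
  moreover have "lsum (\<lambda>u v. tens (scl B) (scl B) (x * u) (y * v)) ps
      \<in> tensor_space (scl B) (scl B) UNIV UNIV" for x y ps
    by (intro lsum_in_tensor_space tens_in_tensor_space UNIV_I)
  ultimately show ?thesis
    unfolding sw_def[of _ f "a * b"]
    by (simp add: tlift_lsum_tensors[OF sw_bil_on] tens_in_tensor_space tlift_tens[OF sw_bil_on]
        sw_crep)
qed

end

text \<open>Unlike linearity in a parameter of the integrand, linearity in the element depends on
  bilinearity, as the expansions chosen for a + b, for a and for b are unrelated.\<close>

lemma sw_lin [lin_rules]:
  assumes "lin s (scl B) g" "\<And>y. lin (scl B) sC (\<lambda>x. f x y)" "\<And>x. lin (scl B) sC (\<lambda>y. f x y)"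
  shows "lin s sC (\<lambda>z. sw B f (g z))"
  by (rule lin_comp[OF sw_lin' assms(1)]) (rule assms)+

lemma sw3_lin [lin_rules]:
  assumes "lin s (scl B) g" "\<And>y z. lin (scl B) sC (\<lambda>x. f x y z)"
    "\<And>x z. lin (scl B) sC (\<lambda>y. f x y z)" "\<And>x y. lin (scl B) sC (\<lambda>z. f x y z)"
  shows "lin s sC (\<lambda>z. sw3 B f (g z))"
  unfolding sw3_def by (intro lin_rules assms)

lemma
  fixes T :: "'n::finite \<Rightarrow> 'n \<Rightarrow> 'a"
  assumes T: "\<And>i j. cop B (T i j) = (\<Sum>a\<in>UNIV. tens (scl B) (scl B) (T i a) (T a j))"
  shows sw_matrix: "(\<And>y. lin (scl B) sC (\<lambda>x. f x y)) \<Longrightarrow> (\<And>x. lin (scl B) sC (\<lambda>y. f x y)) \<Longrightarrow>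
      sw B f (T i j) = (\<Sum>a\<in>UNIV. f (T i a) (T a j))"
    and sw3_matrix: "(\<And>y z. lin (scl B) sC (\<lambda>x. g x y z)) \<Longrightarrow>
      (\<And>x z. lin (scl B) sC (\<lambda>y. g x y z)) \<Longrightarrow> (\<And>x y. lin (scl B) sC (\<lambda>z. g x y z)) \<Longrightarrow>
      sw3 B g (T i j) = (\<Sum>a\<in>UNIV. \<Sum>b\<in>UNIV. g (T i a) (T a b) (T b j))"
proof -
  show sw: "sw B f (T i j) = (\<Sum>a\<in>UNIV. f (T i a) (T a j))"
    if "\<And>y. lin (scl B) sC (\<lambda>x. f x y)" "\<And>x. lin (scl B) sC (\<lambda>y. f x y)" for f i j
    by (rule sw_cop_sum[OF that T])
  assume g: "\<And>y z. lin (scl B) sC (\<lambda>x. g x y z)" "\<And>x z. lin (scl B) sC (\<lambda>y. g x y z)"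
    "\<And>x y. lin (scl B) sC (\<lambda>z. g x y z)"
  have "sw3 B g (T i j) = (\<Sum>b\<in>UNIV. \<Sum>a\<in>UNIV. g (T i a) (T a b) (T b j))"
    unfolding sw3_def
    by (subst sw, intro sw_lin[of _ _ sC] lin_rules g, intro lin_rules g, subst sw, intro g, intro g,
        rule refl)
  then show "sw3 B g (T i j) = (\<Sum>a\<in>UNIV. \<Sum>b\<in>UNIV. g (T i a) (T a b) (T b j))"
    by (subst sum.swap)
qed

lemma sw_cou_left: "lin (scl B) sC f \<Longrightarrow> sw B (\<lambda>x y. sC (cou B x) (f y)) a = f a"
  using bialgebra lin_sw[of "scl B" sC f B "\<lambda>x y. scl B (cou B x) y" a]
  by (simp add: bialgebra_def lin_scale)

lemma sw_cou_right: "lin (scl B) sC f \<Longrightarrow> sw B (\<lambda>x y. sC (cou B y) (f x)) a = f a"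
  using bialgebra lin_sw[of "scl B" sC f B "\<lambda>x y. scl B (cou B y) x" a]
  by (simp add: bialgebra_def lin_scale)

text \<open>Coassociativity is an equation between functionals on trilinear scalar forms. Evaluating
  it at the composite of f with each linear functional \<phi> gives it for f with values in any
  space.\<close>

lemma sw_coassoc:
  fixes f :: "'a \<Rightarrow> 'a \<Rightarrow> 'a \<Rightarrow> 'c::ab_group_add"
  assumes f1: "\<And>y z. lin (scl B) sC (\<lambda>x. f x y z)" and f2: "\<And>x z. lin (scl B) sC (\<lambda>y. f x y z)"
    and f3: "\<And>x y. lin (scl B) sC (\<lambda>z. f x y z)"
  shows "sw B (\<lambda>x y. sw B (\<lambda>u v. f u v y) x) a = sw B (\<lambda>x y. sw B (\<lambda>u v. f x u v) y) a"
proof (rule eq_by_functionals[OF lin_vs(2)[OF f1]])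
  fix \<phi> :: "'c \<Rightarrow> 'k" assume \<phi>: "lin sC (*) \<phi>"
  let ?\<beta> = "\<lambda>x y z. \<phi> (f x y z)"
  have "trilin (scl B) (scl B) (scl B) ?\<beta>"
    unfolding trilin_def by (intro conjI allI lin_comp[OF \<phi>] f1 f2 f3)
  then have t: "tens3 (scl B) (scl B) (scl B) x y z ?\<beta> = ?\<beta> x y z" for x y z
    by (simp add: tens3_def)
  have "sw B (\<lambda>x y. sw B (\<lambda>u v. tens3 (scl B) (scl B) (scl B) u v y) x) a =
      sw B (\<lambda>x y. sw B (\<lambda>u v. tens3 (scl B) (scl B) (scl B) x u v) y) a"
    using bialgebra by (simp add: bialgebra_def)
  from fun_cong[OF this, of ?\<beta>]
  show "\<phi> (sw B (\<lambda>x y. sw B (\<lambda>u v. f u v y) x) a) = \<phi> (sw B (\<lambda>x y. sw B (\<lambda>u v. f x u v) y) a)"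
    by (simp add: sw_apply t lin_sw[OF \<phi>])
qed

lemma sw3_right:
  assumes "\<And>y z. lin (scl B) sC (\<lambda>x. f x y z)" "\<And>x z. lin (scl B) sC (\<lambda>y. f x y z)"
    "\<And>x y. lin (scl B) sC (\<lambda>z. f x y z)"
  shows "sw3 B f a = sw B (\<lambda>x y. sw B (\<lambda>u v. f x u v) y) a"
  unfolding sw3_def by (rule sw_coassoc[OF assms])

lemma sw3_mult:
  assumes "\<And>y z. lin (scl B) sC (\<lambda>x. f x y z)" "\<And>x z. lin (scl B) sC (\<lambda>y. f x y z)"
    "\<And>x y. lin (scl B) sC (\<lambda>z. f x y z)"
  shows "sw3 B f (a * b) =
    sw3 B (\<lambda>x y z. sw3 B (\<lambda>u v w. f (x * u) (y * v) (z * w)) b) a"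
proof -
  have "sw3 B f (a * b) = sw B (\<lambda>x y. sw B (\<lambda>u v. sw B (\<lambda>p q. f p q (y * v)) (x * u)) b) a"
    unfolding sw3_def by (rule sw_mult[of sC]) (intro lin_rules assms)+
  also have "\<dots> = sw B (\<lambda>x y. sw B (\<lambda>u v.
      sw B (\<lambda>p q. sw B (\<lambda>p' q'. f (p * p') (q * q') (y * v)) u) x) b) a"
    by (subst sw_mult[of sC]) (rule assms refl)+
  also have "\<dots> = sw B (\<lambda>x y. sw B (\<lambda>p q. sw B (\<lambda>u v.
      sw B (\<lambda>p' q'. f (p * p') (q * q') (y * v)) u) b) x) a"
    by (subst sw_swap) (rule refl)
  finally show ?thesis
    unfolding sw3_def .
qed

end

lemma sw_hom:
  assumes "bialgebra_hom B C p" "bialg B" "bialg C"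
    and f: "\<And>y. lin (scl C) sC (\<lambda>x. f x y)" "\<And>x. lin (scl C) sC (\<lambda>y. f x y)"
  shows "sw C f (p a) = sw B (\<lambda>x y. f (p x) (p y)) a"
proof -
  interpret B: bialg B by fact
  interpret C: bialg C by fact
  have "cop C (p a) = lsum (\<lambda>x y. tens (scl C) (scl C) (p x) (p y)) (crep B a)"
    using assms(1) by (simp add: bialgebra_hom_def sw_crep)
  then show ?thesis
    unfolding sw_def[of C]
    by (simp add: tlift_lsum_tensors[OF C.sw_bil_on[OF f]] tens_in_tensor_space
        tlift_tens[OF C.sw_bil_on[OF f]] sw_crep)
qed

lemma sw3_hom:
  assumes "bialgebra_hom B C p" "bialg B" "bialg C"
    and f: "\<And>y z. lin (scl C) sC (\<lambda>x. f x y z)" "\<And>x z. lin (scl C) sC (\<lambda>y. f x y z)"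
    "\<And>x y. lin (scl C) sC (\<lambda>z. f x y z)"
  shows "sw3 C f (p a) = sw3 B (\<lambda>x y z. f (p x) (p y) (p z)) a"
proof -
  interpret C: bialg C by fact
  show ?thesis
    unfolding sw3_def
    by (subst sw_hom[OF assms(1-3), of sC], intro C.sw_lin[of _ _ sC] lin_rules f,
        intro lin_rules f, subst sw_hom[OF assms(1-3), of sC], intro f, intro f, rule refl)
qed

lemma bialgebra_homD:
  assumes "bialgebra_hom B C p"
  shows "lin (scl B) (scl C) p" "p 1 = 1" "p (a * b) = p a * p b" "cou C (p a) = cou B a"
  using assms by (auto simp: bialgebra_hom_def)

section \<open>The antipode\<close>

locale hopf =
  fixes H :: "('k::field, 'a::ring_1, 'z) hopf_scheme"
  assumes hopf: "hopf_algebra H"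
begin

sublocale bialg H
  using hopf by unfold_locales (simp add: hopf_algebra_def)

abbreviation S where "S \<equiv> antip H"
abbreviation \<epsilon> where "\<epsilon> \<equiv> cou H"

lemma lin_antip [lin_rules]: "lin s (scl H) f \<Longrightarrow> lin s (scl H) (\<lambda>z. antip H (f z))"
  using hopf by (rule_tac lin_comp[of "scl H"]) (simp_all add: hopf_algebra_def)

lemma antip_left: "sw H (\<lambda>x y. S x * y) a = scl H (\<epsilon> a) 1"
  and antip_right: "sw H (\<lambda>x y. x * S y) a = scl H (\<epsilon> a) 1"
  using hopf by (auto simp: hopf_algebra_def)

lemma antip_one: "S 1 = 1"
proof -
  have "sw H (\<lambda>x y. S x * y) 1 = S 1 * 1"
    by (rule sw_one[of "scl H"]) (intro lin_rules)+
  then show ?thesis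
    by (simp add: antip_left cou_one)
qed

lemma cou_antip: "\<epsilon> (S a) = \<epsilon> a"
proof -
  have "\<epsilon> (sw H (\<lambda>x y. S x * y) a) = sw H (\<lambda>x y. \<epsilon> y * \<epsilon> (S x)) a"
    by (simp add: lin_sw[OF lin_cou'] cou_mult mult.commute)
  also have "\<dots> = \<epsilon> (S a)"
    by (rule sw_cou_right[of "(*)"]) (intro lin_rules)
  finally show ?thesis
    by (simp add: antip_left lin_scale[OF lin_cou'] cou_one)
qed

text \<open>Both sides are convolution inverses of the multiplication: in
  \<open>S(a1 b1) a2 b2 S(b3) S(a3)\<close>, contracting legs 1 and 2 leaves S(b) S(a), contracting
  legs 2 and 3 leaves S(ab).\<close>

lemma antip_mult: "S (a * b) = S b * S a"
proof -
  let ?F = "\<lambda>a1 a2 a3 b1 b2 b3. S (a1 * b1) * (a2 * b2) * (S b3 * S a3)"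
  have "sw3 H (\<lambda>a1 a2 a3. sw3 H (\<lambda>b1 b2 b3. ?F a1 a2 a3 b1 b2 b3) b) a =
      sw H (\<lambda>x a3. sw H (\<lambda>y b3. sw H (\<lambda>u v. S u * v) (x * y) * (S b3 * S a3)) b) a"
  proof -
    have "sw H (\<lambda>u v. S u * v) (x * y) * (S b3 * S a3) =
        sw H (\<lambda>a1 a2. sw H (\<lambda>b1 b2. ?F a1 a2 a3 b1 b2 b3) y) x" for x y b3 a3
      by (subst sw_mult[of "scl H"], intro lin_rules, intro lin_rules)
        (simp add: lin_sw[OF lin_mult(1)[OF lin_id]])
    then show ?thesis
      unfolding sw3_def by (subst sw_swap) simp
  qed
  also have "\<dots> = sw H (\<lambda>x a3. scl H (\<epsilon> x) (sw H (\<lambda>y b3. scl H (\<epsilon> y) (S b3 * S a3)) b)) a"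
    by (simp add: antip_left cou_mult scl_mult_left lin_sw[OF lin_smult[OF lin_id]])
  also have "\<dots> = sw H (\<lambda>x a3. scl H (\<epsilon> x) (S b * S a3)) a"
    by (subst sw_cou_left[of "scl H" "\<lambda>y. S y * c" for c]) (intro lin_rules refl)+
  also have "\<dots> = S b * S a"
    by (rule sw_cou_left[of "scl H" "\<lambda>y. S b * S y"]) (intro lin_rules)
  finally have *: "sw3 H (\<lambda>a1 a2 a3. sw3 H (\<lambda>b1 b2 b3. ?F a1 a2 a3 b1 b2 b3) b) a = S b * S a" .
  have inner: "sw H (\<lambda>b2 b3. a2 * b2 * (S b3 * S a3)) y = scl H (\<epsilon> y) (a2 * S a3)" for a2 a3 y
  proof -
    have "a2 * sw H (\<lambda>b2 b3. b2 * S b3) y * S a3 = sw H (\<lambda>b2 b3. a2 * (b2 * S b3) * S a3) y"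
      by (rule lin_sw[OF lin_mult(1)[OF lin_mult(2)[OF lin_id]]])
    then show ?thesis
      by (simp add: mult.assoc[symmetric]) (simp add: antip_right scl_mult_left scl_mult_right)
  qed
  have inner': "sw H (\<lambda>b2 b3. ?F a1 a2 a3 b1 b2 b3) y =
      scl H (\<epsilon> y) (S (a1 * b1) * (a2 * S a3))" for a1 a2 a3 b1 y
    using lin_sw[OF lin_mult(2)[OF lin_id, of "S (a1 * b1)"], of H
        "\<lambda>b2 b3. a2 * b2 * (S b3 * S a3)" y]
    by (simp add: inner[unfolded mult.assoc] scl_mult_right mult.assoc)
  have "sw3 H (\<lambda>a1 a2 a3. sw3 H (\<lambda>b1 b2 b3. ?F a1 a2 a3 b1 b2 b3) b) a =
      sw3 H (\<lambda>a1 a2 a3. sw H (\<lambda>b1 y. sw H (\<lambda>b2 b3. ?F a1 a2 a3 b1 b2 b3) y) b) a"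
    by (subst sw3_right[of "scl H" "\<lambda>b1 b2 b3. ?F a1 a2 a3 b1 b2 b3" for a1 a2 a3])
      (intro lin_rules refl)+
  also have "\<dots> = sw3 H (\<lambda>a1 a2 a3. sw H (\<lambda>b1 y. scl H (\<epsilon> y) (S (a1 * b1) * (a2 * S a3))) b) a"
    by (simp only: inner')
  also have "\<dots> = sw3 H (\<lambda>a1 a2 a3. S (a1 * b) * (a2 * S a3)) a"
    by (subst sw_cou_right[of "scl H" "\<lambda>y. S (a1 * y) * c" for a1 c]) (intro lin_rules refl)+
  also have "\<dots> = sw H (\<lambda>a1 y. sw H (\<lambda>a2 a3. S (a1 * b) * (a2 * S a3)) y) a"
    by (rule sw3_right[of "scl H"]) (intro lin_rules)+
  also have "\<dots> = sw H (\<lambda>a1 y. scl H (\<epsilon> y) (S (a1 * b))) a"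
    by (simp add: lin_sw[OF lin_mult(2)[OF lin_id], symmetric] antip_right scl_mult_right)
  also have "\<dots> = S (a * b)"
    by (rule sw_cou_right[of "scl H" "\<lambda>y. S (y * b)"]) (intro lin_rules)
  finally show ?thesis
    using * by simp
qed

end

text \<open>Both maps invert p under convolution: \<open>S'(p a1) p(a2) p(S a3)\<close> is evaluated
  by contracting legs 1 and 2, or legs 2 and 3.\<close>

lemma antip_hom:
  assumes p: "bialgebra_hom H H' p" and "hopf H" "hopf H'"
  shows "antip H' (p a) = p (antip H a)"
proof -
  interpret H: hopf H by fact
  interpret H': hopf H' by fact
  note pD = bialgebra_homD[OF p]
  have p_lin [lin_rules]: "lin s (scl H) f \<Longrightarrow> lin s (scl H') (\<lambda>z. p (f z))" for s f
    by (rule lin_comp[OF pD(1)])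
  let ?F = "\<lambda>x y z. antip H' (p x) * p y * p (antip H z)"
  have "sw H (\<lambda>x y. antip H' (p x) * p y) u = scl H' (cou H u) 1" for u
    using H'.antip_left[of "p u"]
      sw_hom[OF p H.bialg_axioms H'.bialg_axioms, of "scl H'" "\<lambda>x y. antip H' x * y" u]
    by (simp add: pD(4) lin_rules)
  then have "sw3 H ?F a = sw H (\<lambda>x y. scl H' (cou H x) (p (antip H y))) a"
    unfolding sw3_def
    by (simp add: lin_sw[OF H'.lin_mult(1)[OF lin_ident[OF H'.vs]], symmetric] H'.scl_mult_left)
  also have "\<dots> = p (antip H a)"
    by (rule H.sw_cou_left) (intro lin_rules)
  finally have "sw3 H ?F a = p (antip H a)" .
  moreover have "sw3 H ?F a = sw H (\<lambda>x y. sw H (\<lambda>u v. ?F x u v) y) a"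
    by (rule H.sw3_right[of "scl H'"]) (intro lin_rules)+
  moreover have "sw H (\<lambda>u v. ?F x u v) y = scl H' (cou H y) (antip H' (p x))" for x y
  proof -
    have "sw H (\<lambda>u v. ?F x u v) y = antip H' (p x) * p (sw H (\<lambda>u v. u * antip H v) y)"
      by (simp add: lin_sw[OF pD(1)] lin_sw[OF H'.lin_mult(2)[OF lin_ident[OF H'.vs]]]
          pD(3) mult.assoc)
    then show ?thesis
      by (simp add: H.antip_right lin_scale[OF pD(1)] pD(2) H'.scl_mult_right)
  qed
  moreover have "sw H (\<lambda>x y. scl H' (cou H y) (antip H' (p x))) a = antip H' (p a)"
    by (rule H.sw_cou_right) (intro lin_rules)
  ultimately show ?thesis by simp
qed

section \<open>Matrix coalgebras and coquasitriangular structures\<close>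

abbreviation (input) sum_univ :: "('n::finite \<Rightarrow> 'a::comm_monoid_add) \<Rightarrow> 'a" (binder "SUM " 10)
  where "sum_univ f \<equiv> sum f UNIV"

lemma sum_kd:
  fixes f :: "'n::finite \<Rightarrow> 'a::ring_1"
  shows "(SUM a. kd i a * f a) = f i" "(SUM a. kd a i * f a) = f i"
    "(SUM a. f a * kd i a) = f i" "(SUM a. f a * kd a i) = f i"
  by (simp_all add: kd_def if_distrib[of "\<lambda>x. x * _"] if_distrib[of "\<lambda>x. _ * x"] cong: if_cong)

lemma sum_kd_scale:
  assumes "vector_space s"
  shows "(SUM a. s (kd i a) (f a)) = f (i::'n::finite)" "(SUM a. s (kd a i) (f a)) = f i"
proof -
  interpret vector_space s by fact
  have "s (kd i a) (f a) = (if i = a then f a else 0)"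
    "s (kd a i) (f a) = (if a = i then f a else 0)" for a
    by (auto simp: kd_def)
  then show "(SUM a. s (kd i a) (f a)) = f i" "(SUM a. s (kd a i) (f a)) = f i"
    by simp_all
qed

lemma kd_commute: "kd i j = kd j i"
  by (auto simp: kd_def)

lemma sum_swap4:
  "(\<Sum>p\<in>A. \<Sum>q\<in>B. \<Sum>x\<in>C. \<Sum>y\<in>D. f p q x y) = (\<Sum>x\<in>C. \<Sum>y\<in>D. \<Sum>p\<in>A. \<Sum>q\<in>B. f p q x y)"
  unfolding sum.cartesian_product
  by (rule sum.reindex_bij_witness[of _ "\<lambda>(c, d, a, b). (a, b, c, d)" "\<lambda>(a, b, c, d). (c, d, a, b)"])
    auto

lemma sum_rotate3: "(\<Sum>a\<in>A. \<Sum>b\<in>B. \<Sum>s\<in>C. f a b s) = (\<Sum>s\<in>C. \<Sum>a\<in>A. \<Sum>b\<in>B. f a b s)"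
  unfolding sum.cartesian_product
  by (rule sum.reindex_bij_witness[of _ "\<lambda>(s, a, b). (a, b, s)" "\<lambda>(a, b, s). (s, a, b)"]) auto

lemma sum_swap5:
  "(\<Sum>a\<in>A. \<Sum>b\<in>B. \<Sum>w\<in>C. \<Sum>v\<in>D. \<Sum>s\<in>E. f a b w v s) =
   (\<Sum>w\<in>C. \<Sum>v\<in>D. \<Sum>s\<in>E. \<Sum>a\<in>A. \<Sum>b\<in>B. f a b w v s)"
  unfolding sum.cartesian_product
  by (rule sum.reindex_bij_witness[of _ "\<lambda>(w, v, s, a, b). (a, b, w, v, s)"
        "\<lambda>(a, b, w, v, s). (w, v, s, a, b)"]) auto

lemma rmat_cong: "P = Q \<Longrightarrow> P i j k l = Q i j k l"
  by simp

lemma rmat_mult_assoc: "rmat_mult (rmat_mult P Q) U = rmat_mult P (rmat_mult Q U)"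
proof (intro ext)
  fix i j k l
  have "rmat_mult (rmat_mult P Q) U i j k l =
      (SUM a b c d. P i c k d * Q c a d b * U a j b l)"
    by (simp add: rmat_mult_def sum_distrib_right)
  also have "\<dots> = (SUM c d a b. P i c k d * Q c a d b * U a j b l)"
    by (rule sum_swap4)
  finally show "rmat_mult (rmat_mult P Q) U i j k l = rmat_mult P (rmat_mult Q U) i j k l"
    by (simp add: rmat_mult_def sum_distrib_left mult.assoc)
qed

lemma rmat_one_left: "rmat_mult rmat_one P = P" and rmat_one_right: "rmat_mult P rmat_one = P"
  by (simp_all add: fun_eq_iff rmat_mult_def rmat_one_def mult.assoc sum_kd
      flip: sum_distrib_left sum_distrib_right)
    (simp add: sum_kd flip: mult.assoc sum_distrib_left)

section \<open>Matrix coalgebras inside a Hopf algebra\<close>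

locale hopf_mat = hopf H
  for H :: "('k::field, 'a::ring_1, 'z) hopf_scheme" +
  fixes T :: "'n::finite \<Rightarrow> 'n \<Rightarrow> 'a"
  assumes cop_T: "cop H (T i j) = (SUM a. tens (scl H) (scl H) (T i a) (T a j))"
    and cou_T: "cou H (T i j) = kd i j"
begin

lemmas sw_T = sw_matrix[of T, OF cop_T]
lemmas sw3_T = sw3_matrix[of T, OF cop_T]

lemma scl_kd: "scl H (kd i j) 1 = kd i j"
  by (auto simp: kd_def)

lemma T_S: "(SUM a. T i a * S (T a j)) = kd i j"
  using antip_right[of "T i j"]
  by (subst (asm) sw_T[of "scl H"], (intro lin_rules)+) (simp add: cou_T scl_kd)

lemma S_T: "(SUM a. S (T i a) * T a j) = kd i j"
  using antip_left[of "T i j"]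
  by (subst (asm) sw_T[of "scl H"], (intro lin_rules)+) (simp add: cou_T scl_kd)

text \<open>The array E inserts \<open>T S(T)\<close> into both legs of the coproduct of S(T i x).
  Contracting the inserted factors returns the coproduct of S(T i j), while recombining
  \<open>S(T i x) T x w\<close> into the unit first leaves the reversed expansion.\<close>

lemma sw_S_T:
  assumes f: "\<And>y. lin (scl H) sC (\<lambda>x. f x y)" "\<And>x. lin (scl H) sC (\<lambda>y. f x y)"
  shows "sw H f (S (T i j)) = (SUM a. f (S (T a j)) (S (T i a)))"
proof -
  have vsC [lin_rules]: "vector_space sC"
    by (rule lin_vs[OF f(1)])
  have f' [lin_rules]: "lin (scl H) (scl H) g \<Longrightarrow> lin (scl H) sC (\<lambda>x. f (g x) y)"
    "lin (scl H) (scl H) g \<Longrightarrow> lin (scl H) sC (\<lambda>x. f y (g x))" for g y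
    by (rule lin_comp[OF f(1)] lin_comp[OF f(2)], assumption)+
  interpret C: vector_space sC by (rule vsC)
  have f_sum: "(\<Sum>a\<in>I. f (g a) y) = f (\<Sum>a\<in>I. g a) y"
    "(\<Sum>a\<in>I. f y (g a)) = f y (\<Sum>a\<in>I. g a)" for g :: "'n \<Rightarrow> 'a" and y I
    by (rule lin_sum[OF f(1), symmetric] lin_sum[OF f(2), symmetric])+
  define E where "E = (\<lambda>x y w z. sw H (\<lambda>u v. f (u * (T x y * S (T z j))) (v * (T y w * S (T w z)))) (S (T i x)))"
  have lin_E: "(SUM w. E x y w z) = sC (kd y z) (sw H (\<lambda>u v. f (u * (T x y * S (T z j))) v) (S (T i x)))"
    for x y z
  proof -
    have "(SUM w. E x y w z) =
        sw H (\<lambda>u v. f (u * (T x y * S (T z j))) (v * (SUM w. T y w * S (T w z)))) (S (T i x))"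
      unfolding E_def by (simp add: f_sum sum_distrib_left flip: sw_sum)
    also have "\<dots> = sw H (\<lambda>u v. sC (kd y z) (f (u * (T x y * S (T z j))) v)) (S (T i x))"
      unfolding T_S by (simp add: kd_def lin_zero[OF f(2)] if_distrib cong: if_cong)
    also have "\<dots> = sC (kd y z) (sw H (\<lambda>u v. f (u * (T x y * S (T z j))) v) (S (T i x)))"
      by (rule lin_sw[OF lin_smult[OF lin_ident[OF vsC]], symmetric])
    finally show ?thesis .
  qed
  have "(SUM x y z w. E x y w z) =
      (SUM x y. sw H (\<lambda>u v. f (u * (T x y * S (T y j))) v) (S (T i x)))"
    by (simp add: lin_E sum_kd_scale[OF vsC])
  also have "\<dots> = (SUM x. sw H (\<lambda>u v. f (u * kd x j) v) (S (T i x)))"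
    by (simp add: f_sum T_S flip: sw_sum sum_distrib_left)
  also have "\<dots> = (SUM x. sC (kd x j) (sw H f (S (T i x))))"
  proof (rule sum.cong)
    have "f 0 = (\<lambda>_. 0)"
      by (rule ext) (rule lin_zero[OF f(1)])
    then show "sw H (\<lambda>u v. f (u * kd x j) v) (S (T i x)) = sC (kd x j) (sw H f (S (T i x)))" for x
      by (simp add: kd_def sw_zero)
  qed simp
  finally have 1: "(SUM x y z w. E x y w z) = sw H f (S (T i j))"
    by (simp add: sum_kd_scale[OF vsC])
  have "(SUM x y. E x y w z) = sC (kd i w) (f (S (T z j)) (S (T w z)))" for w z
  proof -
    let ?f = "\<lambda>u v. f (u * S (T z j)) (v * S (T w z))"
    have lin_f': "lin (scl H) sC (\<lambda>a. sw H ?f a)"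
      by (intro lin_rules)
    have "(SUM y. E x y w z) = sw H ?f (S (T i x) * T x w)" for x
      unfolding E_def
      by (subst sw_mult[of sC], intro lin_rules, intro lin_rules,
          subst sw_T[of sC "\<lambda>u v. ?f (x * u) (y * v)" for x y], intro lin_rules, intro lin_rules,
          simp add: sw_sum mult.assoc)
    then have "(SUM x y. E x y w z) = sw H ?f (kd i w)"
      by (simp add: lin_sum[OF lin_f', symmetric] S_T)
    also have "\<dots> = sC (kd i w) (sw H ?f 1)"
      using lin_scale[OF lin_f', of "kd i w" 1] by (simp add: scl_kd)
    also have "sw H ?f 1 = f (S (T z j)) (S (T w z))"
      by (subst sw_one[of sC], (intro lin_rules)+) simp
    finally show ?thesis .
  qed
  then have "(SUM z w x y. E x y w z) =
      (SUM z. f (S (T z j)) (S (T i z)))"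
    by (simp add: sum_kd_scale[OF vsC])
  moreover have "(SUM x y z w. E x y w z) =
      (SUM z w x y. E x y w z)"
    by (rule sum_swap4)
  ultimately show ?thesis
    using 1 by simp
qed

text \<open>The entries of the left adjoint coaction: T k l is sent to the sum of
  \<open>adm k m n l\<close> \<otimes> T m n. The outer indices (k, l) form the row and the inner
  indices (m, n) the column of a matrix coalgebra.\<close>

definition adm :: "'n \<Rightarrow> 'n \<Rightarrow> 'n \<Rightarrow> 'n \<Rightarrow> 'a" where
  "adm k m n l = T k m * S (T n l)"

lemma sw_adm:
  assumes f: "\<And>y. lin (scl H) sC (\<lambda>x. f x y)" "\<And>x. lin (scl H) sC (\<lambda>y. f x y)"
  shows "sw H f (adm k m n l) = (SUM p q. f (adm k p q l) (adm p m n q))"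
proof -
  have vsC [lin_rules]: "vector_space sC"
    by (rule lin_vs[OF f(1)])
  have f' [lin_rules]: "lin (scl H) (scl H) g \<Longrightarrow> lin (scl H) sC (\<lambda>x. f (g x) y)"
    "lin (scl H) (scl H) g \<Longrightarrow> lin (scl H) sC (\<lambda>x. f y (g x))" for g y
    by (rule lin_comp[OF f(1)] lin_comp[OF f(2)], assumption)+
  show ?thesis
    unfolding adm_def
    by (subst sw_mult[of sC], intro lin_rules, intro lin_rules,
        subst sw_S_T[of sC "\<lambda>u v. f (x * u) (y * v)" for x y], intro lin_rules, intro lin_rules,
        subst sw_T[of sC], intro lin_rules, intro lin_rules, rule refl)
qed

lemma cou_adm: "\<epsilon> (adm k m n l) = kd k m * kd n l"
  by (simp add: adm_def cou_mult cou_antip cou_T)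

end

section \<open>Coquasitriangular structures on matrix entries\<close>

locale coquasi = hopf H
  for H :: "('k::field, 'a::ring_1, 'z) hopf_scheme" +
  fixes r :: "'a \<Rightarrow> 'a \<Rightarrow> 'k"
  assumes coquasi: "coquasitriangular H r"
begin

lemma lin_r [lin_rules]:
  "lin s (scl H) f \<Longrightarrow> lin s (*) (\<lambda>z. r (f z) b)"
  "lin s (scl H) f \<Longrightarrow> lin s (*) (\<lambda>z. r a (f z))"
  using coquasi lin_comp unfolding coquasitriangular_def bilin_def by blast+

lemma r_mult_left: "r (a * b) c = sw H (\<lambda>c1 c2. r a c1 * r b c2) c"
  and r_mult_right: "r a (b * c) = sw H (\<lambda>a1 a2. r a1 c * r a2 b) a"
  using coquasi by (auto simp: coquasitriangular_def)

end

locale coquasi_mat = hopf_mat H T + coquasi H r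
  for H :: "('k::field, 'a::ring_1, 'z) hopf_scheme" and T :: "'n::finite \<Rightarrow> 'n \<Rightarrow> 'a" and r +
  assumes invertible_r: "\<exists>Ri. rmat_mult (\<lambda>i j k l. r (T i j) (T k l)) Ri = rmat_one"
begin

text \<open>The normalisation r(1, .) = \<epsilon> is not among the axioms in
  \<open>coquasitriangular\<close>. They make r(1, T) a left unit for the matrix r(T, T), and
  invertibility of the latter cancels it.\<close>

lemma r_one_T: "r 1 (T k l) = kd k l"
proof -
  obtain Ri where Ri: "rmat_mult (\<lambda>i j k l. r (T i j) (T k l)) Ri = rmat_one"
    using invertible_r by blast
  have 1: "(SUM a. r 1 (T k a) * r (T i j) (T a l)) = r (T i j) (T k l)" for i j k l
    using r_mult_left[of 1 "T i j" "T k l"]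
    by (subst (asm) sw_T[of "(*)"], (intro lin_rules)+) simp
  have 2: "rmat_mult (\<lambda>i j k l. kd i j * r 1 (T k l)) (\<lambda>i j k l. r (T i j) (T k l)) =
      (\<lambda>i j k l. r (T i j) (T k l))"
    by (simp add: rmat_mult_def fun_eq_iff mult.assoc sum_kd 1 flip: sum_distrib_left)
  have "(\<lambda>i j k l. kd i j * r 1 (T k l)) = rmat_one"
    using arg_cong[OF 2, of "\<lambda>P. rmat_mult P Ri"] by (simp add: rmat_mult_assoc Ri rmat_one_right)
  from rmat_cong[of _ _ k k k l, OF this] show ?thesis
    by (simp add: rmat_one_def kd_def)
qed

lemma r_T_one: "r (T k l) 1 = kd k l"
proof -
  obtain Ri where Ri: "rmat_mult (\<lambda>i j k l. r (T i j) (T k l)) Ri = rmat_one"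
    using invertible_r by blast
  have 1: "(SUM a. r (T i a) 1 * r (T a j) (T k l)) = r (T i j) (T k l)" for i j k l
    using r_mult_right[of "T i j" "T k l" 1]
    by (subst (asm) sw_T[of "(*)"], (intro lin_rules)+) simp
  have 2: "rmat_mult (\<lambda>i j k l. kd k l * r (T i j) 1) (\<lambda>i j k l. r (T i j) (T k l)) =
      (\<lambda>i j k l. r (T i j) (T k l))"
    by (simp add: rmat_mult_def fun_eq_iff mult.assoc sum_kd 1)
  have "(\<lambda>i j k l. kd k l * r (T i j) 1) = rmat_one"
    using arg_cong[OF 2, of "\<lambda>P. rmat_mult P Ri"] by (simp add: rmat_mult_assoc Ri rmat_one_right)
  from rmat_cong[of _ _ k l k k, OF this] show ?thesis
    by (simp add: rmat_one_def kd_def)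
qed

lemma r_one_one: "r 1 1 = 1"
proof -
  have r1: "r 1 (a * b) = r 1 b * r 1 a" for a b
    unfolding r_mult_right by (rule sw_one[of "(*)"]) (intro lin_rules)+
  have "r 1 (T i i * 1) = r 1 1 * r 1 (T i i)" for i :: 'n
    by (rule r1)
  then show ?thesis
    by (simp add: r_one_T) (simp add: kd_def)
qed

end

text \<open>Unitality on the whole algebra is assumed here because its proof depends on the case:
  for a quotient of A(R) words suffice, for the localisation the inverse determinant must be treated
  as well.\<close>

locale coquasi_unital = coquasi_mat H T r
  for H :: "('k::field, 'a::ring_1, 'z) hopf_scheme" and T :: "'n::finite \<Rightarrow> 'n \<Rightarrow> 'a" and r +
  assumes r_one_left: "r 1 a = cou H a" and r_one_right: "r a 1 = cou H a"
begin

text \<open>L(a) is a matrix with row (m, n) and column (k, l), multiplicative in a: a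
  representation on n by n matrices. It governs both the cocycle rule of tangent vectors and the
  action on right-invariant forms.\<close>

definition L :: "'n \<Rightarrow> 'n \<Rightarrow> 'n \<Rightarrow> 'n \<Rightarrow> 'a \<Rightarrow> 'k" where
  "L m n k l a = r (adm k m n l) a"

lemma lin_L [lin_rules]: "lin s (scl H) f \<Longrightarrow> lin s (*) (\<lambda>z. L m n k l (f z))"
  unfolding L_def by (intro lin_rules)

lemma L_one: "L m n k l 1 = kd k m * kd n l"
  by (simp add: L_def r_one_right cou_adm)

lemma L_mult: "L m n k l (a * b) = (SUM p q. L m n p q a * L p q k l b)"
  unfolding L_def r_mult_right
  by (subst sw_adm[of "(*)"], (intro lin_rules)+) (simp add: mult.commute)

text \<open>Contracting the inner indices of \<open>T S(T)\<close> gives the unit, so the trace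
  covector is fixed by L up to \<epsilon>. This is what leaves the plain term x(a) \<epsilon>(T k l)
  in the cocycle rule.\<close>

lemma L_trace: "(SUM p q. L p q k l v * kd p q) = \<epsilon> v * kd k l"
proof -
  have "(SUM p q. L p q k l v * kd p q) = (SUM p. L p p k l v)"
    by (simp add: sum_kd)
  also have "\<dots> = r (SUM p. T k p * S (T p l)) v"
    by (simp add: L_def adm_def lin_sum[OF lin_r(1)[OF lin_id]])
  also have "\<dots> = \<epsilon> v * kd k l"
    by (auto simp: T_S kd_def r_one_left lin_zero[OF lin_r(1)[OF lin_id]])
  finally show ?thesis .
qed

lemma L_antip: "sw H (\<lambda>x y. SUM p q. L m n p q (S x) * L p q k l y) a =
    \<epsilon> a * (kd k m * kd n l)"
proof -
  have "sw H (\<lambda>x y. SUM p q. L m n p q (S x) * L p q k l y) a =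
      L m n k l (sw H (\<lambda>x y. S x * y) a)"
    unfolding lin_sw[OF lin_L[OF lin_id]] L_mult ..
  then show ?thesis
    by (simp add: antip_left L_one lin_scale[OF lin_L[OF lin_id]])
qed

lemma L_antip_right: "sw H (\<lambda>x y. SUM p q. L m n p q x * L p q k l (S y)) a =
    \<epsilon> a * (kd k m * kd n l)"
proof -
  have "sw H (\<lambda>x y. SUM p q. L m n p q x * L p q k l (S y)) a =
      L m n k l (sw H (\<lambda>x y. x * S y) a)"
    unfolding lin_sw[OF lin_L[OF lin_id]] L_mult ..
  then show ?thesis
    by (simp add: antip_right L_one lin_scale[OF lin_L[OF lin_id]])
qed

lemma r_antip_left_inverse:
  "rmat_mult (\<lambda>i j k l. r (S (T i j)) (T k l)) (\<lambda>i j k l. r (T i j) (T k l)) = rmat_one"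
proof (intro ext)
  fix i j k l
  have "r (SUM a. S (T i a) * T a j) (T k l) =
      (SUM a b. r (S (T i a)) (T k b) * r (T a j) (T b l))"
    by (simp add: lin_sum[OF lin_r(1)[OF lin_id]] r_mult_left,
        subst sw_T[of "(*)"]) (intro lin_rules refl)+
  moreover have "r (kd i j) (T k l) = kd i j * kd k l"
    by (auto simp: kd_def r_one_T lin_zero[OF lin_r(1)[OF lin_id]])
  ultimately show "rmat_mult (\<lambda>i j k l. r (S (T i j)) (T k l)) (\<lambda>i j k l. r (T i j) (T k l)) i j k l =
      rmat_one i j k l"
    by (simp add: rmat_mult_def rmat_one_def S_T)
qed

lemma r_antip_right_inverse:
  "rmat_mult (\<lambda>i j k l. r (T i j) (T k l)) (\<lambda>i j k l. r (S (T i j)) (T k l)) = rmat_one"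
proof (intro ext)
  fix i j k l
  have "r (SUM a. T i a * S (T a j)) (T k l) =
      (SUM a b. r (T i a) (T k b) * r (S (T a j)) (T b l))"
    by (simp add: lin_sum[OF lin_r(1)[OF lin_id]] r_mult_left,
        subst sw_T[of "(*)"]) (intro lin_rules refl)+
  moreover have "r (kd i j) (T k l) = kd i j * kd k l"
    by (auto simp: kd_def r_one_T lin_zero[OF lin_r(1)[OF lin_id]])
  ultimately show "rmat_mult (\<lambda>i j k l. r (T i j) (T k l)) (\<lambda>i j k l. r (S (T i j)) (T k l)) i j k l =
      rmat_one i j k l"
    by (simp add: rmat_mult_def rmat_one_def T_S)
qed

lemma r_second_inverse':
  "(SUM a b. r (T i a) (T b l) * r (T a j) (S (T k b))) = kd i j * kd k l"
proof -
  have "r (T i j) (SUM b. S (T k b) * T b l) =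
      (SUM b a. r (T i a) (T b l) * r (T a j) (S (T k b)))"
    by (simp add: lin_sum[OF lin_r(2)[OF lin_id]] r_mult_right,
        subst sw_T[of "(*)"]) (intro lin_rules refl)+
  moreover have "r (T i j) (kd k l) = kd i j * kd k l"
    by (auto simp: kd_def r_T_one lin_zero[OF lin_r(2)[OF lin_id]])
  ultimately show ?thesis
    by (subst sum.swap) (simp add: S_T)
qed

text \<open>Both sides are inverse to the matrix r(S T, T): the left one by multiplicativity in the
  second argument, the right one by \<open>r_antip_left_inverse\<close>.\<close>

lemma r_antip_antip: "r (S (T i j)) (S (T k l)) = r (T i j) (T k l)"
proof -
  have "(SUM a b. r (S (T i a)) (S (T k b)) * r (S (T a j)) (T b l)) = kd i j * kd k l"
    for i j k l
  proof -
    have "r (S (T i j)) (SUM b. S (T k b) * T b l) =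
        (SUM b a. r (S (T a j)) (T b l) * r (S (T i a)) (S (T k b)))"
      by (simp add: lin_sum[OF lin_r(2)[OF lin_id]] r_mult_right,
          subst sw_S_T[of "(*)"]) (intro lin_rules refl)+
    moreover have "r (S (T i j)) (kd k l) = kd i j * kd k l"
      by (auto simp: kd_def r_one_right cou_antip cou_T lin_zero[OF lin_r(2)[OF lin_id]])
    ultimately show ?thesis
      by (subst sum.swap) (simp add: S_T mult.commute)
  qed
  then have *: "rmat_mult (\<lambda>i j k l. r (S (T i j)) (S (T k l))) (\<lambda>i j k l. r (S (T i j)) (T k l)) = rmat_one"
    by (simp add: fun_eq_iff rmat_mult_def rmat_one_def)
  have "(\<lambda>i j k l. r (S (T i j)) (S (T k l))) = (\<lambda>i j k l. r (T i j) (T k l))"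
    using arg_cong[OF *, of "\<lambda>P. rmat_mult P (\<lambda>i j k l. r (T i j) (T k l))"]
    by (simp add: rmat_mult_assoc r_antip_left_inverse rmat_one_left rmat_one_right)
  from rmat_cong[OF this] show ?thesis .
qed

lemma L_T: "L m n k l (T i j) = (SUM s. r (T k m) (T i s) * r (S (T n l)) (T s j))"
  unfolding L_def adm_def r_mult_left by (rule sw_T[of "(*)"]) (intro lin_rules)+

lemma L_S_T: "L m n k l (S (T i j)) = (SUM s. r (T k m) (S (T s j)) * r (T n l) (T i s))"
  unfolding L_def adm_def r_mult_left
  by (subst sw_S_T[of "(*)"], (intro lin_rules)+) (simp add: r_antip_antip)

section \<open>Linear maps vanishing on the product of augmentation ideals\<close>

lemma lin_uprod [lin_rules]:
  "lin s (scl H) f \<Longrightarrow> lin s (scl H) (\<lambda>z. uprod H r (f z) b)"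
  "lin s (scl H) f \<Longrightarrow> lin s (scl H) (\<lambda>z. uprod H r a (f z))"
  unfolding uprod_def by (intro lin_rules; assumption?)+

lemma uprod_one_left: "uprod H r 1 b = b"
proof -
  have "uprod H r 1 b = sw3 H (\<lambda>b1 b2 b3. scl H (r (b1 * S b3) (S 1)) (1 * b2)) b"
    unfolding uprod_def by (rule sw_one[of "scl H"]) (intro lin_rules)+
  also have "\<dots> = sw H (\<lambda>x b3. sw H (\<lambda>b1 b2. scl H (\<epsilon> b1) (scl H (\<epsilon> b3) b2)) x) b"
    by (simp add: sw3_def antip_one r_one_right cou_mult cou_antip)
  also have "\<dots> = b"
    by (simp only: sw_cou_left[OF lin_smult[OF lin_id]] sw_cou_right[OF lin_id])
  finally show ?thesis .
qed

lemma uprod_one_right: "uprod H r a 1 = a"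
proof -
  have 3: "sw3 H f 1 = f 1 1 1"
    if "\<And>y z. lin (scl H) (scl H) (\<lambda>x. f x y z)" "\<And>x z. lin (scl H) (scl H) (\<lambda>y. f x y z)"
      "\<And>x y. lin (scl H) (scl H) (\<lambda>z. f x y z)" for f
    unfolding sw3_def
    by (subst sw_one[of "scl H"], intro sw_lin[of _ _ "scl H"] lin_rules that, intro lin_rules that,
        subst sw_one[of "scl H"], intro that, intro that, rule refl)
  have "uprod H r a 1 = sw H (\<lambda>a1 a2. scl H (r (1 * S 1) (S a2)) (a1 * 1)) a"
    unfolding uprod_def by (subst 3) (intro lin_rules refl)+
  also have "\<dots> = a"
    by (simp add: antip_one r_one_left cou_antip sw_cou_right[OF lin_id])
  finally show ?thesis .
qed

lemma uprod_T:
  "uprod H r a (T p q) = sw H (\<lambda>u v. SUM x y. scl H (L x y p q (S v)) (u * T x y)) a"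
  unfolding uprod_def L_def adm_def
  by (subst sw3_T[of "scl H"]) (intro lin_rules refl)+

text \<open>In \<open>uprod_T\<close> the product is twisted by L(S v); a further factor L of the
  next leg undoes the twist through \<open>L_antip\<close>. With a generator as right factor the
  product of H is thus expressed by the transmuted one.\<close>

lemma mult_T_expand:
  "a * T k l = (SUM p q. sw H (\<lambda>x y. scl H (L p q k l y) (uprod H r x (T p q))) a)"
proof -
  have "(SUM p q. sw H (\<lambda>x y. scl H (L p q k l y) (uprod H r x (T p q))) a) =
      sw H (\<lambda>x y. sw H (\<lambda>u v. SUM m n p q.
        scl H (L m n p q (S v) * L p q k l y) (u * T m n)) x) a"
  proof -
    show ?thesis
      by (subst sum_swap4, simp add: uprod_T lin_sw[OF lin_smult[OF lin_id]]
          scale_sum_right mult.commute flip: sw_sum)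
  qed
  also have "\<dots> = sw H (\<lambda>u w. sw H (\<lambda>v y. SUM m n p q.
        scl H (L m n p q (S v) * L p q k l y) (u * T m n)) w) a"
    by (rule sw_coassoc[of "scl H"]) (intro lin_rules)+
  also have "\<dots> = sw H (\<lambda>u w. SUM m n. scl H (\<epsilon> w * (kd k m * kd n l)) (u * T m n)) a"
    by (simp only: L_antip[symmetric] sw_sum[symmetric] scale_sum_left[symmetric]
        lin_sw[OF lin_coeff[OF vs lin_ident[OF vector_space_times]]])
  also have "\<dots> = sw H (\<lambda>u w. scl H (\<epsilon> w) (u * T k l)) a"
  proof -
    have "(SUM m n. scl H (c * (kd k m * kd n l)) (u * T m n)) =
        scl H c (SUM m. scl H (kd k m) (SUM n. scl H (kd n l) (u * T m n)))" for c u
      by (simp add: scale_sum_right)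
    then show ?thesis
      by (simp add: sum_kd_scale[OF vs])
  qed
  also have "\<dots> = a * T k l"
    by (rule sw_cou_right) (intro lin_rules)
  finally show ?thesis ..
qed

context
  fixes sC :: "'k \<Rightarrow> 'c::ab_group_add \<Rightarrow> 'c" and x
  assumes x: "lin (scl H) sC x" and x_one: "x 1 = 0"
    and x_ker: "\<And>a b. \<epsilon> a = 0 \<Longrightarrow> \<epsilon> b = 0 \<Longrightarrow> x (uprod H r a b) = 0"
begin

text \<open>The unit of H is also a unit of the transmuted product, so the vanishing hypothesis
  applied to a - \<epsilon>(a) and b - \<epsilon>(b) expands to a Leibniz rule.\<close>

lemma derivation_uprod: "x (uprod H r a b) = sC (\<epsilon> b) (x a) + sC (\<epsilon> a) (x b)"
proof -
  interpret C: vector_space sC by (rule lin_vs[OF x])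
  have "\<epsilon> (a - scl H (\<epsilon> a) 1) = 0" for a
    by (simp add: lin_diff[OF lin_cou'] lin_scale[OF lin_cou'] cou_one)
  then have "x (uprod H r (a - scl H (\<epsilon> a) 1) (b - scl H (\<epsilon> b) 1)) = 0"
    by (intro x_ker)
  then show ?thesis
    by (simp add: lin_diff[OF lin_uprod(1)[OF lin_id]] lin_diff[OF lin_uprod(2)[OF lin_id]]
        lin_scale[OF lin_uprod(1)[OF lin_id]] lin_scale[OF lin_uprod(2)[OF lin_id]]
        uprod_one_left uprod_one_right lin_diff[OF x] lin_add[OF x] lin_scale[OF x] x_one algebra_simps)
qed

lemma derivation_mult_T:
  "x (a * T k l) = sC (kd k l) (x a) + (SUM p q. sC (L p q k l a) (x (T p q)))"
proof -
  interpret C: vector_space sC by (rule lin_vs[OF x])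
  have trace_L: "(SUM p q. sC (L p q k l v) (sC (kd p q) y)) =
      sC (\<epsilon> v) (sC (kd k l) y)" for v y
  proof -
    show ?thesis
      using L_trace[of k l v] by (simp flip: C.scale_sum_left)
  qed
  \<comment> \<open>The Leibniz rule for transmuted products yields a term in x(u), collapsed by the
    trace identity, and a term in x(T p q), collapsed by the counit.\<close>
  have "x (a * T k l) = (SUM p q. sw H (\<lambda>u v. sC (L p q k l v) (sC (kd p q) (x u)) +
      sC (\<epsilon> u) (sC (L p q k l v) (x (T p q)))) a)"
    by (subst mult_T_expand)
      (simp add: lin_sum[OF x] lin_sw[OF x] lin_scale[OF x] derivation_uprod cou_T
        C.scale_right_distrib mult.commute)
  also have "\<dots> = sw H (\<lambda>u v. SUM p q. sC (L p q k l v) (sC (kd p q) (x u))) a +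
      (SUM p q. sw H (\<lambda>u v. sC (\<epsilon> u) (sC (L p q k l v) (x (T p q)))) a)"
    by (simp add: sw_add sum.distrib sw_sum)
  also have "(SUM p q. sw H (\<lambda>u v. sC (\<epsilon> u) (sC (L p q k l v) (x (T p q)))) a) =
      (SUM p q. sC (L p q k l a) (x (T p q)))"
    by (subst sw_cou_left[of sC "\<lambda>v. sC (L p q k l v) c" for p q c])
      (intro lin_rules lin_vs(2)[OF x] refl)+
  also have "sw H (\<lambda>u v. SUM p q. sC (L p q k l v) (sC (kd p q) (x u))) a =
      sw H (\<lambda>u v. sC (\<epsilon> v) (sC (kd k l) (x u))) a"
    by (simp only: trace_L)
  also have "sw H (\<lambda>u v. sC (\<epsilon> v) (sC (kd k l) (x u))) a = sC (kd k l) (x a)"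
    by (rule sw_cou_right) (intro lin_rules x)
  finally show ?thesis .
qed

end

end

section \<open>Bicovariant calculi\<close>

locale bicovariant = hopf H
  for H :: "('k::field, 'a::ring_1, 'y) hopf_scheme" +
  fixes G :: "('k, 'a, 'g::ab_group_add, 'z) calculus_scheme"
  assumes bicovariant: "bicovariant_fodc H G"
begin

lemma fodc: "fodc H G"
  using bicovariant by (simp add: bicovariant_fodc_def)

lemma lin_lmul [lin_rules]:
  "lin s (scl H) f \<Longrightarrow> lin s (gscl G) (\<lambda>z. lmul G (f z) v)"
  "lin s (gscl G) g \<Longrightarrow> lin s (gscl G) (\<lambda>z. lmul G a (g z))"
proof -
  have "lin (scl H) (gscl G) (\<lambda>a. lmul G a v)" "lin (gscl G) (gscl G) (lmul G a)"
    using fodc by (auto simp: fodc_def bilin_def)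
  then show "lin s (scl H) f \<Longrightarrow> lin s (gscl G) (\<lambda>z. lmul G (f z) v)"
    "lin s (gscl G) g \<Longrightarrow> lin s (gscl G) (\<lambda>z. lmul G a (g z))"
    by (auto intro: lin_comp)
qed

lemma lin_rmul [lin_rules]:
  "lin s (gscl G) g \<Longrightarrow> lin s (gscl G) (\<lambda>z. rmul G (g z) a)"
  "lin s (scl H) f \<Longrightarrow> lin s (gscl G) (\<lambda>z. rmul G v (f z))"
proof -
  have "lin (gscl G) (gscl G) (\<lambda>v. rmul G v a)" "lin (scl H) (gscl G) (rmul G v)"
    using fodc by (auto simp: fodc_def bilin_def)
  then show "lin s (gscl G) g \<Longrightarrow> lin s (gscl G) (\<lambda>z. rmul G (g z) a)"
    "lin s (scl H) f \<Longrightarrow> lin s (gscl G) (\<lambda>z. rmul G v (f z))"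
    by (auto intro: lin_comp)
qed

lemma vsg [lin_rules]: "vector_space (gscl G)"
  by (rule lin_vs(2)[OF lin_lmul(1)[OF lin_id]])

sublocale G: vector_space "gscl G"
  by (rule vsg)

lemma lin_dif [lin_rules]: "lin s (scl H) f \<Longrightarrow> lin s (gscl G) (\<lambda>z. dif G (f z))"
  using fodc lin_comp unfolding fodc_def by blast

lemma lmul_one: "lmul G 1 v = v" and rmul_one: "rmul G v 1 = v"
  and lmul_mult: "lmul G (a * b) v = lmul G a (lmul G b v)"
  and rmul_mult: "rmul G v (a * b) = rmul G (rmul G v a) b"
  and rmul_lmul: "rmul G (lmul G a v) b = lmul G a (rmul G v b)"
  and dif_mult: "dif G (a * b) = rmul G (dif G a) b + lmul G a (dif G b)"
  and generated_dif: "G.span {lmul G a (dif G b) | a b. True} = UNIV"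
  using fodc by (auto simp: fodc_def)

lemmas lin_lmul2 = lin_lmul(2)[OF lin_ident[OF vsg]]
lemmas lin_rmul1 = lin_rmul(1)[OF lin_ident[OF vsg]]
lemmas lin_rmul2 = lin_rmul(2)[OF lin_id]

section \<open>The map onto right-invariant forms and the adjoint action\<close>

abbreviation \<omega> where "\<omega> \<equiv> omega_R H G"

lemma lin_omega [lin_rules]: "lin s (scl H) f \<Longrightarrow> lin s (gscl G) (\<lambda>z. \<omega> (f z))"
  unfolding omega_R_def by (intro lin_rules)

lemma lin_act [lin_rules]:
  "lin s (scl H) f \<Longrightarrow> lin s (gscl G) (\<lambda>z. act H G (f z) v)"
  "lin s (gscl G) g \<Longrightarrow> lin s (gscl G) (\<lambda>z. act H G a (g z))"
  unfolding act_def by (intro lin_rules; assumption?)+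

lemmas lin_act2 = lin_act(2)[OF lin_ident[OF vsg]]

lemma omega_one: "\<omega> 1 = 0"
proof -
  have "dif G 1 = 0"
    using dif_mult[of 1 1] by (simp add: lmul_one rmul_one)
  then show ?thesis
    unfolding omega_R_def
    by (subst sw_one[of "gscl G"], (intro lin_rules)+) (simp add: lin_zero[OF lin_rmul1])
qed

lemma act_mult: "act H G (a * b) v = act H G a (act H G b v)"
  unfolding act_def
  by (subst sw_mult[of "gscl G"], (intro lin_rules)+)
    (simp add: antip_mult lmul_mult rmul_mult rmul_lmul lin_sw[OF lin_lmul2] lin_sw[OF lin_rmul1])

text \<open>In the first Leibniz term the factors \<open>u S(v)\<close> contract to \<epsilon>(b).
  Set against the cocycle rule for x = \<omega>, the formula will identify the action with
  L.\<close>

lemma omega_mult: "\<omega> (a * b) = gscl G (\<epsilon> b) (\<omega> a) + act H G a (\<omega> b)"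
proof -
  have "\<omega> (a * b) = sw H (\<lambda>x y. sw H (\<lambda>u v. rmul G (dif G (x * u)) (S (y * v))) b) a"
    unfolding omega_R_def by (rule sw_mult[of "gscl G"]) (intro lin_rules)+
  also have "\<dots> = sw H (\<lambda>x y. sw H (\<lambda>u v. rmul G (dif G x) (u * S v * S y)) b +
      rmul G (lmul G x (sw H (\<lambda>u v. rmul G (dif G u) (S v)) b)) (S y)) a"
    by (simp add: antip_mult dif_mult lin_add[OF lin_rmul1] sw_add rmul_mult rmul_lmul
        lin_sw[OF lin_lmul2] lin_sw[OF lin_rmul1] mult.assoc)
  also have "\<dots> = sw H (\<lambda>x y. gscl G (\<epsilon> b) (rmul G (dif G x) (S y))) a + act H G a (\<omega> b)"
  proof -
    have "sw H (\<lambda>u v. rmul G (dif G x) (u * S v * S y)) b = gscl G (\<epsilon> b) (rmul G (dif G x) (S y))"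
      for x y
    proof -
      have "sw H (\<lambda>u v. rmul G (dif G x) (u * S v * S y)) b =
          rmul G (dif G x) (sw H (\<lambda>u v. u * S v) b * S y)"
        by (simp add: lin_sw[OF lin_mult(1)[OF lin_id]] lin_sw[OF lin_rmul2])
      then show ?thesis
        by (simp add: antip_right scl_mult_left lin_scale[OF lin_rmul2])
    qed
    then show ?thesis
      by (simp add: sw_add act_def omega_R_def)
  qed
  finally show ?thesis
    unfolding omega_R_def[of _ _ a] by (simp add: lin_sw[OF lin_smult[OF lin_ident[OF vsg]]])
qed

lemma lin_lco: "lin (gscl G) fscale (lco G)" and lin_rco: "lin (gscl G) fscale (rco G)"
  and lco_in: "lco G v \<in> tensor_space (scl H) (gscl G) UNIV UNIV"
  and rco_in: "rco G v \<in> tensor_space (gscl G) (scl H) UNIV UNIV"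
  and lco_rmul: "lco G (rmul G v a) =
        sw H (\<lambda>x y. lcol H G (\<lambda>b w. tens (scl H) (gscl G) (b * x) (rmul G w y)) v) a"
  and rco_lmul: "rco G (lmul G a v) =
        sw H (\<lambda>x y. rcol H G (\<lambda>w b. tens (gscl G) (scl H) (lmul G x w) (y * b)) v) a"
  and rco_rmul: "rco G (rmul G v a) =
        sw H (\<lambda>x y. rcol H G (\<lambda>w b. tens (gscl G) (scl H) (rmul G w x) (b * y)) v) a"
  and lco_dif: "lco G (dif G a) = sw H (\<lambda>x y. tens (scl H) (gscl G) x (dif G y)) a"
  and rco_dif: "rco G (dif G a) = sw H (\<lambda>x y. tens (gscl G) (scl H) (dif G x) y) a"
  using bicovariant by (auto simp: bicovariant_fodc_def)

context
  fixes sC :: "'k \<Rightarrow> 'c::ab_group_add \<Rightarrow> 'c" and f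
  assumes f: "\<And>y. lin (scl H) sC (\<lambda>x. f x y)" "\<And>x. lin (gscl G) sC (\<lambda>y. f x y)"
begin

lemma lcol_bil_on: "bil_on (scl H) (gscl G) sC UNIV UNIV f"
  by (intro bil_on_UNIV bilinI f)

lemma lin_lcol: "lin (gscl G) sC (lcol H G f)"
  using tlift_add[OF lcol_bil_on lco_in lco_in] tlift_scale[OF lcol_bil_on lco_in]
  by (intro linI) (auto simp: vsg lin_vs[OF f(1)] lcol_def lin_add[OF lin_lco] lin_scale[OF lin_lco])

lemma lcol_sum:
  "lco G v = (\<Sum>i\<in>I. tens (scl H) (gscl G) (x i) (y i)) \<Longrightarrow> lcol H G f v = (\<Sum>i\<in>I. f (x i) (y i))"
  using tlift_sum_tens[OF lcol_bil_on, of I x y] by (simp add: lcol_def)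

end

context
  fixes sC :: "'k \<Rightarrow> 'c::ab_group_add \<Rightarrow> 'c" and f
  assumes f: "\<And>y. lin (gscl G) sC (\<lambda>x. f x y)" "\<And>x. lin (scl H) sC (\<lambda>y. f x y)"
begin

lemma rcol_bil_on: "bil_on (gscl G) (scl H) sC UNIV UNIV f"
  by (intro bil_on_UNIV bilinI f)

lemma lin_rcol: "lin (gscl G) sC (rcol H G f)"
  using tlift_add[OF rcol_bil_on rco_in rco_in] tlift_scale[OF rcol_bil_on rco_in]
  by (intro linI) (auto simp: vsg lin_vs[OF f(1)] rcol_def lin_add[OF lin_rco] lin_scale[OF lin_rco])

lemma rcol_tens: "rco G v = tens (gscl G) (scl H) x y \<Longrightarrow> rcol H G f v = f x y"
  using tlift_tens[OF rcol_bil_on, of x y] by (simp add: rcol_def)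

lemma rcol_sum:
  "rco G v = (\<Sum>i\<in>I. tens (gscl G) (scl H) (x i) (y i)) \<Longrightarrow> rcol H G f v = (\<Sum>i\<in>I. f (x i) (y i))"
  using tlift_sum_tens[OF rcol_bil_on, of I x y] by (simp add: rcol_def)

lemma rcol_dif: "rcol H G f (dif G a) = sw H (\<lambda>x y. f (dif G x) y) a"
  unfolding rcol_def rco_dif sw_crep
  by (simp add: tlift_lsum_tensors[OF rcol_bil_on] tens_in_tensor_space tlift_tens[OF rcol_bil_on])

text \<open>The coaction of a v is a double sum whose inner lift runs over \<open>rco G v\<close>;
  one list \<open>ps\<close> for that tensor serves the tensor-valued and the f-valued integrand
  alike.\<close>

lemma rcol_lmul: "rcol H G f (lmul G a v) = sw H (\<lambda>x y. rcol H G (\<lambda>w b. f (lmul G x w) (y * b)) v) a"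
proof -
  obtain ps where ps: "rco G v = lsum (tens (gscl G) (scl H)) ps"
    using rco_in[of v]
    by (auto simp: tensor_space_list[OF vsg vs subspace_univ[OF vsg] subspace_univ[OF vs]])
  have *: "rcol H G h v = lsum h ps"
    if "\<And>y. lin (gscl G) sD (\<lambda>x. h x y)" "\<And>x. lin (scl H) sD (\<lambda>y. h x y)"
    for h :: "'g \<Rightarrow> 'a \<Rightarrow> 'd::ab_group_add" and sD
    unfolding rcol_def ps by (rule tlift_lsum[OF bil_on_UNIV[OF bilinI[OF that]]]) auto
  have 1: "rco G (lmul G a v) = lsum (\<lambda>x y. lsum (\<lambda>w b. tens (gscl G) (scl H) (lmul G x w) (y * b)) ps)
      (crep H a)"
    unfolding rco_lmul sw_crep by (subst *[of fscale]) (intro lin_rules refl)+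
  have "lsum (\<lambda>w b. tens (gscl G) (scl H) (lmul G x w) (y * b)) qs
      \<in> tensor_space (gscl G) (scl H) UNIV UNIV" for x y qs
    by (intro lsum_in_tensor_space tens_in_tensor_space UNIV_I)
  then have "rcol H G f (lmul G a v) = lsum (\<lambda>x y. lsum (\<lambda>w b. f (lmul G x w) (y * b)) ps) (crep H a)"
    unfolding rcol_def 1
    by (simp add: tlift_lsum_tensors[OF rcol_bil_on] tens_in_tensor_space tlift_tens[OF rcol_bil_on])
  moreover have "rcol H G (\<lambda>w b. f (lmul G x w) (y * b)) v = lsum (\<lambda>w b. f (lmul G x w) (y * b)) ps" for x y
    unfolding rcol_def ps
    by (rule tlift_lsum[OF bil_on_UNIV[OF bilinI]],
        rule lin_comp[OF f(1) lin_lmul2], rule lin_comp[OF f(2) lin_mult(2)[OF lin_id]]) auto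
  ultimately show ?thesis
    by (simp add: sw_crep)
qed

end

lemma right_invariant_subspace: "G.subspace (right_invariant H G)"
proof -
  have 1: "lin (gscl G) fscale (\<lambda>v. tens (gscl G) (scl H) v 1)"
    by (intro lin_rules)
  show ?thesis
    unfolding right_invariant_def
    by (intro G.subspaceI) (auto simp: lin_zero[OF lin_rco] lin_zero[OF 1] lin_add[OF lin_rco]
        lin_add[OF 1] lin_scale[OF lin_rco] lin_scale[OF 1])
qed

text \<open>The projection \<open>v \<mapsto> v\<^sub>(\<^sub>0\<^sub>) S(v\<^sub>(\<^sub>1\<^sub>))\<close> is the identity on right-invariant elements and maps
  \<open>a db\<close> to \<open>a \<triangleright> \<omega>\<^sub>R(b)\<close>.\<close>

lemma right_invariant_subset:
  assumes V: "G.subspace V" "\<And>a b. act H G a (\<omega> b) \<in> V"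
  shows "right_invariant H G \<subseteq> V"
proof
  let ?P = "rcol H G (\<lambda>w a. rmul G w (S a))"
  have P: "lin (gscl G) (gscl G) ?P"
    by (rule lin_rcol) (intro lin_rules)+
  have "?P (lmul G a (dif G b)) = act H G a (\<omega> b)" for a b
  proof -
    have "?P (lmul G a (dif G b)) =
        sw H (\<lambda>x y. sw H (\<lambda>u v. rmul G (lmul G x (dif G u)) (S (y * v))) b) a"
      by (subst rcol_lmul[of "gscl G"], intro lin_rules, intro lin_rules,
          subst rcol_dif[of "gscl G"], intro lin_rules, intro lin_rules, rule refl)
    then show ?thesis
      by (simp add: antip_mult rmul_mult act_def omega_R_def rmul_lmul
          lin_sw[OF lin_lmul2] lin_sw[OF lin_rmul1])
  qed
  then have "{lmul G a (dif G b) | a b. True} \<subseteq> {v. ?P v \<in> V}"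
    using V(2) by auto
  then have "G.span {lmul G a (dif G b) | a b. True} \<subseteq> {v. ?P v \<in> V}"
    using subspace_vimage[OF P V(1)] by (rule G.span_minimal)
  then have *: "?P v \<in> V" for v
    unfolding generated_dif by auto
  fix v assume "v \<in> right_invariant H G"
  then have "?P v = rmul G v (S 1)"
    unfolding right_invariant_def
    by (intro rcol_tens[of "gscl G"] lin_rules) simp
  then show "v \<in> V"
    using *[of v] by (simp add: antip_one rmul_one)
qed

end

section \<open>Right-invariant forms of matrix entries\<close>

locale bicovariant_mat = hopf_mat H T + bicovariant H G
  for H :: "('k::field, 'a::ring_1, 'y) hopf_scheme" and T :: "'n::finite \<Rightarrow> 'n \<Rightarrow> 'a"
    and G :: "('k, 'a, 'g::ab_group_add, 'z) calculus_scheme"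
begin

lemma omega_T: "\<omega> (T i j) = (SUM a. rmul G (dif G (T i a)) (S (T a j)))"
  unfolding omega_R_def by (rule sw_T[of "gscl G"]) (intro lin_rules)+

lemma act_T: "act H G (T i j) v = (SUM a. rmul G (lmul G (T i a) v) (S (T a j)))"
  unfolding act_def by (rule sw_T[of "gscl G"]) (intro lin_rules)+

lemma rmul_kd: "rmul G v (kd i j) = gscl G (kd i j) v"
  by (auto simp: kd_def rmul_one lin_zero[OF lin_rmul2])

lemma dif_T: "dif G (T i j) = (SUM a. rmul G (\<omega> (T i a)) (T a j))"
proof -
  have "(SUM a. rmul G (\<omega> (T i a)) (T a j)) =
      (SUM a b. rmul G (dif G (T i b)) (S (T b a) * T a j))"
    by (simp add: omega_T lin_sum[OF lin_rmul1] rmul_mult)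
  also have "\<dots> = (SUM b a. rmul G (dif G (T i b)) (S (T b a) * T a j))"
    by (rule sum.swap)
  also have "\<dots> = (SUM b. rmul G (dif G (T i b)) (kd b j))"
    by (simp add: S_T flip: lin_sum[OF lin_rmul2])
  finally show ?thesis
    by (simp add: rmul_kd sum_kd_scale[OF vsg])
qed

lemma lmul_T: "lmul G (T i j) v = (SUM a. rmul G (act H G (T i a) v) (T a j))"
proof -
  have "(SUM a. rmul G (act H G (T i a) v) (T a j)) =
      (SUM a b. rmul G (lmul G (T i b) v) (S (T b a) * T a j))"
    by (simp add: act_T lin_sum[OF lin_rmul1] rmul_mult)
  also have "\<dots> = (SUM b a. rmul G (lmul G (T i b) v) (S (T b a) * T a j))"
    by (rule sum.swap)
  also have "\<dots> = (SUM b. rmul G (lmul G (T i b) v) (kd b j))"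
    by (simp add: S_T flip: lin_sum[OF lin_rmul2])
  finally show ?thesis
    by (simp add: rmul_kd sum_kd_scale[OF vsg])
qed

lemma lco_omega_T:
  "lco G (\<omega> (T i j)) =
    (SUM a b. tens (scl H) (gscl G) (T i a * S (T b j)) (\<omega> (T a b)))"
proof -
  have 1: "lco G (dif G (T i a)) = (SUM c. tens (scl H) (gscl G) (T i c) (dif G (T c a)))" for i a
    unfolding lco_dif by (rule sw_T[of fscale]) (intro lin_rules)+
  have "lco G (\<omega> (T i j)) = (SUM a. sw H (\<lambda>x y. SUM c.
      tens (scl H) (gscl G) (T i c * x) (rmul G (dif G (T c a)) y)) (S (T a j)))"
    unfolding omega_T lin_sum[OF lin_lco] lco_rmul
    by (subst lcol_sum[OF _ _ 1, of fscale]) (intro lin_rules refl)+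
  also have "\<dots> = (SUM a b c.
      tens (scl H) (gscl G) (T i c * S (T b j)) (rmul G (dif G (T c a)) (S (T a b))))"
    by (subst sw_S_T[of fscale]) (intro lin_rules refl)+
  also have "\<dots> = (SUM b c a.
      tens (scl H) (gscl G) (T i c * S (T b j)) (rmul G (dif G (T c a)) (S (T a b))))"
    by (subst sum.swap, rule sum.cong[OF refl], rule sum.swap)
  also have "\<dots> = (SUM b c. tens (scl H) (gscl G) (T i c * S (T b j)) (\<omega> (T c b)))"
    unfolding omega_T by (simp only: lin_sum[OF tens_linear(2)[OF vs vsg lin_ident[OF vsg]]])
  finally show ?thesis
    by (subst sum.swap)
qed

lemma omega_T_right_invariant: "\<omega> (T i j) \<in> right_invariant H G"
proof -
  have 1: "rco G (dif G (T i a)) = (SUM c. tens (gscl G) (scl H) (dif G (T i c)) (T c a))" for i a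
    unfolding rco_dif by (rule sw_T[of fscale]) (intro lin_rules)+
  have "rco G (\<omega> (T i j)) = (SUM a. sw H (\<lambda>x y. SUM c.
      tens (gscl G) (scl H) (rmul G (dif G (T i c)) x) (T c a * y)) (S (T a j)))"
    unfolding omega_T lin_sum[OF lin_rco] rco_rmul
    by (subst rcol_sum[OF _ _ 1, of fscale]) (intro lin_rules refl)+
  also have "\<dots> = (SUM a b c.
      tens (gscl G) (scl H) (rmul G (dif G (T i c)) (S (T b j))) (T c a * S (T a b)))"
    by (subst sw_S_T[of fscale]) (intro lin_rules refl)+
  also have "\<dots> = (SUM b c a.
      tens (gscl G) (scl H) (rmul G (dif G (T i c)) (S (T b j))) (T c a * S (T a b)))"
    by (subst sum.swap, rule sum.cong[OF refl], rule sum.swap)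
  also have "\<dots> = (SUM b c.
      tens (gscl G) (scl H) (rmul G (dif G (T i c)) (S (T b j))) (kd c b))"
    unfolding T_S[symmetric] by (simp only: lin_sum[OF tens_linear(2)[OF vsg vs lin_id]])
  also have "\<dots> = (SUM b c.
      fscale (kd c b) (tens (gscl G) (scl H) (rmul G (dif G (T i c)) (S (T b j))) 1))"
    by (simp only: scl_kd[symmetric] lin_scale[OF tens_linear(2)[OF vsg vs lin_id]])
  also have "\<dots> = tens (gscl G) (scl H) (\<omega> (T i j)) 1"
    unfolding omega_T
    by (simp only: sum_kd_scale[OF vector_space_fscale]
        lin_sum[OF tens_linear(1)[OF vsg vs lin_ident[OF vsg]]])
  finally show ?thesis
    by (simp add: right_invariant_def)
qed

lemma sigma_t_sum:
  assumes "\<And>a. v a \<in> right_invariant H G" "\<And>a. w a \<in> right_invariant H G"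
  shows "sigma_t H G (\<Sum>a\<in>I. tens (gscl G) (gscl G) (v a) (w a)) =
    (\<Sum>a\<in>I. lcol H G (\<lambda>x v0. tens (gscl G) (gscl G) (act H G x (w a)) v0) (v a))"
  unfolding sigma_t_def
proof (rule tlift_sum_tens)
  show "bil_on (gscl G) (gscl G) fscale (right_invariant H G) (right_invariant H G)
      (\<lambda>v w. lcol H G (\<lambda>x v0. tens (gscl G) (gscl G) (act H G x w) v0) v)"
  proof (intro bil_onI bilinI right_invariant_subspace)
    show "lin (gscl G) fscale (\<lambda>v. lcol H G (\<lambda>x v0. tens (gscl G) (gscl G) (act H G x w) v0) v)" for w
      by (rule lin_lcol) (intro lin_rules)+
    show "lin (gscl G) fscale (\<lambda>w. lcol H G (\<lambda>x v0. tens (gscl G) (gscl G) (act H G x w) v0) v)" for v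
    proof -
      obtain ps where
        "\<And>f. lcol H G f v = (lsum f ps :: ('g \<Rightarrow> 'g \<Rightarrow> 'k) \<Rightarrow> 'k)"
        using tlift_rep[OF vs vsg subspace_univ[OF vs] subspace_univ[OF vsg] lco_in[of v]]
        unfolding lcol_def by metis
      moreover have "lin (gscl G) fscale (\<lambda>w. lsum (\<lambda>x v0. tens (gscl G) (gscl G) (act H G x w) v0) ps)" for ps
      proof (induction ps)
        case Nil
        show ?case
          unfolding lsum_Nil by (intro lin_rules)
      next
        case (Cons p ps)
        then show ?case
          by (cases p) (simp only: lsum_Cons, intro lin_rules)
      qed
      ultimately show ?thesis
        by simp
    qed
  qed
qed (use assms in auto)

text \<open>The coaction of \<open>\<omega> (T i a)\<close> supplies \<open>T S(T)\<close>, which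
  meets the T a j inside \<open>W a\<close>. Summed over a, the middle \<open>S(T) T\<close>
  cancels. No explicit form of the action is involved.\<close>

lemma sigma_t_omega:
  assumes W: "\<And>a. W a \<in> right_invariant H G" and act_W: "\<And>a. W a = act H G (T a j) u"
  shows "sigma_t H G (SUM a. tens (gscl G) (gscl G) (\<omega> (T i a)) (W a)) =
    (SUM a. tens (gscl G) (gscl G) (act H G (T i a) u) (\<omega> (T a j)))"
proof -
  have lco: "lco G (\<omega> (T i a)) = (SUM p. tens (scl H) (gscl G)
      (T i (fst p) * S (T (snd p) a)) (\<omega> (T (fst p) (snd p))))" for a
    by (simp add: lco_omega_T sum.cartesian_product case_prod_unfold)
  have "sigma_t H G (SUM a. tens (gscl G) (gscl G) (\<omega> (T i a)) (W a)) =
      (SUM a p. tens (gscl G) (gscl G)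
        (act H G (T i (fst p) * S (T (snd p) a)) (W a)) (\<omega> (T (fst p) (snd p))))"
    by (subst sigma_t_sum[OF omega_T_right_invariant W], rule sum.cong[OF refl],
        rule lcol_sum[OF _ _ lco, of fscale]) (intro lin_rules)+
  also have "\<dots> = (SUM p a. tens (gscl G) (gscl G)
        (act H G (T i (fst p) * (S (T (snd p) a) * T a j)) u) (\<omega> (T (fst p) (snd p))))"
    by (subst sum.swap) (simp add: act_W act_mult)
  also have "\<dots> = (SUM p. fscale (kd (snd p) j) (tens (gscl G) (gscl G)
        (act H G (T i (fst p)) u) (\<omega> (T (fst p) (snd p)))))"
  proof (rule sum.cong[OF refl])
    fix p :: "'n \<times> 'n"
    have L: "lin (scl H) fscale (\<lambda>x. tens (gscl G) (gscl G)
        (act H G (T i (fst p) * x) u) (\<omega> (T (fst p) (snd p))))"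
      by (intro lin_rules)
    show "(SUM a. tens (gscl G) (gscl G)
        (act H G (T i (fst p) * (S (T (snd p) a) * T a j)) u) (\<omega> (T (fst p) (snd p)))) =
      fscale (kd (snd p) j) (tens (gscl G) (gscl G)
        (act H G (T i (fst p)) u) (\<omega> (T (fst p) (snd p))))"
      using lin_scale[OF L, of "kd (snd p) j" 1]
      by (simp only: lin_sum[OF L, symmetric] S_T scl_kd mult_1_right)
  qed
  also have "\<dots> = (SUM x y. fscale (kd y j) (tens (gscl G) (gscl G)
        (act H G (T i x) u) (\<omega> (T x y))))"
    by (simp only: sum.cartesian_product case_prod_unfold UNIV_Times_UNIV)
  also have "\<dots> = (SUM x. tens (gscl G) (gscl G) (act H G (T i x) u) (\<omega> (T x j)))"
    by (simp only: sum_kd_scale[OF vector_space_fscale])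
  finally show ?thesis .
qed

text \<open>The matrix \<open>t1 t2\<close> is invertible over H, with inverse the entries S(T) in
  the opposite order, so right multiplication by it loses no information.\<close>

lemma rmul_TT_cancel:
  "(\<forall>j l. (SUM m n. rmul G (Y m n) (T m j * T n l)) =
      (SUM m n. rmul G (Z m n) (T m j * T n l))) \<longleftrightarrow> (\<forall>m n. Y m n = Z m n)"
proof -
  have TS: "(SUM j l. T m' j * T n' l * (S (T l n) * S (T j m))) = kd m' m * kd n' n" for m m' n n'
  proof -
    have "(SUM l. T m' j * T n' l * (S (T l n) * S (T j m))) =
        T m' j * (SUM l. T n' l * S (T l n)) * S (T j m)" for j
      by (simp add: sum_distrib_left sum_distrib_right mult.assoc)
    then have "(SUM j l. T m' j * T n' l * (S (T l n) * S (T j m))) =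
        (SUM j. T m' j * kd n' n * S (T j m))"
      by (simp add: T_S)
    also have "\<dots> = (SUM j. T m' j * S (T j m)) * kd n' n"
      by (auto simp: kd_def)
    finally show ?thesis
      by (simp add: T_S)
  qed
  have inv: "(SUM j l. rmul G (SUM m n. rmul G (Y m n) (T m j * T n l))
      (S (T l n) * S (T j m))) = Y m n" for Y m n
  proof -
    have "(SUM j l. rmul G (SUM m n. rmul G (Y m n) (T m j * T n l))
        (S (T l n) * S (T j m))) =
        (SUM j l m' n'.
          rmul G (Y m' n') (T m' j * T n' l * (S (T l n) * S (T j m))))"
      by (simp add: lin_sum[OF lin_rmul1] rmul_mult)
    also have "\<dots> = (SUM m' n' j l.
          rmul G (Y m' n') (T m' j * T n' l * (S (T l n) * S (T j m))))"
      by (rule sum_swap4)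
    also have "\<dots> = (SUM m' n'. rmul G (Y m' n') (kd m' m * kd n' n))"
      by (simp add: TS flip: lin_sum[OF lin_rmul2])
    also have "\<dots> = (SUM m'. gscl G (kd m' m) (SUM n'. gscl G (kd n' n) (Y m' n')))"
      by (auto intro!: sum.cong simp: rmul_mult rmul_kd G.scale_sum_right mult.commute)
    finally show ?thesis
      by (simp add: sum_kd_scale[OF vsg])
  qed
  show ?thesis
  proof (intro iffI allI)
    fix m n
    assume "\<forall>j l. (SUM m n. rmul G (Y m n) (T m j * T n l)) =
      (SUM m n. rmul G (Z m n) (T m j * T n l))"
    then show "Y m n = Z m n"
      by (subst inv[of Y, symmetric], subst inv[of Z, symmetric]) simp
  qed simp
qed

text \<open>Right multiplication of a module-valued matrix by a scalar matrix on the two lower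
  indices, isolated so that R and its inverse can be cancelled as operators.\<close>

definition Rscale :: "('k, 'n) rmat \<Rightarrow> ('n \<Rightarrow> 'n \<Rightarrow> 'g) \<Rightarrow> 'n \<Rightarrow> 'n \<Rightarrow> 'g" where
  "Rscale R Z j l = (SUM a b. gscl G (R a j b l) (Z a b))"

lemma Rscale_mult: "Rscale Q (Rscale P Z) = Rscale (rmat_mult P Q) Z"
proof (intro ext)
  fix j l
  have "Rscale Q (Rscale P Z) j l =
      (SUM a b c d. gscl G (P c a d b * Q a j b l) (Z c d))"
    by (simp add: Rscale_def G.scale_sum_right mult.commute)
  also have "\<dots> = (SUM c d a b. gscl G (P c a d b * Q a j b l) (Z c d))"
    by (rule sum_swap4)
  finally show "Rscale Q (Rscale P Z) j l = Rscale (rmat_mult P Q) Z j l"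
    by (simp add: Rscale_def rmat_mult_def G.scale_sum_left)
qed

lemma Rscale_one: "Rscale rmat_one Z = Z"
proof (intro ext)
  fix j l
  have "Rscale rmat_one Z j l = (SUM a. gscl G (kd a j) (SUM b. gscl G (kd b l) (Z a b)))"
    by (simp add: Rscale_def rmat_one_def G.scale_sum_right)
  then show "Rscale rmat_one Z j l = Z j l"
    by (simp add: sum_kd_scale[OF vsg])
qed

text \<open>Right multiplication by \<open>t1 t2\<close> turns the left side of the first relation
  into \<open>t1 d(t2)\<close> and, by the FRT relation, its right side into
  \<open>R21 d(t2) t1 R\<close>. Exchanging the legs and cancelling R21 against R on the right gives
  the second relation, and every step is reversible.\<close>

lemma t_omega_iff_R_dt:
  assumes FRT: "\<And>i j k l. (SUM a b. scl H (R i a k b) (T a j * T b l)) =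
      (SUM a b. scl H (R a j b l) (T k b * T i a))"
    and inv: "rmat_mult (flip_rmat R) R = rmat_one" "rmat_mult R (flip_rmat R) = rmat_one"
  shows "t_omega_relation H G R T \<longleftrightarrow> R_dt_relation G R T"
proof -
  define X where "X i k j l = Rscale R (\<lambda>m n. Rscale (\<lambda>a i b k. flip_rmat R i a k b)
      (\<lambda>a b. rmul G (dif G (T b n)) (T a m)) i k) j l" for i j k l
  have X: "(SUM m n. rmul G (R21_w2_R G R (\<lambda>a b. \<omega> (T a b)) i m k n) (T m j * T n l)) = X i k j l"
    for i j k l
  proof -
    have FRT': "(SUM m n. rmul G v (scl H (R a m c n) (T m j * T n l))) =
        (SUM m n. rmul G v (scl H (R m j n l) (T c n * T a m)))" for v a c
      using arg_cong[OF FRT[of a c j l], of "rmul G v"] by (simp add: lin_sum[OF lin_rmul2])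
    have "(SUM m n. rmul G (R21_w2_R G R (\<lambda>a b. \<omega> (T a b)) i m k n) (T m j * T n l)) =
        (SUM m n a b c. gscl G (flip_rmat R i a k b)
          (rmul G (\<omega> (T b c)) (scl H (R a m c n) (T m j * T n l))))"
      by (simp add: R21_w2_R_def lin_sum[OF lin_rmul1] lin_scale[OF lin_rmul1] lin_scale[OF lin_rmul2])
    also have "\<dots> = (SUM a b c m n. gscl G (flip_rmat R i a k b)
          (rmul G (\<omega> (T b c)) (scl H (R a m c n) (T m j * T n l))))"
      unfolding sum.cartesian_product
      by (rule sum.reindex_bij_witness[of _ "\<lambda>(a, b, c, m, n). (m, n, a, b, c)"
            "\<lambda>(m, n, a, b, c). (a, b, c, m, n)"]) auto
    also have "\<dots> = (SUM a b c m n. gscl G (flip_rmat R i a k b)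
          (rmul G (\<omega> (T b c)) (scl H (R m j n l) (T c n * T a m))))"
      by (simp only: G.scale_sum_right[symmetric] FRT')
    also have "\<dots> = (SUM m n a b c. gscl G (flip_rmat R i a k b)
          (rmul G (\<omega> (T b c)) (scl H (R m j n l) (T c n * T a m))))"
      unfolding sum.cartesian_product
      by (rule sum.reindex_bij_witness[of _ "\<lambda>(m, n, a, b, c). (a, b, c, m, n)"
            "\<lambda>(a, b, c, m, n). (m, n, a, b, c)"]) auto
    finally show ?thesis
      by (simp add: X_def Rscale_def dif_T lin_sum[OF lin_rmul1] lin_scale[OF lin_rmul2] rmul_mult
          G.scale_sum_right mult.commute)
  qed
  have "t_omega_relation H G R T \<longleftrightarrow>
      (\<forall>i k. \<forall>j l. act H G (T i j) (\<omega> (T k l)) = R21_w2_R G R (\<lambda>a b. \<omega> (T a b)) i j k l)"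
    unfolding t_omega_relation_def by blast
  also have "\<dots> \<longleftrightarrow> (\<forall>i k. \<forall>j l. lmul G (T i j) (dif G (T k l)) = X i k j l)"
  proof -
    have "lmul G (T i j) (dif G (T k l)) =
        (SUM m n. rmul G (act H G (T i m) (\<omega> (T k n))) (T m j * T n l))" for i j k l
    proof -
      have "lmul G (T i j) (dif G (T k l)) =
          (SUM n m. rmul G (act H G (T i m) (\<omega> (T k n))) (T m j * T n l))"
        by (simp add: dif_T lin_sum[OF lin_lmul2] rmul_lmul[symmetric] lmul_T lin_sum[OF lin_rmul1]
            rmul_mult)
      then show ?thesis
        by (subst sum.swap)
    qed
    then show ?thesis
      using rmul_TT_cancel[of "\<lambda>m n. act H G (T i m) (\<omega> (T k n))"
          "\<lambda>m n. R21_w2_R G R (\<lambda>a b. \<omega> (T a b)) i m k n" for i k]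
      by (simp add: X)
  qed
  also have "\<dots> \<longleftrightarrow> R_dt_relation G R T"
  proof -
    define Y where "Y i k j l = (SUM a b.
      gscl G (R i a k b) (rmul G (dif G (T a j)) (T b l)))" for i j k l
    define Z where "Z i k a b = lmul G (T k b) (dif G (T i a))" for i k a b
    have X_Y: "X k i b a = Rscale (flip_rmat R) (Y i k) a b" for i k a b
    proof -
      have "X k i b a = (SUM m n. gscl G (R m b n a) (SUM x y.
          gscl G (R i y k x) (rmul G (dif G (T y n)) (T x m))))"
        unfolding X_def Rscale_def flip_rmat_def ..
      also have "\<dots> = (SUM n m. gscl G (R m b n a) (Y i k n m))"
        by (subst sum.swap, unfold Y_def, subst (4) sum.swap, rule refl)
      finally show ?thesis
        by (simp add: Rscale_def flip_rmat_def)
    qed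
    have "(\<forall>i k. \<forall>j l. lmul G (T i j) (dif G (T k l)) = X i k j l) \<longleftrightarrow>
        (\<forall>i k. Z i k = Rscale (flip_rmat R) (Y i k))"
      unfolding fun_eq_iff X_Y[symmetric] Z_def by blast
    also have "\<dots> \<longleftrightarrow> (\<forall>i k. Y i k = Rscale R (Z i k))"
      by (metis Rscale_mult Rscale_one inv)
    also have "\<dots> \<longleftrightarrow> R_dt_relation G R T"
      unfolding R_dt_relation_def fun_eq_iff Y_def Z_def Rscale_def by blast
    finally show ?thesis .
  qed
  finally show ?thesis .
qed

end

section \<open>The Hopf dual, bracket and braiding\<close>

lemma fs_dual_basis:
  fixes B :: "('x \<Rightarrow> 'k::field) set"
  assumes "fs.independent B" "finite B"
  shows "\<exists>\<phi>. (\<forall>b. lin fscale (*) (\<phi> b)) \<and> (\<forall>v\<in>fs.span B. v = (\<Sum>b\<in>B. fscale (\<phi> b v) b))"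
proof -
  interpret vector_space_pair "fscale :: 'k \<Rightarrow> ('x \<Rightarrow> 'k) \<Rightarrow> _" "(*) :: 'k \<Rightarrow> 'k \<Rightarrow> 'k"
    unfolding vector_space_pair_def using vector_space_fscale vector_space_times by auto
  have "\<forall>b. \<exists>\<phi>. lin fscale (*) \<phi> \<and> (\<forall>d\<in>B. \<phi> d = (if d = b then 1 else 0 :: 'k))"
    by (rule allI, rule linear_independent_extend[OF assms(1)])
  then obtain \<phi> where \<phi>: "\<And>b. lin fscale (*) (\<phi> b)"
    "\<And>b d. d \<in> B \<Longrightarrow> \<phi> b d = (if d = b then 1 else 0)"
    by metis
  have L: "lin fscale fscale (\<lambda>v. \<Sum>b\<in>B. fscale (\<phi> b v) b)"
    by (intro lin_rules \<phi>(1))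
  have "v = (\<Sum>b\<in>B. fscale (\<phi> b v) b)" if "v \<in> fs.span B" for v
  proof -
    interpret P: vector_space_pair "fscale :: 'k \<Rightarrow> ('x \<Rightarrow> 'k) \<Rightarrow> _" "fscale :: 'k \<Rightarrow> ('x \<Rightarrow> 'k) \<Rightarrow> _"
      unfolding vector_space_pair_def using vector_space_fscale by auto
    show ?thesis
    proof (rule P.linear_eq_on[OF lin_ident[OF vector_space_fscale] L that])
      fix d assume d: "d \<in> B"
      have "(\<Sum>b\<in>B. fscale (\<phi> b d) b) = (\<Sum>b\<in>B. if b = d then d else 0)"
        using d by (intro sum.cong) (auto simp: \<phi>(2) fs.scale_zero_left)
      then show "d = (\<Sum>b\<in>B. fscale (\<phi> b d) b)"
        using d assms(2) by simp
    qed
  qed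
  with \<phi>(1) show ?thesis
    by blast
qed

text \<open>The basis is taken among the values of \<beta>, so its members inherit whatever all
  values satisfy; the coefficients are linear in the value, hence linear in a whenever \<beta>
  is.\<close>

lemma finite_rank:
  fixes \<beta> :: "'a::ab_group_add \<Rightarrow> 'x \<Rightarrow> 'k::field"
  assumes "range \<beta> \<subseteq> fs.span W" "finite W"
  obtains B \<phi> where "finite B" "B \<subseteq> range \<beta>" "fs.independent B"
    "\<And>b. lin fscale (*) (\<phi> b)" "\<And>a. \<beta> a = (\<Sum>b\<in>B. fscale (\<phi> b (\<beta> a)) b)"
proof -
  obtain B where B: "B \<subseteq> range \<beta>" "fs.independent B" "range \<beta> \<subseteq> fs.span B"
    using fs.maximal_independent_subset by blast
  have fin: "finite B"
    using fs.independent_span_bound[OF assms(2) B(2)] B(1) assms(1) by blast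
  obtain \<phi> where "\<forall>b. lin fscale (*) (\<phi> b)" "\<forall>v\<in>fs.span B. v = (\<Sum>b\<in>B. fscale (\<phi> b v) b)"
    using fs_dual_basis[OF B(2) fin] by blast
  with that[OF fin B(1,2), of \<phi>] B(3) show ?thesis
    by blast
qed

lemma tens_eval: "tens fscale fscale f g (\<lambda>f g. f a * g b) = f a * (g b :: 'k::field)"
proof -
  have "bilin fscale fscale (*) (\<lambda>f g. f a * (g b :: 'k))"
    by (intro bilinI lin_times_right lin_smult lin_eval lin_ident vector_space_fscale)
  then show ?thesis
    by (simp add: tens_def)
qed

section \<open>Tensors of functionals and the Hopf dual\<close>

context hopf
begin

lemma functionals_iff: "x \<in> functionals H \<longleftrightarrow> lin (scl H) (*) x"
  by (simp add: functionals_def)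

lemma functionals_subspace: "fs.subspace (functionals H)"
proof (rule fs.subspaceI)
  have "lin (scl H) (*) (\<lambda>x. 0)"
    by (intro lin_rules)
  then show "0 \<in> functionals H"
    by (simp add: functionals_def zero_fun_def)
next
  fix x y assume "x \<in> functionals H" "y \<in> functionals H"
  then have "lin (scl H) (*) (\<lambda>a. x a + y a)"
    unfolding functionals_iff by (intro lin_rules)
  then show "x + y \<in> functionals H"
    by (simp add: functionals_def plus_fun_def)
next
  fix c x assume "x \<in> functionals H"
  then have "lin (scl H) (*) (\<lambda>a. c * x a)"
    unfolding functionals_iff by (intro lin_rules)
  then show "fscale c x \<in> functionals H"
    by (simp add: functionals_def fscale_def)
qed

abbreviation dual_tensors :: "('k, 'a \<Rightarrow> 'k, 'a \<Rightarrow> 'k) tensor set" where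
  "dual_tensors \<equiv> tensor_space fscale fscale (functionals H) (functionals H)"

lemmas dual_tensors_list = tensor_space_list[OF vector_space_fscale vector_space_fscale
    functionals_subspace functionals_subspace]

text \<open>Injectivity of the natural map from the tensor square of the dual to bilinear forms on
  A; it gives uniqueness in the definite description \<open>dual_cop\<close>. With the right factors
  rewritten in a basis B, evaluation at all pairs forces the left coefficient of each basis vector
  to vanish.\<close>

lemma tensor_functionals_zero:
  assumes T: "T \<in> dual_tensors"
    and zero: "\<And>a b. T (\<lambda>f g. f a * g b) = 0"
  shows "T = 0"
proof -
  obtain ps where ps: "set ps \<subseteq> functionals H \<times> functionals H" "T = lsum (tens fscale fscale) ps"
    using T dual_tensors_list by blast
  obtain B where B: "B \<subseteq> snd ` set ps" "fs.independent B" "snd ` set ps \<subseteq> fs.span B"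
    using fs.maximal_independent_subset by blast
  have fin: "finite B"
    using B(1) finite_surj by blast
  obtain \<phi> where \<phi>: "\<And>b. lin fscale (*) (\<phi> b)" "\<And>v. v \<in> fs.span B \<Longrightarrow> v = (\<Sum>b\<in>B. fscale (\<phi> b v) b)"
    using fs_dual_basis[OF B(2) fin] by blast
  define u where "u b = lsum (\<lambda>f g. fscale (\<phi> b g) f) ps" for b
  note bt = bilin_tens[OF vector_space_fscale vector_space_fscale]
  have "T = lsum (\<lambda>f g. \<Sum>b\<in>B. tens fscale fscale (fscale (\<phi> b g) f) b) ps"
    unfolding ps(2)
  proof (rule lsum_cong)
    fix f g assume "(f, g) \<in> set ps"
    then have "g \<in> fs.span B"
      using B(3) by force
    then have "tens fscale fscale f g = tens fscale fscale f (\<Sum>b\<in>B. fscale (\<phi> b g) b)"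
      by (rule arg_cong[OF \<phi>(2)])
    then show "tens fscale fscale f g = (\<Sum>b\<in>B. tens fscale fscale (fscale (\<phi> b g) f) b)"
      by (simp only: lin_sum[OF bilinD(2)[OF bt]] lin_scale[OF bilinD(2)[OF bt]]
          lin_scale[OF bilinD(1)[OF bt]])
  qed
  then have T: "T = (\<Sum>b\<in>B. tens fscale fscale (u b) b)"
    unfolding u_def lsum_sum lin_lsum[OF bilinD(1)[OF bt]] .
  have "u b = 0" if "b \<in> B" for b
  proof
    fix a
    have "(\<Sum>b\<in>B. fscale (u b a) b) = 0"
    proof
      fix c
      have "(\<Sum>b\<in>B. u b a * b c) = 0"
        using zero[of a c] by (simp add: T sum_fun_apply tens_eval)
      then show "(\<Sum>b\<in>B. fscale (u b a) b) c = 0 c"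
        by (simp add: sum_fun_apply) (simp add: fscale_def)
    qed
    then show "u b a = 0 a"
      using fs.independentD[OF B(2) fin subset_refl, of "\<lambda>b. u b a"] that by simp
  qed
  then show "T = 0"
    by (simp only: T lin_zero[OF bilinD(1)[OF bt]] sum.neutral_const cong: sum.cong)
qed

lemma tensor_functionals_eqI:
  assumes "T \<in> dual_tensors"
    "T' \<in> dual_tensors"
    "\<And>a b. T (\<lambda>f g. f a * g b) = T' (\<lambda>f g. f a * g b)"
  shows "T = T'"
  using tensor_functionals_zero[of "T - T'"]
    subspace_diffD[OF vector_space_fscale tensor_space_subspace assms(1,2)] assms(3) by simp

lemma hopf_dualI:
  assumes "x \<in> functionals H" "\<And>i. i \<in> I \<Longrightarrow> f i \<in> functionals H" "\<And>i. i \<in> I \<Longrightarrow> g i \<in> functionals H"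
    and "\<And>a b. x (a * b) = (\<Sum>i\<in>I. f i a * g i b)"
  shows "x \<in> hopf_dual H"
proof -
  let ?T = "\<Sum>i\<in>I. tens fscale fscale (f i) (g i)"
  have "?T \<in> dual_tensors"
    using assms by (intro tensor_space_sumI tens_in_tensor_space)
  moreover have "x (a * b) = ?T (\<lambda>f g. f a * g b)" for a b
    by (simp add: assms(4) sum_fun_apply tens_eval)
  ultimately show ?thesis
    using assms(1) unfolding hopf_dual_def by blast
qed

lemma hopf_dual_functionals: "hopf_dual H \<subseteq> functionals H"
  by (auto simp: hopf_dual_def)

lemma hopf_dual_expand:
  assumes "x \<in> hopf_dual H"
  obtains ps where "set ps \<subseteq> functionals H \<times> functionals H"
    "\<And>a b. x (a * b) = lsum (\<lambda>f g. f a * g b) ps"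
proof -
  obtain T where T: "T \<in> dual_tensors"
    "\<And>a b. x (a * b) = T (\<lambda>f g. f a * g b)"
    using assms unfolding hopf_dual_def by blast
  then obtain ps where "set ps \<subseteq> functionals H \<times> functionals H" "T = lsum (tens fscale fscale) ps"
    using dual_tensors_list by blast
  with T(2) show ?thesis
    by (intro that[of ps]) (simp_all add: lsum_apply tens_eval)
qed

text \<open>The translates \<open>c \<mapsto> x(ac)\<close> span a finite-dimensional space. Expanding them in a basis of
  translates gives a coproduct of \<open>x\<close> all of whose components are again in the Hopf dual.\<close>

lemma hopf_dual_coproduct:
  assumes x: "x \<in> hopf_dual H"
  obtains B f where "finite B" "B \<subseteq> hopf_dual H" "\<And>b. f b \<in> hopf_dual H"
    "\<And>a c. x (a * c) = (\<Sum>b\<in>B. f b a * b c)"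
proof -
  obtain ps where ps: "set ps \<subseteq> functionals H \<times> functionals H"
    "\<And>a b. x (a * b) = lsum (\<lambda>f g. f a * g b) ps"
    using hopf_dual_expand[OF x] by blast
  have lin_x [lin_rules]: "lin (scl H) (scl H) g \<Longrightarrow> lin (scl H) (*) (\<lambda>z. x (g z))" for g
    by (rule lin_comp[of "scl H"]) (use x hopf_dual_functionals in \<open>auto simp: functionals_iff\<close>)
  define \<beta> where "\<beta> a = (\<lambda>c. x (a * c))" for a
  have "range \<beta> \<subseteq> fs.span (snd ` set ps)"
  proof
    fix v assume "v \<in> range \<beta>"
    then obtain a where v: "v = \<beta> a" by blast
    have "\<beta> a = lsum (\<lambda>f g. fscale (f a) g) ps"
      by (rule ext) (simp add: \<beta>_def ps(2) lsum_apply, simp add: fscale_def)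
    also have "\<dots> \<in> fs.span (snd ` set ps)"
    proof -
      have "lsum (\<lambda>f g. fscale (f a) g) qs \<in> fs.span (snd ` set ps)" if "set qs \<subseteq> set ps" for qs
        using that
      proof (induction qs)
        case Nil
        show ?case unfolding lsum_Nil by (rule fs.span_zero)
      next
        case (Cons q qs)
        then have "fscale (fst q a) (snd q) \<in> fs.span (snd ` set ps)"
          by (intro fs.span_scale fs.span_base) auto
        then show ?case
          using Cons by (cases q) (auto simp only: lsum_Cons set_simps fst_conv snd_conv
              intro!: fs.span_add)
      qed
      then show ?thesis by blast
    qed
    finally show "v \<in> fs.span (snd ` set ps)"
      using v by simp
  qed
  then obtain B \<phi> where B: "finite B" "B \<subseteq> range \<beta>" "\<And>b. lin fscale (*) (\<phi> b)"
    "\<And>a. \<beta> a = (\<Sum>b\<in>B. fscale (\<phi> b (\<beta> a)) b)"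
    by (rule finite_rank) auto
  define f where "f b a = \<phi> b (\<beta> a)" for b a
  have x_eq: "x (a * c) = (\<Sum>b\<in>B. f b a * b c)" for a c
    using fun_cong[OF B(4)[of a], of c] by (simp add: sum_fun_apply f_def) (simp add: \<beta>_def fscale_def)
  obtain pt where pt: "\<And>b. b \<in> B \<Longrightarrow> \<beta> (pt b) = b"
    using B(2) by (metis f_inv_into_f subsetD)
  have lin_\<beta>: "lin (scl H) fscale \<beta>"
    unfolding \<beta>_def by (rule lin_fun_pointwise[OF vs]) (intro lin_rules)
  have lin_f: "lin (scl H) (*) (\<lambda>z. f b (g z))" if "lin (scl H) (scl H) g" for b g
    unfolding f_def by (intro lin_comp[OF B(3)] lin_comp[OF lin_\<beta>] that)
  have f_mult: "f b (a * c) = (\<Sum>d\<in>B. f d a * f b (pt d * c))" for b a c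
  proof -
    have "\<beta> (a * c) = (\<Sum>d\<in>B. fscale (f d a) (\<beta> (pt d * c)))"
    proof
      fix e
      have "\<beta> (pt d * c) e = d (c * e)" if "d \<in> B" for d
        using pt[OF that] by (simp add: \<beta>_def mult.assoc fun_eq_iff)
      then show "\<beta> (a * c) e = (\<Sum>d\<in>B. fscale (f d a) (\<beta> (pt d * c))) e"
        using x_eq[of a "c * e"]
        by (simp add: sum_fun_apply, simp add: fscale_def)
          (simp add: \<beta>_def mult.assoc)
    qed
    then show ?thesis
      unfolding f_def[of b] by (simp add: lin_sum[OF B(3)] lin_scale[OF B(3)])
  qed
  have f_in: "f b \<in> functionals H" "(\<lambda>c. f b (a * c)) \<in> functionals H" for b a
    unfolding functionals_iff by (intro lin_f lin_rules lin_f[OF lin_id])+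
  have b_in: "b \<in> functionals H" if "b \<in> B" for b
  proof -
    have "\<beta> (pt b) \<in> functionals H"
      unfolding functionals_iff \<beta>_def by (intro lin_rules)
    then show ?thesis
      by (simp only: pt[OF that])
  qed
  show ?thesis
  proof (rule that[of B f, OF B(1) _ _ x_eq])
    show "f b \<in> hopf_dual H" for b
      by (rule hopf_dualI[of _ B f "\<lambda>d c. f b (pt d * c)"], rule f_in, rule f_in, rule f_in, rule f_mult)
    show "B \<subseteq> hopf_dual H"
    proof
      fix b assume b: "b \<in> B"
      show "b \<in> hopf_dual H"
      proof (rule hopf_dualI[of _ B "\<lambda>d a. f d (pt b * a)" "\<lambda>d. d"])
        fix a c
        have "b (a * c) = x (pt b * a * c)"
          using fun_cong[OF pt[OF b], of "a * c"] by (simp add: \<beta>_def mult.assoc)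
        then show "b (a * c) = (\<Sum>d\<in>B. f d (pt b * a) * d c)"
          by (simp add: x_eq)
      qed (use b_in f_in b in auto)
    qed
  qed
qed

lemma hopf_dual_subspace: "fs.subspace (hopf_dual H)"
proof (rule fs.subspaceI)
  show "0 \<in> hopf_dual H"
    by (rule hopf_dualI[of _ "{}"]) (auto simp: subspace_zeroD[OF vector_space_fscale functionals_subspace])
next
  fix x y assume x: "x \<in> hopf_dual H" and y: "y \<in> hopf_dual H"
  obtain T where T: "T \<in> dual_tensors"
    "\<And>a b. x (a * b) = T (\<lambda>f g. f a * g b)"
    using x unfolding hopf_dual_def by blast
  obtain T' where T': "T' \<in> dual_tensors"
    "\<And>a b. y (a * b) = T' (\<lambda>f g. f a * g b)"
    using y unfolding hopf_dual_def by blast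
  have "T + T' \<in> dual_tensors"
    by (rule tensor_space_addI[OF T(1) T'(1)])
  moreover have "x + y \<in> functionals H"
    using x y hopf_dual_functionals subspace_addD[OF vector_space_fscale functionals_subspace] by blast
  ultimately show "x + y \<in> hopf_dual H"
    unfolding hopf_dual_def using T(2) T'(2) by (auto intro!: bexI[of _ "T + T'"])
next
  fix c x assume x: "x \<in> hopf_dual H"
  obtain T where T: "T \<in> dual_tensors"
    "\<And>a b. x (a * b) = T (\<lambda>f g. f a * g b)"
    using x unfolding hopf_dual_def by blast
  have "fscale c T \<in> dual_tensors"
    by (rule subspace_scaleD[OF vector_space_fscale tensor_space_subspace T(1)])
  moreover have "fscale c x \<in> functionals H"
    using x hopf_dual_functionals subspace_scaleD[OF vector_space_fscale functionals_subspace] by blast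
  ultimately show "fscale c x \<in> hopf_dual H"
    unfolding hopf_dual_def using T(2) by (auto intro!: bexI[of _ "fscale c T"] simp: fscale_def)
qed

lemma tensor_hopf_dual_functionals:
  "tensor_space fscale fscale (hopf_dual H) (hopf_dual H) \<subseteq>
   dual_tensors"
  unfolding tensor_space_def using hopf_dual_functionals by (intro fs.span_mono) blast

text \<open>Existence comes from \<open>hopf_dual_coproduct\<close>, whose components stay in the
  Hopf dual, and uniqueness from \<open>tensor_functionals_eqI\<close>. The list works for every F,
  which is essential for F built from \<open>bracket\<close>.\<close>

lemma dual_sw_rep:
  assumes x: "x \<in> hopf_dual H"
  obtains ps where "set ps \<subseteq> hopf_dual H \<times> hopf_dual H"
    "\<And>a c. x (a * c) = lsum (\<lambda>f g. f a * g c) ps"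
    "\<And>F :: _ \<Rightarrow> _ \<Rightarrow> 'c::ab_group_add. dual_sw H F x = lsum F ps"
proof -
  let ?P = "\<lambda>T. T \<in> tensor_space fscale fscale (hopf_dual H) (hopf_dual H) \<and>
     (\<forall>a b. x (a * b) = T (\<lambda>f g. f a * g b))"
  have "\<exists>!T. ?P T"
  proof (rule ex_ex1I)
    obtain B f where B: "finite B" "B \<subseteq> hopf_dual H" "\<And>b. f b \<in> hopf_dual H"
      "\<And>a c. x (a * c) = (\<Sum>b\<in>B. f b a * b c)"
      by (rule hopf_dual_coproduct[OF x]) blast
    have "?P (\<Sum>b\<in>B. tens fscale fscale (f b) b)"
      using B by (auto simp: sum_fun_apply tens_eval
          intro!: tensor_space_sumI tens_in_tensor_space)
    then show "\<exists>T. ?P T" by blast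
  next
    fix T T' assume "?P T" "?P T'"
    then show "T = T'"
      using tensor_hopf_dual_functionals by (intro tensor_functionals_eqI) auto
  qed
  then have P: "?P (dual_cop H x)"
    unfolding dual_cop_def by (rule theI')
  then obtain ps where "set ps \<subseteq> hopf_dual H \<times> hopf_dual H"
    "dual_cop H x = lsum (tens fscale fscale) ps"
    "\<And>F :: _ \<Rightarrow> _ \<Rightarrow> 'c. tlift fscale fscale (hopf_dual H) (hopf_dual H) F (dual_cop H x) = lsum F ps"
    using tlift_rep[OF vector_space_fscale vector_space_fscale hopf_dual_subspace hopf_dual_subspace]
    by metis
  with P show ?thesis
    by (intro that[of ps]) (simp_all add: dual_sw_def lsum_apply tens_eval)
qed

text \<open>The bracket as an explicit formula on H. It makes sense for arbitrary functionals and is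
  visibly bilinear, neither of which is evident for \<open>bracket\<close>, defined through a chosen
  coproduct.\<close>

definition br :: "('a \<Rightarrow> 'k) \<Rightarrow> ('a \<Rightarrow> 'k) \<Rightarrow> 'a \<Rightarrow> 'k" where
  "br x y a = sw3 H (\<lambda>a1 a2 a3. x (a1 * S a3) * y a2) a"

lemma bilin_br: "bilin fscale fscale fscale br"
proof (intro bilinI)
  show "lin fscale fscale (\<lambda>x. br x y)" for y
    by (rule lin_fun_pointwise[OF vector_space_fscale], unfold br_def)
      (intro lin_rules lin_eval[OF lin_ident[OF vector_space_fscale]])
  show "lin fscale fscale (br x)" for x
    by (rule lin_fun_pointwise[OF vector_space_fscale], unfold br_def)
      (intro lin_rules lin_eval[OF lin_ident[OF vector_space_fscale]])
qed

lemma bracket_br: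
  assumes "x \<in> hopf_dual H"
  shows "bracket H x y = br x y"
proof
  fix a
  obtain ps where ps: "set ps \<subseteq> hopf_dual H \<times> hopf_dual H"
    "\<And>a c. x (a * c) = lsum (\<lambda>f g. f a * g c) ps"
    "\<And>F :: _ \<Rightarrow> _ \<Rightarrow> 'a \<Rightarrow> 'k. dual_sw H F x = lsum F ps"
    using dual_sw_rep[OF assms] by blast
  have "bracket H x y a = lsum (\<lambda>f g. sw3 H (\<lambda>s t v. f s * y t * g (S v)) a) ps"
    unfolding bracket_def ps(3) lsum_apply conv_def sw3_def o_def
    by (simp add: lin_sw[OF lin_times_right[OF lin_ident[OF vector_space_times]]])
  also have "\<dots> = sw3 H (\<lambda>s t v. lsum (\<lambda>f g. f s * g (S v) * y t) ps) a"
    unfolding sw3_def sw_crep by (subst lsum_swap, subst lsum_swap) (simp add: mult.commute mult.left_commute)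
  also have "\<dots> = br x y a"
    unfolding br_def ps(2)
    by (simp add: lin_lsum[OF lin_times_right[OF lin_ident[OF vector_space_times]]])
  finally show "bracket H x y a = br x y a" .
qed

text \<open>The term x \<otimes> \<epsilon> of the coproduct contributes [x, y] \<otimes>
  \<epsilon>, exactly what \<open>braiding\<close> subtracts. The components of the given expansion
  are only assumed to be functionals, so it is compared with the chosen one in the tensor square of
  the full dual.\<close>

lemma braiding_br:
  assumes x: "x \<in> functionals H" and M: "\<And>i. i \<in> I \<Longrightarrow> M i \<in> functionals H"
    and X: "\<And>i. i \<in> I \<Longrightarrow> X i \<in> functionals H" and fin: "finite I"
    and x_eq: "\<And>a b. x (a * b) = x a * \<epsilon> b + (\<Sum>i\<in>I. M i a * X i b)"
  shows "x \<in> hopf_dual H" "braiding H x y = (\<Sum>i\<in>I. tens fscale fscale (br (M i) y) (X i))"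
proof -
  have eps: "\<epsilon> \<in> functionals H"
    unfolding functionals_iff by (rule lin_cou')
  \<comment> \<open>The extra index \<open>None\<close> carries the summand x \<otimes>
    \<epsilon>.\<close>
  show x_dual: "x \<in> hopf_dual H"
  proof (rule hopf_dualI[of _ "insert None (Some ` I)"
        "\<lambda>i. case i of None \<Rightarrow> x | Some i \<Rightarrow> M i" "\<lambda>i. case i of None \<Rightarrow> \<epsilon> | Some i \<Rightarrow> X i"])
    show "x (a * b) = (\<Sum>i\<in>insert None (Some ` I). (case i of None \<Rightarrow> x | Some i \<Rightarrow> M i) a *
        (case i of None \<Rightarrow> \<epsilon> | Some i \<Rightarrow> X i) b)" for a b
      using fin by (simp add: x_eq sum.reindex)
  qed (use x M X eps in \<open>auto split: option.splits\<close>)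
  obtain ps where ps: "set ps \<subseteq> hopf_dual H \<times> hopf_dual H"
    "\<And>a c. x (a * c) = lsum (\<lambda>f g. f a * g c) ps"
    "\<And>F :: _ \<Rightarrow> _ \<Rightarrow> (('a \<Rightarrow> 'k) \<Rightarrow> ('a \<Rightarrow> 'k) \<Rightarrow> 'k) \<Rightarrow> 'k. dual_sw H F x = lsum F ps"
    using dual_sw_rep[OF x_dual] by blast
  let ?F = "\<lambda>x1 x2. tens fscale fscale (br x1 y) x2"
  let ?t = "tlift fscale fscale (functionals H) (functionals H) ?F"
  have bil: "bil_on fscale fscale fscale (functionals H) (functionals H) ?F"
    by (intro bil_onI bilinI functionals_subspace tens_linear vector_space_fscale
        bilinD(1)[OF bilin_br] lin_ident)
  have ps': "set ps \<subseteq> functionals H \<times> functionals H"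
    using ps(1) hopf_dual_functionals by blast
  have T1: "tens fscale fscale x \<epsilon> \<in> dual_tensors"
    by (intro tens_in_tensor_space x eps)
  have T2: "(\<Sum>i\<in>I. tens fscale fscale (M i) (X i)) \<in> dual_tensors"
    using M X by (intro tensor_space_sumI tens_in_tensor_space)
  have "lsum (tens fscale fscale) ps = tens fscale fscale x \<epsilon> + (\<Sum>i\<in>I. tens fscale fscale (M i) (X i))"
  proof (rule tensor_functionals_eqI)
    show "lsum (tens fscale fscale) ps \<in> dual_tensors"
      using ps' dual_tensors_list by blast
    show "tens fscale fscale x \<epsilon> + (\<Sum>i\<in>I. tens fscale fscale (M i) (X i))
        \<in> dual_tensors"
      by (rule tensor_space_addI[OF T1 T2])
    show "lsum (tens fscale fscale) ps (\<lambda>f g. f a * g b) =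
        (tens fscale fscale x \<epsilon> + (\<Sum>i\<in>I. tens fscale fscale (M i) (X i))) (\<lambda>f g. f a * g b)" for a b
      using ps(2)[of a b] by (simp add: lsum_apply tens_eval sum_fun_apply x_eq)
  qed
  then have "lsum ?F ps = ?t (tens fscale fscale x \<epsilon> + (\<Sum>i\<in>I. tens fscale fscale (M i) (X i)))"
    using tlift_lsum[OF bil ps'] by metis
  also have "\<dots> = ?F x \<epsilon> + (\<Sum>i\<in>I. ?F (M i) (X i))"
    using M X by (subst tlift_add[OF bil T1 T2], subst tlift_tens[OF bil x eps],
        subst tlift_sum_tens[OF bil]) auto
  finally have *: "lsum ?F ps = ?F x \<epsilon> + (\<Sum>i\<in>I. ?F (M i) (X i))" .
  have "dual_sw H (\<lambda>x1 x2. tens fscale fscale (bracket H x1 y) x2) x = lsum ?F ps"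
    unfolding ps(3) using ps(1) by (intro lsum_cong) (auto simp: bracket_br)
  then show "braiding H x y = (\<Sum>i\<in>I. tens fscale fscale (br (M i) y) (X i))"
    unfolding braiding_def * bracket_br[OF x_dual] by simp
qed

end

section \<open>The FRT bialgebra\<close>

text \<open>With the words of A(R) as values this is \<open>eval_free\<close>; a variable target
  lets a function on words be extended linearly to the free algebra before passing to the
  quotient.\<close>

definition fext :: "('k::field \<Rightarrow> 'c::ab_group_add \<Rightarrow> 'c) \<Rightarrow> ('w \<Rightarrow> 'c) \<Rightarrow> ('w \<Rightarrow> 'k) \<Rightarrow> 'c" where
  "fext s X p = (\<Sum>w | p w \<noteq> 0. s (p w) (X w))"

abbreviation fin_supp :: "('w \<Rightarrow> 'k::field) \<Rightarrow> bool" where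
  "fin_supp p \<equiv> finite {w. p w \<noteq> 0}"

lemma fin_supp_subspace: "fs.subspace {p :: 'w \<Rightarrow> 'k::field. fin_supp p}"
proof (rule fs.subspaceI; clarsimp)
  show "fin_supp (\<lambda>w. x w + y w)" if "fin_supp x" "fin_supp y" for x y :: "'w \<Rightarrow> 'k"
    by (rule finite_subset[OF _ finite_UnI[OF that]]) auto
  show "fin_supp (fscale c x)" if "fin_supp x" for c and x :: "'w \<Rightarrow> 'k"
    by (rule finite_subset[OF _ that]) (auto simp: fscale_def)
qed

lemma fin_supp_add: "fin_supp p \<Longrightarrow> fin_supp q \<Longrightarrow> fin_supp (p + q :: 'w \<Rightarrow> 'k::field)"
  using subspace_addD[OF vector_space_fscale fin_supp_subspace, of p q] by simp

lemma fin_supp_diff: "fin_supp p \<Longrightarrow> fin_supp q \<Longrightarrow> fin_supp (p - q :: 'w \<Rightarrow> 'k::field)"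
  using subspace_diffD[OF vector_space_fscale fin_supp_subspace, of p q] by simp

lemma fin_supp_scale: "fin_supp p \<Longrightarrow> fin_supp (fscale c p :: 'w \<Rightarrow> 'k::field)"
  using subspace_scaleD[OF vector_space_fscale fin_supp_subspace, of p c] by simp

lemma fin_supp_sum:
  assumes "\<And>i. i \<in> I \<Longrightarrow> fin_supp (p i)"
  shows "fin_supp (\<Sum>i\<in>I. p i :: 'w \<Rightarrow> 'k::field)"
proof -
  have "(\<Sum>i\<in>I. p i) \<in> {p. fin_supp p}"
    using assms by (intro subspace_sumD[OF vector_space_fscale fin_supp_subspace] CollectI)
  then show ?thesis
    by (rule CollectD)
qed

lemma fin_supp_kd: "fin_supp (kd w :: 'w \<Rightarrow> 'k::field)"
  by (rule finite_subset[of _ "{w}"]) (auto simp: kd_def)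

context
  fixes s :: "'k::field \<Rightarrow> 'c::ab_group_add \<Rightarrow> 'c" and X :: "'w \<Rightarrow> 'c"
  assumes s: "vector_space s"
begin

interpretation vector_space s by (rule s)

lemma fext_superset: "finite F \<Longrightarrow> {w. p w \<noteq> 0} \<subseteq> F \<Longrightarrow> fext s X p = (\<Sum>w\<in>F. s (p w) (X w))"
  unfolding fext_def by (rule sum.mono_neutral_left) auto

lemma fext_add:
  assumes "fin_supp p" "fin_supp p'"
  shows "fext s X (p + p') = fext s X p + fext s X p'"
proof -
  let ?F = "{w. p w \<noteq> 0} \<union> {w. p' w \<noteq> 0}"
  have F: "finite ?F" using assms by simp
  have "fext s X (p + p') = (\<Sum>w\<in>?F. s ((p + p') w) (X w))"
    by (rule fext_superset[OF F]) auto
  moreover have "fext s X p = (\<Sum>w\<in>?F. s (p w) (X w))" "fext s X p' = (\<Sum>w\<in>?F. s (p' w) (X w))"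
    by (rule fext_superset[OF F], blast)+
  ultimately show ?thesis
    by (simp add: scale_left_distrib sum.distrib)
qed

lemma fext_scale:
  assumes "fin_supp p"
  shows "fext s X (fscale c p) = s c (fext s X p)"
proof -
  have "fext s X (fscale c p) = (\<Sum>w | p w \<noteq> 0. s (fscale c p w) (X w))"
    by (rule fext_superset[OF assms]) (auto simp: fscale_def)
  then show ?thesis
    by (simp add: fext_def scale_sum_right fscale_def)
qed

lemma fext_kd: "fext s X (kd w) = X w"
proof -
  have "fext s X (kd w) = (\<Sum>v\<in>{w}. s (kd w v) (X v))"
    by (rule fext_superset) (auto simp: kd_def)
  then show ?thesis
    by (simp add: kd_def)
qed

lemma fext_diff:
  assumes "fin_supp p" "fin_supp p'"
  shows "fext s X (p - p') = fext s X p - fext s X p'"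
proof -
  have "fin_supp (p - p')"
    using assms by (rule fin_supp_diff)
  then show ?thesis
    using fext_add[of "p - p'" p'] assms by simp
qed

lemma fext_sum:
  assumes "\<And>i. i \<in> I \<Longrightarrow> fin_supp (p i)"
  shows "fext s X (\<Sum>i\<in>I. p i) = (\<Sum>i\<in>I. fext s X (p i))"
  using assms
proof (induction I rule: infinite_finite_induct)
  case (insert i I)
  have "fin_supp (\<Sum>i\<in>I. p i)"
    using insert by (intro fin_supp_sum) blast
  then have "fext s X (p i + (\<Sum>i\<in>I. p i)) = fext s X (p i) + fext s X (\<Sum>i\<in>I. p i)"
    using insert by (intro fext_add) simp_all
  then show ?case
    using insert.IH insert.prems by (simp only: sum.insert[OF insert.hyps]) simp
qed (simp_all add: fext_def)

end

section \<open>Words and relations of A(R)\<close>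

context frt_bialgebra
begin

sublocale M: bialg M
  by unfold_locales (rule bialgebra)

definition word :: "('n \<times> 'n) list \<Rightarrow> 'm" where
  "word w = prod_list (map (\<lambda>(i, j). t i j) w)"

lemma word_simps: "word [] = 1" "word ((i, j) # w) = t i j * word w" "word (u @ v) = word u * word v"
  by (simp_all add: word_def)

lemma eval_free_fext: "eval_free (scl M) t = fext (scl M) word"
  by (simp add: fun_eq_iff eval_free_def fext_def word_def)

lemma word_span:
  assumes V: "M.subspace V" and "\<And>w. word w \<in> V"
  shows "a \<in> V"
proof -
  obtain p where "finite {w. p w \<noteq> 0}" "eval_free (scl M) t p = a"
    using generated by blast
  then show ?thesis
    using assms unfolding eval_free_fext fext_def by (auto intro!: M.subspace_sum M.subspace_scale)
qed

lemma frt_induct: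
  assumes "M.subspace V" "1 \<in> V" "\<And>i j a. a \<in> V \<Longrightarrow> t i j * a \<in> V"
  shows "a \<in> V"
proof (rule word_span[OF assms(1)])
  show "word w \<in> V" for w
    by (induction w) (use assms in \<open>auto simp: word_simps\<close>)
qed

text \<open>The cocycle rule for tangent vectors peels off the last generator, whence the
  right-handed induction.\<close>

lemma frt_induct_right:
  assumes "M.subspace V" "1 \<in> V" "\<And>i j a. a \<in> V \<Longrightarrow> a * t i j \<in> V"
  shows "a \<in> V"
proof (rule word_span[OF assms(1)])
  show "word w \<in> V" for w
    by (induction w rule: rev_induct) (use assms in \<open>auto simp: word_simps\<close>)
qed

lemma lin_eq_on_words:
  assumes "lin (scl M) s f" "lin (scl M) s g" "\<And>w. f (word w) = g (word w)"
  shows "f a = g a"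
proof -
  interpret C: vector_space s by (rule lin_vs[OF assms(1)])
  have "a \<in> {a. f a - g a \<in> {0}}"
    by (rule word_span[OF subspace_vimage[OF lin_minus[OF assms(1,2)] C.subspace_single_0]])
      (simp add: assms(3))
  then show ?thesis by simp
qed

lemma fin_supp_relator_sum:
  "fin_supp (\<Sum>i\<in>I. \<Sum>j\<in>J. fscale (c i j) (kd (w i j)) :: _ \<Rightarrow> 'k)"
  by (intro fin_supp_sum fin_supp_scale fin_supp_kd)

lemma fin_supp_relator: "fin_supp (frt_relator R u v i j k l)"
  unfolding frt_relator_def by (intro fin_supp_diff fin_supp_relator_sum)

lemma fext_relator:
  assumes "vector_space s"
  shows "fext s X (frt_relator R u v i j k l) =
    (SUM a b. s (R i a k b) (X (u @ [(a, j), (b, l)] @ v)))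
     - (SUM a b. s (R a j b l) (X (u @ [(k, b), (i, a)] @ v)))"
proof -
  have *: "fext s X (\<Sum>i\<in>I. \<Sum>j\<in>J. fscale (c i j) (kd (w i j))) = (\<Sum>i\<in>I. \<Sum>j\<in>J. s (c i j) (X (w i j)))"
    for I J :: "'n set" and c w
    by (simp only: fext_sum[OF assms fin_supp_sum] fext_sum[OF assms] fin_supp_scale fin_supp_kd
        fext_scale[OF assms fin_supp_kd] fext_kd[OF assms])
  show ?thesis
    unfolding frt_relator_def by (simp only: fext_diff[OF assms fin_supp_relator_sum fin_supp_relator_sum] *)
qed

lemma FRT: "(SUM a b. scl M (R i a k b) (t a j * t b l)) =
      (SUM a b. scl M (R a j b l) (t k b * t i a))"
proof -
  let ?p = "frt_relator R [] [] i j k l"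
  have "?p \<in> module.span fscale {frt_relator R u v i j k l | u v i j k l. True}"
    by (rule fs.span_base) blast
  moreover have "fin_supp ?p"
    by (rule fin_supp_relator)
  ultimately have "fext (scl M) word ?p = 0"
    using relations[of ?p] unfolding eval_free_fext by blast
  then show ?thesis
    by (simp add: fext_relator[OF M.vs] word_def)
qed

text \<open>The kernel of evaluation is spanned by the relators in all contexts u, v, so a function
  on words whose linear extension kills these descends to A(R).\<close>

lemma frt_functional:
  fixes X :: "('n \<times> 'n) list \<Rightarrow> 'k"
  assumes X: "\<And>u v i j k l. (SUM a b. R i a k b * X (u @ [(a, j), (b, l)] @ v)) =
     (SUM a b. R a j b l * X (u @ [(k, b), (i, a)] @ v))"
  shows "\<exists>\<chi>. lin (scl M) (*) \<chi> \<and> (\<forall>w. \<chi> (word w) = X w)"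
proof -
  let ?Rel = "module.span fscale {frt_relator R u v i j k l | u v i j k l. True}"
  note vt = vector_space_times
  \<comment> \<open>One preimage in the free algebra is chosen per element; \<open>indep\<close>
    below shows the value to be independent of it, from which linearity follows.\<close>
  define pre where "pre a = (SOME p. fin_supp p \<and> fext (scl M) word p = a)" for a
  have pre: "fin_supp (pre a)" "fext (scl M) word (pre a) = a" for a
    using someI_ex[of "\<lambda>p. fin_supp p \<and> fext (scl M) word p = a"] generated[of a]
    unfolding pre_def eval_free_fext by auto
  have rel: "fin_supp p \<and> fext (*) X p = 0" if "p \<in> ?Rel" for p
    using that
  proof (induction rule: fs.span_induct_alt)
    case base
    show ?case by (simp add: fext_def)
  next
    case (step c x y)
    then obtain u v i j k l where x: "x = frt_relator R u v i j k l" by blast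
    have "fin_supp x"
      unfolding x by (rule fin_supp_relator)
    moreover have "fext (*) X x = 0"
      unfolding x fext_relator[OF vt] by (simp only: X diff_self)
    moreover have "fin_supp (fscale c x)"
      using \<open>fin_supp x\<close> by (rule fin_supp_scale)
    moreover have "fin_supp (fscale c x + y)"
      using \<open>fin_supp (fscale c x)\<close> step by (intro fin_supp_add) simp_all
    moreover have "fext (*) X (fscale c x + y) = 0"
      using step calculation by (simp only: fext_add[OF vt] fext_scale[OF vt]) simp
    ultimately show ?case by blast
  qed
  have indep: "fext (*) X p = fext (*) X p'"
    if "fin_supp p" "fin_supp p'" "fext (scl M) word p = fext (scl M) word p'" for p p'
  proof -
    have fs: "fin_supp (p - p')"
      using that by (intro fin_supp_diff)
    moreover have "fext (scl M) word (p - p') = 0"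
      using that by (simp add: fext_diff[OF M.vs])
    ultimately have "p - p' \<in> ?Rel"
      using relations[of "p - p'"] unfolding eval_free_fext by blast
    then show ?thesis
      using rel fext_diff[OF vt that(1,2), of X] by fastforce
  qed
  define \<chi> where "\<chi> a = fext (*) X (pre a)" for a
  have "lin (scl M) (*) \<chi>"
  proof (rule linI[OF M.vs vt])
    fix a b
    have "fin_supp (pre a + pre b)"
      by (intro fin_supp_add pre)
    then have "\<chi> (a + b) = fext (*) X (pre a + pre b)"
      unfolding \<chi>_def by (intro indep pre(1)) (simp_all only: pre fext_add[OF M.vs])
    then show "\<chi> (a + b) = \<chi> a + \<chi> b"
      by (simp only: \<chi>_def fext_add[OF vt] pre)
  next
    fix c a
    have "fin_supp (fscale c (pre a))"
      by (intro fin_supp_scale pre)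
    then have "\<chi> (scl M c a) = fext (*) X (fscale c (pre a))"
      unfolding \<chi>_def by (intro indep pre(1)) (simp_all only: pre fext_scale[OF M.vs])
    then show "\<chi> (scl M c a) = c * \<chi> a"
      by (simp only: \<chi>_def fext_scale[OF vt] pre)
  qed
  moreover have "\<chi> (word w) = X w" for w
  proof -
    have "\<chi> (word w) = fext (*) X (kd w)"
      unfolding \<chi>_def by (intro indep pre(1) fin_supp_kd) (simp only: pre fext_kd[OF M.vs])
    then show ?thesis
      by (simp only: fext_kd[OF vt])
  qed
  ultimately show ?thesis by blast
qed

lemmas sw_t = M.sw_matrix[of t, OF cop_t]
lemmas sw3_t = M.sw3_matrix[of t, OF cop_t]

lemma sw3_t_mult:
  assumes f: "\<And>y z. lin (scl M) sC (\<lambda>x. f x y z)" "\<And>x z. lin (scl M) sC (\<lambda>y. f x y z)"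
    "\<And>x y. lin (scl M) sC (\<lambda>z. f x y z)"
  shows "sw3 M f (t i j * a) =
    (SUM x y. sw3 M (\<lambda>u v w. f (t i x * u) (t x y * v) (t y j * w)) a)"
proof -
  have f': "lin (scl M) sC (\<lambda>x. f (c * x) y z)" "lin (scl M) sC (\<lambda>x. f y (c * x) z)"
    "lin (scl M) sC (\<lambda>x. f y z (c * x))" "lin (scl M) sC (\<lambda>x. f (x * c) y z)"
    "lin (scl M) sC (\<lambda>x. f y (x * c) z)" "lin (scl M) sC (\<lambda>x. f y z (x * c))" for c y z
    by (rule lin_comp[OF f(1)] lin_comp[OF f(2)] lin_comp[OF f(3)], intro lin_rules)+
  show ?thesis
    by (subst M.sw3_mult[OF f], subst sw3_t[of sC]) (intro lin_rules f' refl)+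
qed

end

section \<open>Grouplike elements\<close>

lemma (in bialg) cop_sw: "cop B a = sw B (tens (scl B) (scl B)) a"
  unfolding sw_crep by (rule cop_crep)

lemma (in bialg) grouplike_inverse:
  assumes g: "grouplike B g" and inv: "g * g' = 1" "g' * g = 1"
  shows "grouplike B g'"
proof -
  let ?f = "\<lambda>x y. tens (scl B) (scl B) (g' * x) (g' * y)"
  have "tens (scl B) (scl B) g' g' = sw B ?f (g * g')"
    unfolding inv by (subst sw_one[of fscale], (intro lin_rules)+) simp
  also have "\<dots> = sw B (\<lambda>u v. tens (scl B) (scl B) (g' * (g * u)) (g' * (g * v))) g'"
    by (subst sw_mult[of fscale], intro lin_rules, intro lin_rules,
        subst sw_grouplike[of fscale, OF _ _ g], intro lin_rules, intro lin_rules, rule refl)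
  also have "\<dots> = cop B g'"
    by (simp add: inv cop_sw flip: mult.assoc)
  moreover have "cou B g' = 1"
    using cou_mult[of g g'] g by (simp add: inv cou_one grouplike_def)
  ultimately show ?thesis
    by (simp add: grouplike_def)
qed

lemma (in bialg) grouplike_mult:
  assumes g: "grouplike B g" and h: "grouplike B h"
  shows "grouplike B (g * h)"
proof -
  have "cop B (g * h) = tens (scl B) (scl B) (g * h) (g * h)"
    unfolding cop_sw
    by (subst sw_mult[of fscale], intro lin_rules, intro lin_rules,
        subst sw_grouplike[of fscale, OF _ _ g], intro lin_rules, intro lin_rules,
        subst sw_grouplike[of fscale, OF _ _ h], intro lin_rules, intro lin_rules, rule refl)
  then show ?thesis
    using g h by (simp add: grouplike_def cou_mult)
qed

lemma (in bialg) grouplike_one: "grouplike B 1"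
  using bialgebra by (simp add: grouplike_def bialgebra_def)

lemma (in bialg) grouplike_power: "grouplike B g \<Longrightarrow> grouplike B (g ^ m)"
  by (induction m) (simp_all add: grouplike_one grouplike_mult)

lemma (in bialg) sw3_grouplike:
  assumes g: "grouplike B g"
    and f: "\<And>y z. lin (scl B) sC (\<lambda>x. f x y z)" "\<And>x z. lin (scl B) sC (\<lambda>y. f x y z)"
    "\<And>x y. lin (scl B) sC (\<lambda>z. f x y z)"
  shows "sw3 B f g = f g g g"
  unfolding sw3_def
  by (subst sw_grouplike[of sC, OF _ _ g], intro sw_lin[of _ _ sC] lin_rules f, intro lin_rules f,
      subst sw_grouplike[of sC, OF _ _ g], intro f, intro f, rule refl)

lemma (in bialg) sw3_mult_grouplike:
  assumes g: "grouplike B g"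
    and f: "\<And>y z. lin (scl B) sC (\<lambda>x. f x y z)" "\<And>x z. lin (scl B) sC (\<lambda>y. f x y z)"
    "\<And>x y. lin (scl B) sC (\<lambda>z. f x y z)"
  shows "sw3 B f (a * g) = sw3 B (\<lambda>x y z. f (x * g) (y * g) (z * g)) a"
proof -
  have f': "lin (scl B) sC (\<lambda>x. f (c * x) y z)" "lin (scl B) sC (\<lambda>x. f y (c * x) z)"
    "lin (scl B) sC (\<lambda>x. f y z (c * x))" for c y z
    by (rule lin_comp[OF f(1)] lin_comp[OF f(2)] lin_comp[OF f(3)], intro lin_rules)+
  show ?thesis
    by (subst sw3_mult[OF f], subst sw3_grouplike[OF g, of sC])
      (intro f' refl)+
qed

lemma (in hopf) grouplike_antip:
  assumes "grouplike H g"
  shows "S g * g = 1" "g * S g = 1"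
proof -
  have "sw H (\<lambda>x y. S x * y) g = S g * g" "sw H (\<lambda>x y. x * S y) g = g * S g"
    by (rule sw_grouplike[of "scl H", OF _ _ assms]; intro lin_rules)+
  then show "S g * g = 1" "g * S g = 1"
    using assms by (simp_all add: antip_left antip_right grouplike_def)
qed

section \<open>Left ideals and tangent spaces\<close>

lemma (in hopf) uprod_left_ideal:
  assumes "left_ideal H G = ker_uprod_ker H r" "cou H a = 0" "cou H b = 0"
  shows "uprod H r a b \<in> left_ideal H G"
  unfolding assms(1) ker_uprod_ker_def using assms(2,3) by (intro span_base) blast

lemma (in hopf) tangentI:
  assumes x: "lin (scl H) (*) x" "x 1 = 0" and ideal: "left_ideal H G = ker_uprod_ker H r"
    and "\<And>a b. cou H a = 0 \<Longrightarrow> cou H b = 0 \<Longrightarrow> x (uprod H r a b) = 0"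
  shows "x \<in> tangent H G"
proof -
  have "ker_uprod_ker H r \<subseteq> {a. x a \<in> {0}}"
    unfolding ker_uprod_ker_def
    by (rule span_minimal[OF _ subspace_vimage[OF x(1) subspace_zero_set[OF vector_space_times]]])
      (use assms(4) in auto)
  then show ?thesis
    unfolding tangent_def functionals_def ideal using x by auto
qed

lemma (in hopf) tangent_subspace: "fs.subspace (tangent H G)"
proof (rule fs.subspaceI)
  show "0 \<in> tangent H G"
    using subspace_zeroD[OF vector_space_fscale functionals_subspace] by (simp add: tangent_def)
  show "x + y \<in> tangent H G" if "x \<in> tangent H G" "y \<in> tangent H G" for x y
    using that subspace_addD[OF vector_space_fscale functionals_subspace, of x y]
    by (simp add: tangent_def)
  show "fscale c x \<in> tangent H G" if "x \<in> tangent H G" for c x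
    using that subspace_scaleD[OF vector_space_fscale functionals_subspace, of x c]
    by (simp add: tangent_def) (simp add: fscale_def)
qed

lemmas (in hopf) tangent_sumI = subspace_sumD[OF vector_space_fscale tangent_subspace]
lemmas (in hopf) tangent_scaleI = subspace_scaleD[OF vector_space_fscale tangent_subspace]

lemma frt_hopf_mat:
  assumes "frt_bialgebra R Rt M t" "hopf_algebra H" "bialgebra_hom M H f"
  shows "hopf_mat H (\<lambda>i j. f (t i j))"
proof -
  interpret frt_bialgebra R Rt M t by fact
  interpret H: hopf H by unfold_locales (rule assms)
  note fD = bialgebra_homD[OF assms(3)]
  have [lin_rules]: "lin s (scl M) g \<Longrightarrow> lin s (scl H) (\<lambda>z. f (g z))" for s g
    by (rule lin_comp[OF fD(1)])
  show ?thesis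
  proof unfold_locales
    fix i j
    show "cop H (f (t i j)) = (SUM a. tens (scl H) (scl H) (f (t i a)) (f (t a j)))"
    proof -
      have "cop H (f (t i j)) = sw M (\<lambda>x y. tens (scl H) (scl H) (f x) (f y)) (t i j)"
        using assms(3) by (simp add: bialgebra_hom_def)
      also have "\<dots> = (SUM a. tens (scl H) (scl H) (f (t i a)) (f (t a j)))"
        by (rule sw_t[of fscale]) (intro lin_rules)+
      finally show ?thesis .
    qed
    show "cou H (f (t i j)) = kd i j"
      by (simp add: fD(4) cou_t)
  qed
qed

lemma frt_coquasi_mat:
  assumes "frt_bialgebra R Rt M t" "hopf_algebra H" "bialgebra_hom M H f" "coquasitriangular H r"
    and z: "z \<noteq> 0" and r: "\<And>i j k l. r (f (t i j)) (f (t k l)) = z * R i j k l"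
  shows "coquasi_mat H (\<lambda>i j. f (t i j)) r"
proof -
  interpret frt_bialgebra R Rt M t by fact
  interpret hopf_mat H "\<lambda>i j. f (t i j)"
    by (rule frt_hopf_mat[OF assms(1-3)])
  show ?thesis
  proof unfold_locales
    obtain Ri where Ri: "rmat_mult R Ri = rmat_one"
      using invertible by blast
    have "rmat_mult (\<lambda>i j k l. r (f (t i j)) (f (t k l))) (\<lambda>i j k l. inverse z * Ri i j k l) =
        rmat_mult R Ri"
      using z by (simp add: fun_eq_iff rmat_mult_def r field_simps)
    then show "\<exists>Ri. rmat_mult (\<lambda>i j k l. r (f (t i j)) (f (t k l))) Ri = rmat_one"
      using Ri by auto
  qed (rule assms)
qed

lemma frt_coquasi_unit:
  assumes "frt_bialgebra R Rt M t" "hopf_algebra H" "bialgebra_hom M H f" "coquasitriangular H r"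
    and z: "z \<noteq> 0" and r: "\<And>i j k l. r (f (t i j)) (f (t k l)) = z * R i j k l"
  shows "r 1 (f a) = cou M a" "r (f a) 1 = cou M a"
proof -
  interpret frt_bialgebra R Rt M t by fact
  interpret coquasi_mat H "\<lambda>i j. f (t i j)" r
    by (rule frt_coquasi_mat[OF assms])
  note fD = bialgebra_homD[OF assms(3)]
  have lf [lin_rules]: "lin s (scl M) g \<Longrightarrow> lin s (scl H) (\<lambda>z. f (g z))" for s g
    by (rule lin_comp[OF fD(1)])
  have r1: "r 1 (a * b) = r 1 b * r 1 a" for a b
    unfolding r_mult_right by (rule sw_one[of "(*)"]) (intro lin_rules)+
  have r2: "r (a * b) 1 = r a 1 * r b 1" for a b
    unfolding r_mult_left by (rule sw_one[of "(*)"]) (intro lin_rules)+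
  have "r 1 (f (word w)) = cou M (word w) \<and> r (f (word w)) 1 = cou M (word w)" for w
    by (induction w) (auto simp: word_simps fD r1 r2 r_one_one M.cou_one M.cou_mult cou_t r_one_T r_T_one)
  then show "r 1 (f a) = cou M a" "r (f a) 1 = cou M a"
    by (rule_tac lin_eq_on_words[of "(*)"], intro lin_rules, intro lin_rules, simp)+
qed

section \<open>The localisation at the determinant\<close>

context quantum_GL
begin

abbreviation T :: "'n \<Rightarrow> 'n \<Rightarrow> 'h" where "T i j \<equiv> \<iota> (t i j)"

lemmas iotaD = bialgebra_homD[OF iota_hom]

lemma lin_iota [lin_rules]: "lin s (scl M) f \<Longrightarrow> lin s (scl H) (\<lambda>z. \<iota> (f z))"
  by (rule lin_comp[OF iotaD(1)])

sublocale C: coquasi_mat H T r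
  by (rule frt_coquasi_mat[OF frt_bialgebra_axioms hopf iota_hom coquasi z_nonzero r_t])

lemma grouplike_iota_det: "grouplike H (\<iota> det)"
proof -
  have "cop H (\<iota> det) = sw M (\<lambda>x y. tens (scl H) (scl H) (\<iota> x) (\<iota> y)) det"
    using iota_hom by (simp add: bialgebra_hom_def)
  also have "\<dots> = tens (scl H) (scl H) (\<iota> det) (\<iota> det)"
    by (rule M.sw_grouplike[of fscale, OF _ _ det_grouplike]) (intro lin_rules)+
  finally show ?thesis
    using det_grouplike by (simp add: grouplike_def iotaD(4))
qed

lemma grouplike_deti: "grouplike H deti"
  by (rule C.grouplike_inverse[OF grouplike_iota_det]) (rule deti)+

lemma cou_det: "cou M det = 1" and cou_deti: "cou H deti = 1"
  using det_grouplike grouplike_deti by (auto simp: grouplike_def)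

lemma cou_deti_pow: "cou H (deti ^ m) = 1"
  by (induction m) (simp_all add: C.cou_one C.cou_mult cou_deti)

lemma cou_det_pow: "cou M (det ^ m) = 1"
  by (induction m) (simp_all add: M.cou_one M.cou_mult cou_det)

lemma iota_det_deti: "\<iota> (a * det ^ m) * deti ^ m = \<iota> a"
proof (induction m)
  case (Suc m)
  have "\<iota> (a * det ^ Suc m) * deti ^ Suc m = \<iota> (a * det ^ m) * (\<iota> det * deti) * deti ^ m"
    by (simp only: iotaD(3) power_Suc2 power_Suc mult.assoc) (simp only: power_commutes mult.assoc)
  then show ?case
    using Suc by (simp add: deti)
qed simp

lemma deti_iota: "deti * \<iota> a = \<iota> a * deti"
proof -
  have "deti * \<iota> a = deti * (\<iota> a * \<iota> det) * deti"
    by (simp add: mult.assoc deti)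
  also have "\<dots> = deti * \<iota> det * \<iota> a * deti"
    by (simp add: det_central mult.assoc flip: iotaD(3))
  finally show ?thesis
    by (simp add: deti)
qed

lemma deti_pow_iota: "deti ^ m * \<iota> a = \<iota> a * deti ^ m"
proof (induction m)
  case (Suc m)
  have "deti ^ Suc m * \<iota> a = deti * (deti ^ m * \<iota> a)"
    by (simp add: mult.assoc)
  also have "\<dots> = deti * \<iota> a * deti ^ m"
    unfolding Suc by (simp add: mult.assoc)
  finally show ?case
    by (simp add: deti_iota mult.assoc)
qed simp

lemma frac_eqD:
  assumes "\<iota> a * deti ^ m = \<iota> a' * deti ^ m'"
  shows "a * det ^ m' = a' * det ^ m"
proof -
  have 1: "deti ^ m * \<iota> (det ^ m) = 1" for m
    using iota_det_deti[of 1 m] by (simp add: deti_pow_iota iotaD(2))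
  have "\<iota> (a * det ^ m') = \<iota> a * deti ^ m * \<iota> (det ^ m) * \<iota> (det ^ m')"
    by (simp add: mult.assoc 1 iotaD(3))
  also have "\<dots> = \<iota> a' * deti ^ m' * \<iota> (det ^ m') * \<iota> (det ^ m)"
    unfolding assms by (simp add: mult.assoc flip: iotaD(3) power_add) (simp add: add.commute)
  also have "\<dots> = \<iota> (a' * det ^ m)"
    by (simp add: mult.assoc 1 iotaD(3))
  finally show ?thesis
    using iota_inj by (simp add: inj_eq)
qed

text \<open>Both r(1, .) and r(., 1) are multiplicative up to order. They equal \<epsilon> on A(R),
  and \<open>\<iota> det * deti = 1\<close> then forces the value 1 on the inverse
  determinant.\<close>

lemma r_unit: "r 1 h = cou H h" "r h 1 = cou H h"
proof -
  note [simp] = frt_coquasi_unit[OF frt_bialgebra_axioms hopf iota_hom coquasi z_nonzero r_t]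
  have r1: "r 1 (a * b) = r 1 b * r 1 a" for a b
    unfolding C.r_mult_right by (rule C.sw_one[of "(*)"]) (intro lin_rules)+
  have r2: "r (a * b) 1 = r a 1 * r b 1" for a b
    unfolding C.r_mult_left by (rule C.sw_one[of "(*)"]) (intro lin_rules)+
  have "r 1 deti = 1" "r deti 1 = 1"
    using r1[of "\<iota> det" deti] r2[of "\<iota> det" deti] by (simp_all add: deti C.r_one_one cou_det)
  then have "r 1 (deti ^ m) = 1 \<and> r (deti ^ m) 1 = 1" for m
    by (induction m) (simp_all add: r1 r2 C.r_one_one)
  moreover obtain a m where "h = \<iota> a * deti ^ m"
    using fractions by blast
  ultimately show "r 1 h = cou H h" "r h 1 = cou H h"
    by (simp_all add: r1 r2 C.cou_mult cou_deti_pow iotaD(4))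
qed

sublocale C: coquasi_unital H T r
  by unfold_locales (rule r_unit)+

sublocale G: bicovariant_mat H T G
  by unfold_locales (rule calculus)

text \<open>Two formulas for \<open>\<omega> (a * T k l)\<close>, the Leibniz rule
  \<open>omega_mult\<close> and the cocycle rule imposed by the left ideal, share their first term;
  comparing the rest reads off the action.\<close>

lemma act_omega_T: "act H G a (G.\<omega> (T k l)) =
    (SUM p q. gscl G (C.L p q k l a) (G.\<omega> (T p q)))"
proof -
  have "G.\<omega> (a * T k l) = gscl G (kd k l) (G.\<omega> a) +
      (SUM p q. gscl G (C.L p q k l a) (G.\<omega> (T p q)))"
  proof (rule C.derivation_mult_T)
    show "G.\<omega> (uprod H r a b) = 0" if "cou H a = 0" "cou H b = 0" for a b
      using C.uprod_left_ideal[OF calculus_ideal that] by (simp add: left_ideal_def)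
  qed (intro lin_rules, rule G.omega_one)
  then show ?thesis
    by (simp add: G.omega_mult C.cou_T)
qed

end

section \<open>The triangular case\<close>

lemma sum_kd2:
  fixes f :: "'n::finite \<Rightarrow> 'n \<Rightarrow> 'k::field"
  shows "(SUM x y. f x y * (kd b x * kd l y)) = f b l"
    "(SUM x y. f x y * (kd x b * kd l y)) = f b l"
    "(SUM x y. f x y * (kd x b * kd y l)) = f b l"
    "(SUM x y. f x y * (kd b x * kd y l)) = f b l"
proof -
  show 1: "(SUM x y. f x y * (kd b x * kd l y)) = f b l"
    for f :: "'n \<Rightarrow> 'n \<Rightarrow> 'k" and b l
  proof -
    have "(SUM x y. f x y * (kd b x * kd l y)) =
        (SUM x. kd b x * (SUM y. kd l y * f x y))"
      by (simp add: sum_distrib_left mult_ac)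
    then show ?thesis
      by (simp add: sum_kd)
  qed
  show "(SUM x y. f x y * (kd x b * kd l y)) = f b l"
    "(SUM x y. f x y * (kd x b * kd y l)) = f b l"
    "(SUM x y. f x y * (kd b x * kd y l)) = f b l"
    by (simp_all add: kd_commute[of _ b] kd_commute[of _ l] 1)
qed

lemma sum_kd2_scale:
  assumes "vector_space s"
  shows "(SUM x y. s (kd x m * kd y n) (f x y)) = f (m::'n::finite) (n::'l::finite)"
    "(SUM x y. s (kd m x * kd n y) (f x y)) = f m n"
proof -
  interpret vector_space s by fact
  show "(SUM x y. s (kd x m * kd y n) (f x y)) = f m n"
    by (simp add: sum_kd_scale[OF assms] flip: scale_scale scale_sum_right)
  then show "(SUM x y. s (kd m x * kd n y) (f x y)) = f m n"
    by (simp add: kd_commute[of m] kd_commute[of n])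
qed

lemma subspace_equalizer:
  assumes "\<And>m n. lin s1 s2 (f m n)" "\<And>m n. lin s1 s2 (g m n)"
  shows "module.subspace s1 {a. \<forall>m n. f m n a = g m n a}"
  by (rule subspaceI[OF lin_vs(1)[OF assms(1)]])
    (auto simp: lin_zero[OF assms(1)] lin_zero[OF assms(2)] lin_add[OF assms(1)] lin_add[OF assms(2)]
      lin_scale[OF assms(1)] lin_scale[OF assms(2)])

lemma flip_rmat_mult: "rmat_mult (flip_rmat P) (flip_rmat Q) = flip_rmat (rmat_mult P Q)"
  by (auto simp: fun_eq_iff flip_rmat_def rmat_mult_def intro: sum.swap)

lemma flip_rmat_one: "flip_rmat rmat_one = rmat_one"
  by (simp add: fun_eq_iff flip_rmat_def rmat_one_def mult.commute)

lemma flip_flip_rmat: "flip_rmat (flip_rmat R) = R"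
  by (simp add: fun_eq_iff flip_rmat_def)

context coquasi_unital
begin

text \<open>The matrix r(S T, T) is inverse to r(T, T) = c R, and R21 R = 1 makes this inverse
  explicit.\<close>

lemma r_antip_T_triangular:
  assumes "c \<noteq> 0" and r_R: "\<And>i j k l. r (T i j) (T k l) = c * R i j k l"
    and triangular: "rmat_mult (flip_rmat R) R = rmat_one"
  shows "r (S (T i j)) (T k l) = inverse c * R k l i j"
proof -
  let ?Y = "\<lambda>i j k l. r (S (T i j)) (T k l)"
  let ?F = "\<lambda>i j k l. inverse c * flip_rmat R i j k l"
  have "rmat_mult ?F (\<lambda>i j k l. r (T i j) (T k l)) = rmat_mult (flip_rmat R) R"
    using assms(1) by (simp add: fun_eq_iff rmat_mult_def r_R field_simps)
  then have "?F = ?Y"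
    using arg_cong[OF r_antip_right_inverse, of "rmat_mult ?F"]
    by (simp add: rmat_mult_assoc[symmetric] triangular rmat_one_left rmat_one_right)
  from rmat_cong[of _ _ i j k l, OF this] show ?thesis
    by (simp add: flip_rmat_def)
qed

text \<open>The factors c and 1/c cancel, so L does not see the normalisation of r. This makes GL(n)
  and SL(n) comparable.\<close>

lemma L_T_triangular:
  assumes "c \<noteq> 0" "\<And>i j k l. r (T i j) (T k l) = c * R i j k l"
    and "rmat_mult (flip_rmat R) R = rmat_one"
  shows "L m n k l (T i j) = (SUM s. R k m i s * R s j n l)"
  using assms(1) by (simp add: L_T assms(2) r_antip_T_triangular[OF assms] field_simps)

text \<open>The quasi-commutativity axiom of r for an entry of \<open>adm\<close> and a generator,
  multiplied on the right by S(T) to remove the trailing T. It drives the induction in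
  \<open>adM\<close>.\<close>

lemma L_adm:
  "(SUM x y p q.
      scl H (L m n p q (T x y)) (T i x * adm k p q l * S (T y j))) =
   (SUM p q. scl H (L p q k l (T i j)) (adm p m n q))"
proof -
  have 1: "(SUM p q x. scl H (L m n p q (T x y)) (T i x * adm k p q l)) =
      (SUM p q x. scl H (L p q k l (T i x)) (adm p m n q * T x y))" for y
  proof -
    have "sw H (\<lambda>a1 a2. sw H (\<lambda>b1 b2. scl H (r a2 b2) (b1 * a1)) (T i y)) (adm k m n l) =
        sw H (\<lambda>a1 a2. sw H (\<lambda>b1 b2. scl H (r a1 b1) (a2 * b2)) (T i y)) (adm k m n l)"
      using coquasi by (simp add: coquasitriangular_def)
    then show ?thesis
      by (subst (asm) (1 2) sw_T[of "scl H"], (intro lin_rules)+,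
          subst (asm) (1 2) sw_adm[of "scl H"], (intro lin_rules)+) (simp add: L_def)
  qed
  have "(SUM x y p q.
      scl H (L m n p q (T x y)) (T i x * adm k p q l * S (T y j))) =
      (SUM y. (SUM p q x. scl H (L m n p q (T x y)) (T i x * adm k p q l)) *
        S (T y j))"
  proof -
    have "(SUM x y p q. f x y p q) =
        (SUM y p q x. f x y p q)" for f :: "'n \<Rightarrow> 'n \<Rightarrow> 'n \<Rightarrow> 'n \<Rightarrow> 'a"
      unfolding sum.cartesian_product
      by (rule sum.reindex_bij_witness[of _ "\<lambda>(y, p, q, x). (x, y, p, q)" "\<lambda>(x, y, p, q). (y, p, q, x)"])
        auto
    then show ?thesis
      by (simp add: sum_distrib_right scl_mult_left)
  qed
  also have "\<dots> = (SUM y p q x.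
      scl H (L p q k l (T i x)) (adm p m n q * (T x y * S (T y j))))"
    by (simp add: 1 sum_distrib_right scl_mult_left mult.assoc)
  also have "\<dots> = (SUM p q x y.
      scl H (L p q k l (T i x)) (adm p m n q * (T x y * S (T y j))))"
    unfolding sum.cartesian_product
    by (rule sum.reindex_bij_witness[of _ "\<lambda>(p, q, x, y). (y, p, q, x)" "\<lambda>(y, p, q, x). (p, q, x, y)"])
      auto
  also have "\<dots> = (SUM p q x. scl H (L p q k l (T i x)) (adm p m n q * kd x j))"
    by (simp add: T_S flip: scale_sum_right sum_distrib_left)
  also have "\<dots> = (SUM p q x. scl H (kd x j) (scl H (L p q k l (T i x)) (adm p m n q)))"
    by (intro sum.cong refl) (auto simp: kd_def)
  also have "\<dots> = (SUM p q. scl H (L p q k l (T i j)) (adm p m n q))"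
    by (simp only: sum_kd_scale[OF vs])
  finally show ?thesis .
qed

end

locale triangular_GL = quantum_GL R Rt M t det tt H \<iota> deti z r G
  for R :: "('k::field, 'n::finite) rmat" and Rt :: "('k, 'n) rmat"
    and M :: "('k, 'm::ring_1) bialg" and t :: "'n \<Rightarrow> 'n \<Rightarrow> 'm" and det :: 'm
    and tt :: "'n \<Rightarrow> 'n \<Rightarrow> 'm" and H :: "('k, 'h::ring_1) hopf" and \<iota> :: "'m \<Rightarrow> 'h"
    and deti :: 'h and z :: 'k and r :: "'h \<Rightarrow> 'h \<Rightarrow> 'k"
    and G :: "('k, 'h, 'g::ab_group_add) calculus" +
  assumes triangular: "rmat_mult (flip_rmat R) R = rmat_one"
begin

lemma triangular': "rmat_mult R (flip_rmat R) = rmat_one"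
  using arg_cong[OF triangular, of flip_rmat]
  by (simp add: flip_rmat_mult[symmetric] flip_flip_rmat flip_rmat_one)

lemma triangular_sum: "(SUM a b. R k b i a * R a j b l) = kd i j * kd k l"
  using rmat_cong[of _ _ i j k l, OF triangular]
  by (simp add: rmat_mult_def flip_rmat_def rmat_one_def)

lemma triangular_sum': "(SUM a b. R i a k b * R b l a j) = kd i j * kd k l"
  using rmat_cong[of _ _ i j k l, OF triangular']
  by (simp add: rmat_mult_def flip_rmat_def rmat_one_def)

lemma L_T_R: "C.L m n k l (T i j) = (SUM s. R k m i s * R s j n l)"
  by (rule C.L_T_triangular[OF z_nonzero r_t triangular])

text \<open>The intended value of the (k, l) coordinate functional on a word. The recursion is the
  cocycle rule with the first letter split off and with unit matrices prescribed on
  generators.\<close>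

fun X :: "('n \<times> 'n) list \<Rightarrow> 'n \<Rightarrow> 'n \<Rightarrow> 'k" where
  "X [] k l = 0"
| "X ((i, j) # w) k l = kd i k * kd j l * cou M (word w) +
     (SUM p q. C.L k l p q (T i j) * X w p q)"

lemma X_append:
  "X (u @ w) k l = X u k l * cou M (word w) + (SUM p q. C.L k l p q (\<iota> (word u)) * X w p q)"
proof (induction u arbitrary: k l)
  case Nil
  have eq: "C.L k l p q (\<iota> (word [])) * X w p q = X w p q * (kd p k * kd l q)" for p q
    by (simp add: word_simps iotaD(2) C.L_one)
  show ?case
    by (simp only: append_Nil X.simps mult_zero_left add_0_left eq sum_kd2)
next
  case (Cons ij u)
  obtain i j where ij: "ij = (i, j)" by (cases ij)
  have "(SUM p q. C.L k l p q (T i j) * (SUM x y. C.L p q x y (\<iota> (word u)) * X w x y)) =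
      (SUM x y. C.L k l x y (\<iota> (word (ij # u))) * X w x y)"
    unfolding ij word_simps iotaD(3) C.L_mult
    by (simp add: sum_distrib_left sum_distrib_right mult.assoc) (rule sum_swap4)
  then show ?case
    by (simp add: ij Cons word_simps M.cou_mult distrib_left sum.distrib sum_distrib_right
        distrib_right mult.assoc)
qed

text \<open>D forms the difference of the two sides of an FRT relation in a function of two-letter
  words. By \<open>X_append\<close>, X on u y v depends on y through \<epsilon>(y), L(y) and X(y).
  The first two factor through A(R), where D vanishes; only X(y) calls for triangularity.\<close>

lemma X_relator:
  "(SUM a b. R i a k b * X (u @ [(a, j), (b, l)] @ v) m n) =
   (SUM a b. R a j b l * X (u @ [(k, b), (i, a)] @ v) m n)"
proof -
  define D :: "(('n \<times> 'n) list \<Rightarrow> 'k) \<Rightarrow> 'k" where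
    "D f = (SUM a b. R i a k b * f [(a, j), (b, l)]) -
      (SUM a b. R a j b l * f [(k, b), (i, a)])" for f
  have D_add: "D (\<lambda>y. f y + g y) = D f + D g" for f g
    by (simp add: D_def distrib_left sum.distrib)
  have D_left: "D (\<lambda>y. c * f y) = c * D f" and D_right: "D (\<lambda>y. f y * c) = D f * c" for c f
    by (simp_all add: D_def sum_distrib_left sum_distrib_right right_diff_distrib left_diff_distrib mult_ac)
  have D_zero: "D (\<lambda>y. 0) = 0"
    by (simp add: D_def)
  have D_sum: "D (\<lambda>y. SUM p. f p y) = (SUM p. D (f p))" for f :: "'n \<Rightarrow> _"
  proof -
    have "D (\<lambda>y. \<Sum>p\<in>A. f p y) = (\<Sum>p\<in>A. D (f p))" if "finite A" for A
      using that by (induction A) (simp_all add: D_add D_zero)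
    then show ?thesis by simp
  qed
  have D_word: "D (\<lambda>y. h (word y)) = 0" if h: "lin (scl M) (*) h" for h
    using arg_cong[OF FRT[of i k j l], of h]
    by (simp add: D_def word_simps lin_sum[OF h] lin_scale[OF h])
  \<comment> \<open>Triangularity contracts the two L-terms: sum 3 equals sum 2 and sum 4 equals sum
    1, so the sides cancel crosswise.\<close>
  have D_X: "D (\<lambda>y. X y p q) = 0" for p q
  proof -
    have X2: "X [(a, j), (b, l)] p q = kd a p * kd j q * kd b l + C.L p q b l (T a j)" for a b j l
      by (simp add: word_simps M.cou_one cou_t sum_kd2)
    have 1: "(SUM a b. R i a k b * (kd a p * kd j q * kd b l)) = R i p k l * kd j q"
      using sum_kd2(3)[of "\<lambda>a b. R i a k b * kd j q" p l] by (simp add: mult_ac)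
    have 2: "(SUM a b. R a j b l * (kd k p * kd b q * kd i a)) = kd k p * R i j q l"
      using sum_kd2(4)[of "\<lambda>a b. R a j b l * kd k p" i q] by (simp add: mult_ac)
    have 3: "(SUM a b. R i a k b * C.L p q b l (T a j)) = kd k p * R i j q l"
    proof -
      have "(SUM a b. R i a k b * C.L p q b l (T a j)) =
          (SUM a b s. R i a k b * R b p a s * R s j q l)"
        by (simp add: L_T_R sum_distrib_left mult.assoc)
      also have "\<dots> = (SUM s a b. R i a k b * R b p a s * R s j q l)"
        by (rule sum_rotate3)
      also have "\<dots> = (SUM s. kd i s * kd k p * R s j q l)"
        by (simp add: triangular_sum' flip: sum_distrib_right)
      finally show ?thesis
        by (simp add: mult.assoc sum_kd)
    qed
    have 4: "(SUM a b. R a j b l * C.L p q i a (T k b)) = R i p k l * kd j q"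
    proof -
      have "(SUM a b. R a j b l * C.L p q i a (T k b)) =
          (SUM a b s. R i p k s * (R s b q a * R a j b l))"
        by (simp add: L_T_R sum_distrib_left mult_ac)
      also have "\<dots> = (SUM s a b. R i p k s * (R s b q a * R a j b l))"
        by (rule sum_rotate3)
      also have "\<dots> = (SUM s. R i p k s * (kd q j * kd s l))"
        by (simp add: triangular_sum flip: sum_distrib_left)
      finally show ?thesis
        by (simp add: sum_kd kd_commute[of j] flip: mult.assoc)
    qed
    show ?thesis
      unfolding D_def X2 by (simp add: distrib_left sum.distrib 1 2 3 4)
  qed
  have "X (u @ y @ v) m n = X u m n * (cou M (word y) * cou M (word v)) +
      (SUM p q. C.L m n p q (\<iota> (word u)) * (X y p q * cou M (word v) +
        (SUM x w. C.L p q x w (\<iota> (word y)) * X v x w)))" for y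
    by (simp add: X_append word_simps M.cou_mult)
  moreover have "D (\<lambda>y. C.L p q x w (\<iota> (word y))) = 0" "D (\<lambda>y. cou M (word y)) = 0" for p q x w
    by (rule D_word; intro lin_rules)+
  ultimately have "D (\<lambda>y. X (u @ y @ v) m n) = 0"
    by (simp add: D_add D_left D_right D_sum D_X)
  then show ?thesis
    by (simp add: D_def)
qed

definition chiM :: "'n \<Rightarrow> 'n \<Rightarrow> 'm \<Rightarrow> 'k" where
  "chiM k l = (SOME \<chi>. lin (scl M) (*) \<chi> \<and> (\<forall>w. \<chi> (word w) = X w k l))"

lemma chiM: "lin (scl M) (*) (chiM k l)" "chiM k l (word w) = X w k l"
  using someI_ex[OF frt_functional[of "\<lambda>w. X w k l", OF X_relator]] unfolding chiM_def by auto

lemma lin_chiM [lin_rules]: "lin s (scl M) f \<Longrightarrow> lin s (*) (\<lambda>z. chiM k l (f z))"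
  by (rule lin_comp[OF chiM(1)])

lemma chiM_one: "chiM k l 1 = 0"
  using chiM(2)[of k l "[]"] by (simp add: word_simps)

lemma chiM_t: "chiM k l (t i j) = kd i k * kd j l"
  using chiM(2)[of k l "[(i, j)]"] by (simp add: word_simps M.cou_one)

lemma chiM_mult:
  "chiM k l (a * b) = chiM k l a * cou M b + (SUM p q. C.L k l p q (\<iota> a) * chiM p q b)"
proof -
  have "chiM k l (word u * b) = chiM k l (word u) * cou M b +
      (SUM p q. C.L k l p q (\<iota> (word u)) * chiM p q b)" for u
    by (rule lin_eq_on_words[of "(*)"], intro lin_rules, intro lin_rules)
      (simp add: word_simps(3)[symmetric] chiM X_append)
  then show ?thesis
    by (rule_tac lin_eq_on_words[of "(*)" _ _ a], intro lin_rules, intro lin_rules)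
qed

text \<open>\<chi> intertwines the adjoint coaction with the matrix coaction given by
  \<open>adm\<close>. In a product the cocycle rule places L between the coactions of the two
  factors, and \<open>L_adm\<close> carries it past. Values lie in H because the antipode is
  available only there.\<close>

lemma adM:
  "sw3 M (\<lambda>x v y. scl H (chiM m n v) (\<iota> x * C.S (\<iota> y))) a =
    (SUM k l. scl H (chiM k l a) (C.adm k m n l))"
proof -
  let ?l = "\<lambda>m n. sw3 M (\<lambda>x v y. scl H (chiM m n v) (\<iota> x * C.S (\<iota> y)))"
  let ?r = "\<lambda>m n a. SUM k l. scl H (chiM k l a) (C.adm k m n l)"
  \<comment> \<open>Needed for the \<epsilon>-term of the cocycle rule: the counit is coinvariant
    under the adjoint coaction.\<close>
  have eps: "sw3 M (\<lambda>x v y. scl H (cou M v) (\<iota> x * C.S (\<iota> y))) a = scl H (cou M a) 1" for a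
  proof -
    have "sw3 M (\<lambda>x v y. scl H (cou M v) (\<iota> x * C.S (\<iota> y))) a = sw M (\<lambda>x y. \<iota> x * C.S (\<iota> y)) a"
      unfolding sw3_def
      by (subst M.sw_cou_right[of "scl H" "\<lambda>x. \<iota> x * c" for c]) (intro lin_rules refl)+
    also have "\<dots> = scl H (cou M a) 1"
      using C.antip_right[of "\<iota> a"]
      by (subst (asm) sw_hom[OF iota_hom M.bialg_axioms C.bialg_axioms, of "scl H"], (intro lin_rules)+)
        (simp add: iotaD(4))
    finally show ?thesis .
  qed
  have "a \<in> {a. \<forall>m n. ?l m n a = ?r m n a}"
  proof (rule frt_induct)
    show "M.subspace {a. \<forall>m n. ?l m n a = ?r m n a}"
      by (rule subspace_equalizer[of "scl M" "scl H"]; intro lin_rules)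
    show "1 \<in> {a. \<forall>m n. ?l m n a = ?r m n a}"
    proof (intro CollectI allI)
      fix m n
      have "?l m n 1 = scl H (chiM m n 1) (\<iota> 1 * C.S (\<iota> 1))"
        by (rule M.sw3_grouplike[OF M.grouplike_one, of "scl H"]) (intro lin_rules)+
      then show "?l m n 1 = ?r m n 1"
        by (simp add: chiM_one)
    qed
  next
    fix i j a
    assume "a \<in> {a. \<forall>m n. ?l m n a = ?r m n a}"
    then have IH: "?l m n a = ?r m n a" for m n
      by blast
    show "t i j * a \<in> {a. \<forall>m n. ?l m n a = ?r m n a}"
    proof (intro CollectI allI)
      fix m n
      have step: "sw3 M (\<lambda>u v w. scl H (chiM m n (t x y * v)) (\<iota> (t i x * u) * C.S (\<iota> (t y j * w)))) a =
          scl H (kd x m * kd y n) (T i x * scl H (cou M a) 1 * C.S (T y j)) +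
          (SUM p q. scl H (C.L m n p q (T x y)) (T i x * ?r p q a * C.S (T y j)))" for x y
      proof -
        have lin1: "lin (scl H) (scl H) (\<lambda>h. scl H c (T i x * h * C.S (T y j)))" for c
          by (intro lin_rules)
        have "sw3 M (\<lambda>u v w. scl H (chiM m n (t x y * v)) (\<iota> (t i x * u) * C.S (\<iota> (t y j * w)))) a =
          sw3 M (\<lambda>u v w. scl H (kd x m * kd y n) (T i x * scl H (cou M v) (\<iota> u * C.S (\<iota> w)) * C.S (T y j)) +
          (SUM p q. scl H (C.L m n p q (T x y))
              (T i x * scl H (chiM p q v) (\<iota> u * C.S (\<iota> w)) * C.S (T y j)))) a"
          by (simp add: chiM_mult chiM_t iotaD(3) C.antip_mult C.scale_left_distrib C.scale_sum_left
              C.scl_mult_left C.scl_mult_right mult.assoc)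
        also have "\<dots> = scl H (kd x m * kd y n)
            (T i x * sw3 M (\<lambda>u v w. scl H (cou M v) (\<iota> u * C.S (\<iota> w))) a * C.S (T y j)) +
          (SUM p q. scl H (C.L m n p q (T x y)) (T i x * ?l p q a * C.S (T y j)))"
          by (simp only: sw3_add sw3_sum lin_sw3[OF lin1])
        finally show ?thesis
          by (simp only: eps IH)
      qed
      have "?l m n (t i j * a) = (SUM x y. sw3 M (\<lambda>u v w.
          scl H (chiM m n (t x y * v)) (\<iota> (t i x * u) * C.S (\<iota> (t y j * w)))) a)"
        by (rule sw3_t_mult[of "scl H"]) (intro lin_rules)+
      also have "\<dots> = T i m * scl H (cou M a) 1 * C.S (T n j) + (SUM x y p q.
          scl H (C.L m n p q (T x y)) (T i x * ?r p q a * C.S (T y j)))"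
        unfolding step by (simp only: sum.distrib sum_kd2_scale[OF C.vs])
      also have "T i m * scl H (cou M a) 1 * C.S (T n j) = scl H (cou M a) (C.adm i m n j)"
        by (simp add: C.adm_def C.scl_mult_left C.scl_mult_right)
      also have "(SUM x y p q.
          scl H (C.L m n p q (T x y)) (T i x * ?r p q a * C.S (T y j))) =
          (SUM k l. scl H (chiM k l a) (SUM x y p q.
            scl H (C.L m n p q (T x y)) (T i x * C.adm k p q l * C.S (T y j))))"
      proof -
        have swap: "(SUM x y p q k l. f x y p q k l) =
            (SUM k l x y p q. f x y p q k l)"
          for f :: "'n \<Rightarrow> 'n \<Rightarrow> 'n \<Rightarrow> 'n \<Rightarrow> 'n \<Rightarrow> 'n \<Rightarrow> 'h"
          unfolding sum.cartesian_product
          by (rule sum.reindex_bij_witness[of _ "\<lambda>(k, l, x, y, p, q). (x, y, p, q, k, l)"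
                "\<lambda>(x, y, p, q, k, l). (k, l, x, y, p, q)"]) auto
        show ?thesis
          by (simp add: sum_distrib_left sum_distrib_right C.scale_sum_right C.scl_mult_left
              C.scl_mult_right mult.commute) (rule swap)
      qed
      also have "scl H (cou M a) (C.adm i m n j) + (SUM k l. scl H (chiM k l a)
          (SUM x y p q.
            scl H (C.L m n p q (T x y)) (T i x * C.adm k p q l * C.S (T y j)))) = ?r m n (t i j * a)"
      proof -
        have "?r m n (t i j * a) = (SUM p q. scl H (kd p i * kd q j) (scl H (cou M a) (C.adm p m n q))) +
            (SUM p q k l. scl H (chiM k l a * C.L p q k l (T i j)) (C.adm p m n q))"
          by (simp add: chiM_mult chiM_t C.scale_left_distrib sum.distrib C.scale_sum_left mult.commute
              kd_commute[of i] kd_commute[of j])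
        also have "(SUM p q k l. scl H (chiM k l a * C.L p q k l (T i j)) (C.adm p m n q)) =
            (SUM k l p q. scl H (chiM k l a * C.L p q k l (T i j)) (C.adm p m n q))"
          by (rule sum_swap4)
        finally show ?thesis
          unfolding C.L_adm sum_kd2_scale[OF C.vs] by (simp only: C.scale_sum_right C.scale_scale)
      qed
      finally show "?l m n (t i j * a) = ?r m n (t i j * a)" .
    qed
  qed
  then show ?thesis by blast
qed

text \<open>The grouplike \<open>det\<close> is coinvariant under the adjoint coaction, so the vector \<open>\<chi>(det)\<close> is
  invariant under \<open>L\<close>.\<close>

lemma chi_det_adm: "scl H (chiM m n det) 1 = (SUM k l. scl H (chiM k l det) (C.adm k m n l))"
proof -
  have "sw3 M (\<lambda>x v y. scl H (chiM m n v) (\<iota> x * C.S (\<iota> y))) det =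
      scl H (chiM m n det) (\<iota> det * C.S (\<iota> det))"
    by (rule M.sw3_grouplike[OF det_grouplike, of "scl H"]) (intro lin_rules)+
  then show ?thesis
    by (simp add: adM C.grouplike_antip[OF grouplike_iota_det])
qed

lemma chi_det_invariant:
  "(SUM p q. C.L k l p q h * chiM p q det) = cou H h * chiM k l det"
proof -
  have "r (scl H (chiM k l det) 1) h = (SUM p q. chiM p q det * C.L k l p q h)"
    unfolding chi_det_adm
    by (simp add: lin_sum[OF C.lin_r(1)[OF C.lin_id]]
        lin_scale[OF C.lin_r(1)[OF C.lin_id]] C.L_def)
  then show ?thesis
    by (simp add: lin_scale[OF C.lin_r(1)[OF C.lin_id]] r_unit mult.commute)
qed

text \<open>Centrality of det equates \<chi>(det t) with \<chi>(t det). By invariance the latter is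
  \<chi>(t) + \<epsilon>(t) \<chi>(det), so L(det) fixes \<chi>(t), and these run through all unit
  matrices.\<close>

lemma L_det: "C.L k l i j (\<iota> det) = kd i k * kd j l"
proof -
  have "chiM k l (det * t i j) = chiM k l (t i j * det)"
    by (simp add: det_central)
  then show ?thesis
    by (simp add: chiM_mult chiM_t chi_det_invariant cou_det C.cou_T cou_t sum_kd2)
qed

lemma L_deti: "C.L k l i j deti = kd i k * kd j l"
proof -
  have "C.L k l i j (\<iota> det * deti) = C.L k l i j deti"
    using sum_kd2(3)[of "\<lambda>p q. C.L p q i j deti" k l] by (simp add: C.L_mult L_det mult.commute)
  then show ?thesis
    by (simp add: deti C.L_one kd_commute[of l])
qed

lemma L_mult_deti: "C.L k l i j (h * deti ^ m) = C.L k l i j h"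
proof (induction m)
  case (Suc m)
  have "C.L k l i j (h * deti ^ Suc m) = C.L k l i j (h * deti ^ m * deti)"
    by (simp add: power_commutes mult.assoc)
  also have "\<dots> = C.L k l i j (h * deti ^ m)"
    unfolding C.L_mult[of _ _ _ _ "h * deti ^ m" deti]
    using sum_kd2(4)[of "\<lambda>p q. C.L k l p q (h * deti ^ m)" i j]
    by (simp add: L_deti kd_commute[of j])
  finally show ?case
    using Suc by simp
qed simp

lemma chiM_det_pow: "chiM k l (a * det ^ m) = chiM k l a + of_nat m * (cou M a * chiM k l det)"
proof (induction m)
  case (Suc m)
  have "chiM k l (a * det ^ Suc m) = chiM k l (a * det ^ m * det)"
    by (simp add: power_commutes mult.assoc)
  also have "\<dots> = chiM k l (a * det ^ m) + cou M a * chiM k l det"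
    by (simp add: chiM_mult[of _ _ "a * det ^ m"] cou_det chi_det_invariant iotaD(4) M.cou_mult cou_det_pow)
  finally show ?case
    using Suc by (simp add: algebra_simps)
qed simp

section \<open>Extension of the coordinate functionals to the localisation\<close>

definition chi :: "'n \<Rightarrow> 'n \<Rightarrow> 'h \<Rightarrow> 'k" where
  "chi k l h = (case (SOME (a, m). h = \<iota> a * deti ^ m) of
     (a, m) \<Rightarrow> chiM k l a - of_nat m * (cou M a * chiM k l det))"

text \<open>Two fractions for one element are cross-multiplied. By \<open>chiM_det_pow\<close> each
  factor det adds \<epsilon>(a) \<chi>(det), which the correction term compensates.\<close>

lemma chi_frac: "chi k l (\<iota> a * deti ^ m) = chiM k l a - of_nat m * (cou M a * chiM k l det)"
proof -
  let ?P = "\<lambda>(a', m'). \<iota> a * deti ^ m = \<iota> a' * deti ^ m'"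
  obtain a' m' where am: "(SOME p. ?P p) = (a', m')"
    by (cases "SOME p. ?P p")
  have "?P (SOME p. ?P p)"
    by (rule someI[of ?P "(a, m)"]) simp
  then have eq: "\<iota> a * deti ^ m = \<iota> a' * deti ^ m'"
    by (simp add: am)
  have "cou M a = cou M a'"
    using arg_cong[OF eq, of "cou H"] by (simp add: C.cou_mult cou_deti_pow iotaD(4))
  moreover have "chiM k l (a * det ^ m') = chiM k l (a' * det ^ m)"
    by (simp only: frac_eqD[OF eq])
  ultimately show ?thesis
    unfolding chi_def am by (simp add: chiM_det_pow algebra_simps)
qed

lemma chi_iota: "chi k l (\<iota> a) = chiM k l a"
  using chi_frac[of k l a 0] by simp

lemma common_denominator:
  obtains a b m where "h = \<iota> a * deti ^ m" "h' = \<iota> b * deti ^ m"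
proof -
  obtain a m b m' where "h = \<iota> a * deti ^ m" "h' = \<iota> b * deti ^ m'"
    using fractions by blast
  then have "h = \<iota> (a * det ^ m') * deti ^ (m' + m)" "h' = \<iota> (b * det ^ m) * deti ^ (m + m')"
    by (simp_all add: power_add iota_det_deti flip: mult.assoc)
  then show ?thesis
    using that[of "a * det ^ m'" "m' + m" "b * det ^ m"] by (simp add: add.commute)
qed

lemma lin_chi': "lin (scl H) (*) (chi k l)"
proof (rule linI[OF C.vs vector_space_times])
  fix x y
  obtain a b m where xy: "x = \<iota> a * deti ^ m" "y = \<iota> b * deti ^ m"
    by (rule common_denominator)
  then have "x + y = \<iota> (a + b) * deti ^ m"
    by (simp add: lin_add[OF iotaD(1)] distrib_right)
  then show "chi k l (x + y) = chi k l x + chi k l y"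
    using xy by (simp add: chi_frac lin_add[OF chiM(1)] lin_add[OF M.lin_cou'] algebra_simps)
next
  fix c x
  obtain a m where x: "x = \<iota> a * deti ^ m"
    using fractions by blast
  then have "scl H c x = \<iota> (scl M c a) * deti ^ m"
    by (simp add: lin_scale[OF iotaD(1)] C.scl_mult_left)
  then show "chi k l (scl H c x) = c * chi k l x"
    using x by (simp add: chi_frac lin_scale[OF chiM(1)] lin_scale[OF M.lin_cou'] algebra_simps)
qed

lemma lin_chi [lin_rules]: "lin s (scl H) f \<Longrightarrow> lin s (*) (\<lambda>z. chi k l (f z))"
  by (rule lin_comp[OF lin_chi'])

lemma chi_one: "chi k l 1 = 0"
  using chi_iota[of k l 1] by (simp add: iotaD(2) chiM_one)

lemma chi_T: "chi k l (T i j) = kd i k * kd j l"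
  by (simp add: chi_iota chiM_t)

lemma chi_mult:
  "chi k l (g * h) = chi k l g * cou H h + (SUM p q. C.L k l p q g * chi p q h)"
proof -
  obtain a m where g: "g = \<iota> a * deti ^ m"
    using fractions by blast
  obtain b m' where h: "h = \<iota> b * deti ^ m'"
    using fractions by blast
  have "g * h = \<iota> (a * b) * deti ^ (m + m')"
  proof -
    have "g * h = \<iota> a * (deti ^ m * \<iota> b) * deti ^ m'"
      by (simp add: g h mult.assoc)
    then show ?thesis
      by (simp add: deti_pow_iota iotaD(3) power_add mult.assoc)
  qed
  moreover have "(SUM p q. C.L k l p q g * chi p q h) =
      (SUM p q. C.L k l p q (\<iota> a) * chiM p q b) -
      of_nat m' * (cou M b * (SUM p q. C.L k l p q (\<iota> a) * chiM p q det))"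
    unfolding g h L_mult_deti chi_frac
    by (simp add: right_diff_distrib sum_subtractf sum_distrib_left mult_ac)
  ultimately show ?thesis
    unfolding g h chi_det_invariant
    by (simp add: chi_frac chiM_mult M.cou_mult C.cou_mult cou_deti_pow iotaD(4) algebra_simps)
qed

lemma ad_cou: "sw3 H (\<lambda>x v y. scl H (cou H v) (x * C.S y)) h = scl H (cou H h) 1"
proof -
  have "sw3 H (\<lambda>x v y. scl H (cou H v) (x * C.S y)) h = sw H (\<lambda>x y. x * C.S y) h"
    unfolding sw3_def
    by (subst C.sw_cou_right[of "scl H" "\<lambda>x. x * c" for c]) (intro lin_rules refl)+
  then show ?thesis
    by (simp add: C.antip_right)
qed

text \<open>Multiplying by the N-th power of the inverse determinant changes \<chi> by -N
  \<chi>(det) \<epsilon> and leaves \<open>x S(y)\<close> unchanged. By \<open>chi_det_adm\<close>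
  the corrections on the two sides match, so the identity carries over from A(R).\<close>

lemma ad_chi:
  "sw3 H (\<lambda>x v y. scl H (chi m n v) (x * C.S y)) h =
    (SUM k l. scl H (chi k l h) (C.adm k m n l))"
proof -
  obtain a N where h: "h = \<iota> a * deti ^ N"
    using fractions by blast
  let ?g = "deti ^ N"
  have g: "grouplike H ?g"
    by (rule C.grouplike_power[OF grouplike_deti])
  have chi_g: "chi m n (v * ?g) = chi m n v - of_nat N * chiM m n det * cou H v" for m n v
  proof -
    have "chi p q ?g = - of_nat N * chiM p q det" for p q
      using chi_frac[of p q 1 N] by (simp add: iotaD(2) chiM_one M.cou_one)
    then have "chi m n (v * ?g) = chi m n v + (SUM p q. C.L m n p q v * (- of_nat N * chiM p q det))"
      by (simp add: chi_mult cou_deti_pow)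
    also have "(SUM p q. C.L m n p q v * (- of_nat N * chiM p q det)) =
        - of_nat N * (SUM p q. C.L m n p q v * chiM p q det)"
      by (simp add: sum_distrib_left mult_ac sum_negf)
    finally show ?thesis
      unfolding chi_det_invariant by (simp add: mult_ac)
  qed
  have S_g: "x * ?g * C.S (y * ?g) = x * C.S y" for x y
    using C.grouplike_antip(2)[OF g] by (simp add: C.antip_mult mult.assoc) (simp flip: mult.assoc)
  have "sw3 H (\<lambda>x v y. scl H (chi m n v) (x * C.S y)) h =
      sw3 H (\<lambda>x v y. scl H (chi m n (v * ?g)) (x * ?g * C.S (y * ?g))) (\<iota> a)"
    unfolding h by (rule C.sw3_mult_grouplike[OF g, of "scl H"]) (intro lin_rules)+
  also have "\<dots> = sw3 H (\<lambda>x v y. scl H (chi m n v) (x * C.S y) +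
      scl H (- of_nat N * chiM m n det) (scl H (cou H v) (x * C.S y))) (\<iota> a)"
    by (simp add: chi_g S_g C.scale_left_diff_distrib)
  also have "\<dots> = sw3 H (\<lambda>x v y. scl H (chi m n v) (x * C.S y)) (\<iota> a) +
      scl H (- of_nat N * chiM m n det) (scl H (cou H (\<iota> a)) 1)"
    by (simp only: sw3_add ad_cou lin_sw3[OF lin_smult[OF C.lin_id], symmetric])
  also have "sw3 H (\<lambda>x v y. scl H (chi m n v) (x * C.S y)) (\<iota> a) =
      sw3 M (\<lambda>x v y. scl H (chiM m n v) (\<iota> x * C.S (\<iota> y))) a"
    unfolding chi_iota[symmetric]
    by (rule sw3_hom[OF iota_hom M.bialg_axioms C.bialg_axioms, of "scl H"]) (intro lin_rules)+
  also have "scl H (- of_nat N * chiM m n det) (scl H (cou H (\<iota> a)) 1) =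
      scl H (- of_nat N * cou M a) (SUM k l. scl H (chiM k l det) (C.adm k m n l))"
    by (simp add: chi_det_adm[symmetric] iotaD(4) mult_ac)
  finally show ?thesis
    unfolding adM h chi_frac
    by (simp add: C.scale_left_diff_distrib sum_subtractf C.scale_sum_right mult.assoc sum_negf)
qed

text \<open>Only the values of \<rho> on 1 and on the entries of \<open>adm\<close> enter, as
  \<open>ad_cou\<close> and \<open>ad_chi\<close> turn \<open>b1 S(b3)\<close> into these. The
  generality serves SL(n), with the pullback of r' in place of r.\<close>

lemma chi_uprod:
  assumes \<rho>: "\<And>a. lin (scl H) (*) (\<lambda>c. \<rho> c a)" "\<And>c. lin (scl H) (*) (\<rho> c)"
    and \<rho>_adm: "\<And>m n k l a. \<rho> (C.adm k m n l) a = C.L m n k l a" and \<rho>_one: "\<And>a. \<rho> 1 a = cou H a"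
  shows "sw H (\<lambda>a1 a2. sw3 H (\<lambda>b1 b2 b3. \<rho> (b1 * C.S b3) (C.S a2) * chi m n (a1 * b2)) b) a =
    chi m n a * cou H b + cou H a * chi m n b"
proof -
  have 1: "sw3 H (\<lambda>b1 b2 b3. \<rho> (b1 * C.S b3) c * cou H b2) b = cou H b * cou H c" for c
  proof -
    have "\<rho> (sw3 H (\<lambda>x v y. scl H (cou H v) (x * C.S y)) b) c =
        sw3 H (\<lambda>b1 b2 b3. \<rho> (b1 * C.S b3) c * cou H b2) b"
      by (simp add: lin_sw3[OF \<rho>(1)] lin_scale[OF \<rho>(1)] mult.commute)
    then show ?thesis
      by (simp add: ad_cou lin_scale[OF \<rho>(1)] \<rho>_one)
  qed
  have 2: "sw3 H (\<lambda>b1 b2 b3. \<rho> (b1 * C.S b3) c * chi p q b2) b =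
      (SUM k l. chi k l b * C.L p q k l c)" for c p q
  proof -
    have "\<rho> (sw3 H (\<lambda>x v y. scl H (chi p q v) (x * C.S y)) b) c =
        sw3 H (\<lambda>b1 b2 b3. \<rho> (b1 * C.S b3) c * chi p q b2) b"
      by (simp add: lin_sw3[OF \<rho>(1)] lin_scale[OF \<rho>(1)] mult.commute)
    then show ?thesis
      by (simp add: ad_chi lin_sum[OF \<rho>(1)] lin_scale[OF \<rho>(1)] \<rho>_adm)
  qed
  have lin_times_left: "lin (*) (*) (\<lambda>x. c * x)" for c :: 'k
    by (rule lin_smult[OF lin_ident[OF vector_space_times]])
  have "sw3 H (\<lambda>b1 b2 b3. \<rho> (b1 * C.S b3) c * chi m n (a1 * b2)) b =
      chi m n a1 * (cou H b * cou H c) +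
      (SUM p q. C.L m n p q a1 * (SUM k l. chi k l b * C.L p q k l c))" for a1 c
  proof -
    have "sw3 H (\<lambda>b1 b2 b3. \<rho> (b1 * C.S b3) c * chi m n (a1 * b2)) b =
      sw3 H (\<lambda>b1 b2 b3. chi m n a1 * (\<rho> (b1 * C.S b3) c * cou H b2) +
        (SUM p q. C.L m n p q a1 * (\<rho> (b1 * C.S b3) c * chi p q b2))) b"
      by (simp add: chi_mult distrib_left sum_distrib_left mult_ac)
    also have "\<dots> = chi m n a1 * sw3 H (\<lambda>b1 b2 b3. \<rho> (b1 * C.S b3) c * cou H b2) b +
        (SUM p q. C.L m n p q a1 * sw3 H (\<lambda>b1 b2 b3. \<rho> (b1 * C.S b3) c * chi p q b2) b)"
      by (simp only: sw3_add sw3_sum lin_sw3[OF lin_times_left])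
    finally show ?thesis
      unfolding 1 2 .
  qed
  then have "sw H (\<lambda>a1 a2. sw3 H (\<lambda>b1 b2 b3. \<rho> (b1 * C.S b3) (C.S a2) * chi m n (a1 * b2)) b) a =
      sw H (\<lambda>a1 a2. cou H b * (cou H a2 * chi m n a1) + (SUM k l. chi k l b *
        (SUM p q. C.L m n p q a1 * C.L p q k l (C.S a2)))) a"
    by (simp add: C.cou_antip sum_distrib_left mult_ac) (subst sum_swap4, rule refl)
  also have "\<dots> = cou H b * sw H (\<lambda>a1 a2. cou H a2 * chi m n a1) a + (SUM k l. chi k l b *
        sw H (\<lambda>a1 a2. SUM p q. C.L m n p q a1 * C.L p q k l (C.S a2)) a)"
    by (simp only: sw_add sw_sum lin_sw[OF lin_times_left, symmetric])
  also have "sw H (\<lambda>a1 a2. cou H a2 * chi m n a1) a = chi m n a"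
    by (rule C.sw_cou_right[of "(*)"]) (intro lin_rules lin_ident C.vs)
  also have "(SUM k l. chi k l b *
        sw H (\<lambda>a1 a2. SUM p q. C.L m n p q a1 * C.L p q k l (C.S a2)) a) = cou H a * chi m n b"
    unfolding C.L_antip_right
    using sum_kd2(2)[of "\<lambda>k l. cou H a * chi k l b" m n] by (simp add: mult_ac)
  finally show ?thesis
    by (simp add: mult.commute)
qed

lemma chi_tangent: "chi m n \<in> tangent H G"
proof (rule C.tangentI[OF lin_chi' chi_one calculus_ideal])
  fix a b assume "cou H a = 0" "cou H b = 0"
  moreover have "chi m n (uprod H r a b) = chi m n a * cou H b + cou H a * chi m n b"
    unfolding chi_uprod[of r, OF C.lin_r(1)[OF C.lin_id] C.lin_r(2)[OF C.lin_id]
        C.L_def[symmetric] r_unit(1), symmetric] uprod_def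
    by (simp add: lin_sw[OF lin_chi'] lin_sw3[OF lin_chi'] lin_scale[OF lin_chi'])
  ultimately show "chi m n (uprod H r a b) = 0"
    by simp
qed

text \<open>Both sides obey the same twisted Leibniz rule and agree on generators, hence on words
  and on their products with powers of the inverse determinant.\<close>

lemma omega_expand: "G.\<omega> h = (SUM k l. gscl G (chi k l h) (G.\<omega> (T k l)))"
proof -
  let ?r = "\<lambda>h. SUM k l. gscl G (chi k l h) (G.\<omega> (T k l))"
  have mult: "?r (g * h) = gscl G (cou H h) (?r g) +
      (SUM p q. gscl G (chi p q h) (SUM k l. gscl G (C.L k l p q g) (G.\<omega> (T k l))))" for g h
  proof -
    have "?r (g * h) = gscl G (cou H h) (?r g) +
      (SUM k l p q. gscl G (chi p q h * C.L k l p q g) (G.\<omega> (T k l)))"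
      by (simp add: chi_mult G.G.scale_left_distrib sum.distrib G.G.scale_sum_right G.G.scale_sum_left mult.commute)
    then show ?thesis
      by (subst (asm) sum_swap4) (simp add: G.G.scale_sum_right)
  qed
  have act: "act H G g (?r h) = (SUM p q. gscl G (chi p q h)
      (SUM k l. gscl G (C.L k l p q g) (G.\<omega> (T k l))))" for g h
    by (simp add: lin_sum[OF G.lin_act2] lin_scale[OF G.lin_act2] act_omega_T)
  have closed: "G.\<omega> (g * h) = ?r (g * h)" if "G.\<omega> g = ?r g" "G.\<omega> h = ?r h" for g h
    unfolding G.omega_mult that act mult ..
  have iota: "G.\<omega> (\<iota> a) = ?r (\<iota> a)" for a
  proof (rule lin_eq_on_words[of "gscl G"])
    show "G.\<omega> (\<iota> (word w)) = ?r (\<iota> (word w))" for w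
    proof (induction w)
      case Nil
      show ?case
        by (simp add: word_simps iotaD(2) G.omega_one chi_one)
    next
      case (Cons ij w)
      have "G.\<omega> (T i j) = ?r (T i j)" for i j
        by (simp add: chi_T sum_kd2_scale[OF G.vsg])
      from closed[OF this Cons] show ?case
        by (cases ij) (simp only: word_simps iotaD(3))
    qed
  qed (intro lin_rules)+
  \<comment> \<open>The Leibniz rule for \<open>deti * \<iota> det = 1\<close> determines either
    side at the inverse determinant, with the same action term, which cancels.\<close>
  have omega_deti: "G.\<omega> deti = ?r deti"
  proof -
    have "G.\<omega> (deti * \<iota> det) = G.\<omega> deti + act H G deti (?r (\<iota> det))"
      by (simp only: G.omega_mult iota[of det] iotaD(4) cou_det G.G.scale_one)
    moreover have "?r (deti * \<iota> det) = ?r deti + act H G deti (?r (\<iota> det))"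
      by (simp only: mult act iotaD(4) cou_det G.G.scale_one)
    moreover have "G.\<omega> (deti * \<iota> det) = ?r (deti * \<iota> det)"
      unfolding deti(2) by (simp add: G.omega_one chi_one)
    ultimately have "G.\<omega> deti + act H G deti (?r (\<iota> det)) = ?r deti + act H G deti (?r (\<iota> det))"
      by (simp only:)
    then show ?thesis
      by (rule add_right_imp_eq)
  qed
  have "G.\<omega> (deti ^ m) = ?r (deti ^ m)" for m
  proof (induction m)
    case 0
    show ?case
      by (simp add: G.omega_one chi_one)
  next
    case (Suc m)
    from closed[OF omega_deti Suc] show ?case
      by (simp only: power_Suc)
  qed
  moreover obtain a m where "h = \<iota> a * deti ^ m"
    using fractions by blast
  ultimately show ?thesis
    using closed iota by blast
qed

lemma tangent_expand:
  assumes y: "y \<in> tangent H G"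
  shows "y h = (SUM k l. y (T k l) * chi k l h)"
proof -
  have lin_y: "lin (scl H) (*) y" and y1: "y 1 = 0" and y_ideal: "\<And>a. a \<in> left_ideal H G \<Longrightarrow> y a = 0"
    using y by (auto simp: tangent_def functionals_def)
  \<comment> \<open>The remainder of the first-order expansion of h. Subtracting constants puts it
    in the kernel of \<epsilon>, and \<open>omega_expand\<close> puts it in the kernel of \<omega>;
    hence it lies in the left ideal.\<close>
  let ?e = "h - scl H (cou H h) 1 -
    (SUM k l. scl H (chi k l h) (T k l - scl H (kd k l) 1))"
  have "G.\<omega> ?e = 0"
  proof -
    have L: "lin (scl H) (gscl G) G.\<omega>"
      by (intro lin_rules)
    show ?thesis
      by (simp add: lin_diff[OF L] lin_sum[OF L] lin_scale[OF L] G.omega_one flip: omega_expand)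
  qed
  moreover have "cou H ?e = 0"
    by (simp add: lin_diff[OF C.lin_cou'] lin_sum[OF C.lin_cou'] lin_scale[OF C.lin_cou'] C.cou_one C.cou_T)
  ultimately have "y ?e = 0"
    by (intro y_ideal) (simp add: left_ideal_def)
  then show ?thesis
    by (simp add: lin_diff[OF lin_y] lin_sum[OF lin_y] lin_scale[OF lin_y] y1 mult.commute)
qed

end

section \<open>Basis and structure maps of the quantum Lie algebra\<close>

context triangular_GL
begin

lemma chi_set: "{chi i j | i j. True} = (\<lambda>(i, j). chi i j) ` UNIV"
  by auto

lemma inj_chi: "inj (\<lambda>(i, j). chi i j)"
proof (rule injI, clarify)
  fix i j k l assume "chi i j = chi k l"
  then have "chi i j (T i j) = chi k l (T i j)"
    by simp
  then show "i = k \<and> j = l"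
    by (simp add: chi_T kd_def split: if_splits)
qed

lemma chi_span_eval:
  "(SUM k l. fscale (c k l) (chi k l)) h = (SUM k l. c k l * chi k l h)"
  by (simp add: sum_fun_apply) (simp add: fscale_def)

lemma independent_chi: "fs.independent {chi i j | i j. True}"
proof (rule fs.independent_if_scalars_zero)
  show "finite {chi i j | i j. True}"
    unfolding chi_set by simp
  fix f x
  assume f: "(\<Sum>x\<in>{chi i j | i j. True}. fscale (f x) x) = 0" and "x \<in> {chi i j | i j. True}"
  then obtain i j where x: "x = chi i j"
    by blast
  have "(SUM k l. fscale (f (chi k l)) (chi k l)) = 0"
    using f unfolding chi_set
    by (subst (asm) sum.reindex[OF inj_chi])
      (simp add: sum.cartesian_product case_prod_unfold)
  from fun_cong[OF this, of "T i j"] show "f x = 0"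
    unfolding chi_span_eval by (simp add: chi_T sum_kd2 x)
qed

lemma tangent_chi:
  assumes "y \<in> tangent H G"
  shows "y = (SUM k l. fscale (y (T k l)) (chi k l))"
  unfolding fun_eq_iff chi_span_eval by (intro allI tangent_expand[OF assms])

lemma sum_chi_tangent: "(SUM k l. fscale (c k l) (chi k l)) \<in> tangent H G"
  by (intro C.tangent_sumI
      C.tangent_scaleI chi_tangent)

lemma span_chi: "fs.span {chi i j | i j. True} = tangent H G"
proof
  show "fs.span {chi i j | i j. True} \<subseteq> tangent H G"
    using chi_tangent by (intro fs.span_minimal C.tangent_subspace) blast
  show "tangent H G \<subseteq> fs.span {chi i j | i j. True}"
  proof
    fix y assume y: "y \<in> tangent H G"
    have "(SUM k l. fscale (y (T k l)) (chi k l)) \<in> fs.span {chi i j | i j. True}"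
      by (intro fs.span_sum fs.span_scale fs.span_base) blast
    then show "y \<in> fs.span {chi i j | i j. True}"
      by (simp only: tangent_chi[OF y, symmetric])
  qed
qed

lemma card_chi: "card {chi i j | i j. True} = CARD('n)\<^sup>2"
  unfolding chi_set by (subst card_image[OF inj_chi]) (simp add: power2_eq_square card_cartesian_product
      flip: UNIV_Times_UNIV)

lemma dim_tangent: "fs.dim (tangent H G) = CARD('n)\<^sup>2"
  unfolding span_chi[symmetric] card_chi[symmetric]
  by (rule fs.dim_span_eq_card_independent[OF independent_chi])

lemma tangent_lin: "y \<in> tangent H G \<Longrightarrow> lin (scl H) (*) y"
  by (simp add: tangent_def functionals_def)

lemma span_omega: "G.G.span {G.\<omega> (T i j) | i j. True} = right_invariant H G"
proof
  show "G.G.span {G.\<omega> (T i j) | i j. True} \<subseteq> right_invariant H G"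
    using G.omega_T_right_invariant by (intro G.G.span_minimal G.right_invariant_subspace) blast
  have "act H G a (G.\<omega> b) \<in> G.G.span {G.\<omega> (T i j) | i j. True}" for a b
    unfolding omega_expand[of b]
    by (simp only: lin_sum[OF G.lin_act2] lin_scale[OF G.lin_act2] act_omega_T)
      (auto intro!: G.G.span_sum G.G.span_scale intro: G.G.span_base)
  then show "right_invariant H G \<subseteq> G.G.span {G.\<omega> (T i j) | i j. True}"
    by (intro G.right_invariant_subset G.G.subspace_span)
qed

lemma act_omega: "act H G (T i j) (G.\<omega> (T k l)) = R21_w2_R G R (\<lambda>a b. G.\<omega> (T a b)) i j k l"
proof -
  have "act H G (T i j) (G.\<omega> (T k l)) = (SUM p q s.
      gscl G (R k p i s * R s j q l) (G.\<omega> (T p q)))"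
    by (simp add: act_omega_T L_T_R G.G.scale_sum_left)
  also have "\<dots> = (SUM s p q. gscl G (R k p i s * R s j q l) (G.\<omega> (T p q)))"
    by (rule sum_rotate3)
  finally show ?thesis
    by (simp add: R21_w2_R_def flip_rmat_def)
qed

lemma t_omega: "t_omega_relation H G R T"
  by (simp add: t_omega_relation_def act_omega)

lemma FRT_H: "(SUM a b. scl H (R i a k b) (T a j * T b l)) =
      (SUM a b. scl H (R a j b l) (T k b * T i a))"
  using arg_cong[OF FRT[of i k j l], of \<iota>]
  by (simp add: lin_sum[OF iotaD(1)] lin_scale[OF iotaD(1)] iotaD(3))

lemma t_omega_iff:
  assumes "bicovariant_fodc H G0"
  shows "t_omega_relation H G0 R T \<longleftrightarrow> R_dt_relation G0 R T"
proof -
  interpret G0: bicovariant_mat H T G0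
    by unfold_locales (rule assms)
  show ?thesis
    by (rule G0.t_omega_iff_R_dt[OF FRT_H triangular triangular'])
qed

lemma sigma_t_omega:
  "sigma_t H G (SUM a. tens (gscl G) (gscl G) (G.\<omega> (T i a)) (R21_w2_R G R (\<lambda>a b. G.\<omega> (T a b)) a j k l)) =
   (SUM a. tens (gscl G) (gscl G) (R21_w2_R G R (\<lambda>a b. G.\<omega> (T a b)) i a k l) (G.\<omega> (T a j)))"
proof -
  have "R21_w2_R G R (\<lambda>a b. G.\<omega> (T a b)) a j k l \<in> right_invariant H G" for a
    unfolding R21_w2_R_def
    by (intro subspace_sumD[OF G.vsg G.right_invariant_subspace]
        subspace_scaleD[OF G.vsg G.right_invariant_subspace] G.omega_T_right_invariant)
  from G.sigma_t_omega[OF this act_omega[symmetric]] show ?thesis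
    by (simp add: act_omega)
qed

lemma br_chi:
  assumes f: "lin (scl H) (*) f"
  shows "C.br f (chi k l) = (SUM a b. fscale (f (C.adm a k l b)) (chi a b))"
proof
  fix h
  have "C.br f (chi k l) h = f (sw3 H (\<lambda>x v y. scl H (chi k l v) (x * C.S y)) h)"
    by (simp add: C.br_def lin_sw3[OF f] lin_scale[OF f] mult.commute)
  then show "C.br f (chi k l) h = (SUM a b. fscale (f (C.adm a k l b)) (chi a b)) h"
    by (simp add: ad_chi lin_sum[OF f] lin_scale[OF f] sum_fun_apply) (simp add: fscale_def mult.commute)
qed

text \<open>Transposing the second leg turns second-inverse equations into ordinary inverse
  equations, so \<open>Rt\<close> and the array z r(T, S T) invert the same matrix.\<close>

lemma r_T_antip: "r (T i j) (C.S (T k l)) = inverse z * Rt i j k l"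
proof -
  let ?R = "\<lambda>i j k l. R i j l k" and ?Rt = "\<lambda>i j k l. Rt i j l k"
    and ?Z = "\<lambda>i j k l. z * r (T i j) (C.S (T l k))"
  have 1: "rmat_mult ?Rt ?R = rmat_one"
    using second_inverse by (simp add: second_inverse_def fun_eq_iff rmat_mult_def rmat_one_def kd_commute)
  have 2: "rmat_mult ?R ?Z = rmat_one"
    using C.r_second_inverse'
    by (simp add: fun_eq_iff rmat_mult_def rmat_one_def r_t mult_ac kd_commute)
  have "?Z = ?Rt"
    using arg_cong[OF 2, of "rmat_mult ?Rt"]
    by (simp add: rmat_mult_assoc[symmetric] 1 rmat_one_left rmat_one_right)
  from rmat_cong[of _ _ i j l k, OF this] show ?thesis
    using z_nonzero by (simp add: field_simps)
qed

text \<open>Multiplicativity splits L at \<open>T S(T)\<close>. The factor at T consists of entries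
  of R; the factor at S(T) brings in r(T, S T), hence \<open>Rt\<close>, with z cancelling
  1/z.\<close>

lemma L_adm_braid: "C.L i j c d (C.adm a k l b) = braid_coeff R Rt i j k l b a d c"
proof -
  have "C.L i j c d (C.adm a k l b) = (SUM x y s u.
      R x i a s * R s k j y * (Rt c x u b * R y d l u))"
    using z_nonzero
    by (simp add: C.adm_def C.L_mult L_T_R C.L_S_T r_T_antip r_t sum_product field_simps)
  also have "\<dots> = (SUM y u s x. R x i a s * R s k j y * (Rt c x u b * R y d l u))"
    unfolding sum.cartesian_product
    by (rule sum.reindex_bij_witness[of _ "\<lambda>(y, u, s, x). (x, y, s, u)" "\<lambda>(x, y, s, u). (y, u, s, x)"]) auto
  finally show ?thesis
    by (simp add: braid_coeff_def flip_rmat_def mult_ac)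
qed

text \<open>Obtained by applying \<chi> to \<open>S(T) T = 1\<close>, which avoids the elements
  \<open>tt\<close>, known only through their defining equation.\<close>

lemma chi_antip_T: "chi p q (C.S (T l b)) = - (SUM m. C.L p q m b (C.S (T l m)))"
proof -
  have "chi p q (SUM m. C.S (T l m) * T m b) = 0"
    unfolding C.S_T by (auto simp: kd_def chi_one lin_zero[OF lin_chi'])
  moreover have "chi p q (SUM m. C.S (T l m) * T m b) =
      chi p q (C.S (T l b)) + (SUM m. C.L p q m b (C.S (T l m)))"
    by (simp add: lin_sum[OF lin_chi'] chi_mult C.cou_T chi_T sum_kd2 sum.distrib sum_kd)
  ultimately show ?thesis
    by (simp add: add_eq_0_iff2)
qed

lemma chi_adm: "chi i j (C.adm a k l b) =
  kd a i * kd j k * kd l b - (SUM s. braid_coeff R Rt i j k l s a b s)"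
proof -
  have "chi i j (C.adm a k l b) = kd a i * kd j k * kd l b -
      (SUM p q m. C.L i j p q (T a k) * C.L p q m b (C.S (T l m)))"
    by (simp add: C.adm_def chi_mult chi_T C.cou_antip C.cou_T chi_antip_T sum_negf sum_distrib_left
        kd_commute[of j])
  also have "(SUM p q m. C.L i j p q (T a k) * C.L p q m b (C.S (T l m))) =
      (SUM m p q. C.L i j p q (T a k) * C.L p q m b (C.S (T l m)))"
    by (rule sum_rotate3)
  also have "\<dots> = (SUM m. C.L i j m b (C.adm a k l m))"
    by (simp add: C.adm_def C.L_mult)
  finally show ?thesis
    by (simp add: L_adm_braid)
qed

lemma chi_functional: "chi i j \<in> functionals H"
  unfolding C.functionals_iff by (rule lin_chi')

lemma L_functional: "C.L i j p q \<in> functionals H"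
  unfolding C.functionals_iff by (rule C.lin_L[OF C.lin_id])

lemma chi_mult_pair: "chi i j (a * b) = chi i j a * cou H b +
    (SUM p. C.L i j (fst p) (snd p) a * chi (fst p) (snd p) b)"
  by (simp add: chi_mult sum.cartesian_product case_prod_unfold)

lemma chi_hopf_dual: "chi i j \<in> hopf_dual H"
  by (rule C.braiding_br(1)[OF chi_functional _ _ _ chi_mult_pair])
    (auto intro: chi_functional L_functional)

lemma braiding_chi: "braiding H (chi i j) (chi k l) =
  (SUM a b c d.
     fscale (braid_coeff R Rt i j k l b a d c) (tens fscale fscale (chi a b) (chi c d)))"
proof -
  note bt = bilin_tens[OF vector_space_fscale vector_space_fscale]
  have "braiding H (chi i j) (chi k l) =
      (SUM p. tens fscale fscale (C.br (C.L i j (fst p) (snd p)) (chi k l)) (chi (fst p) (snd p)))"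
    by (rule C.braiding_br(2)[OF chi_functional _ _ _ chi_mult_pair])
      (auto intro: chi_functional L_functional)
  also have "\<dots> = (SUM c d. tens fscale fscale (C.br (C.L i j c d) (chi k l)) (chi c d))"
    by (simp add: sum.cartesian_product case_prod_unfold)
  also have "\<dots> = (SUM c d a b.
     fscale (braid_coeff R Rt i j k l b a d c) (tens fscale fscale (chi a b) (chi c d)))"
    by (simp only: br_chi[OF C.lin_L[OF C.lin_id]] L_adm_braid
        lin_sum[OF bilinD(1)[OF bt]] lin_scale[OF bilinD(1)[OF bt]])
  also have "\<dots> = (SUM a b c d.
     fscale (braid_coeff R Rt i j k l b a d c) (tens fscale fscale (chi a b) (chi c d)))"
    by (rule sum_swap4)
  finally show ?thesis .
qed

lemma bracket_chi: "bracket H (chi i j) (chi k l) =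
  fscale (kd j k) (chi i l) - (SUM s a b. fscale (braid_coeff R Rt i j k l s a b s) (chi a b))"
proof -
  have "fscale (chi i j (C.adm a k l b)) (chi a b) = fscale (kd a i * kd b l) (fscale (kd j k) (chi a b)) -
      (SUM s. fscale (braid_coeff R Rt i j k l s a b s) (chi a b))" for a b
    unfolding chi_adm fs.scale_left_diff_distrib fs.scale_sum_left fs.scale_scale kd_commute[of l b]
    by (simp only: mult.assoc mult.commute[of "kd j k"])
  then have "bracket H (chi i j) (chi k l) = (SUM a b. fscale (kd a i * kd b l) (fscale (kd j k) (chi a b)) -
      (SUM s. fscale (braid_coeff R Rt i j k l s a b s) (chi a b)))"
    by (simp only: C.bracket_br[OF chi_hopf_dual] br_chi[OF lin_chi'])
  also have "\<dots> = fscale (kd j k) (chi i l) -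
      (SUM a b s. fscale (braid_coeff R Rt i j k l s a b s) (chi a b))"
    by (simp only: sum_subtractf sum_kd2_scale[OF vector_space_fscale])
  also have "(SUM a b s. fscale (braid_coeff R Rt i j k l s a b s) (chi a b)) =
      (SUM s a b. fscale (braid_coeff R Rt i j k l s a b s) (chi a b))"
    by (rule sum_rotate3)
  finally show ?thesis .
qed

end

section \<open>The special linear case\<close>

context quantum_SL
begin

abbreviation T' :: "'n \<Rightarrow> 'n \<Rightarrow> 's" where "T' i j \<equiv> \<pi> (t i j)"

lemmas piD = bialgebra_homD[OF pi_hom]
lemmas pD = bialgebra_homD[OF p_hom]

lemma lin_pi [lin_rules]: "lin s (scl M) f \<Longrightarrow> lin s (scl H') (\<lambda>z. \<pi> (f z))"
  by (rule lin_comp[OF piD(1)])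

lemma lin_p [lin_rules]: "lin s (scl H) f \<Longrightarrow> lin s (scl H') (\<lambda>z. p (f z))"
  by (rule lin_comp[OF pD(1)])

lemma r'_t: "r' (T' i j) (T' k l) = \<zeta> * R i j k l"
  by (simp add: r'_pi rM_t)

sublocale C': coquasi_mat H' T' r'
  by (rule frt_coquasi_mat[OF frt_bialgebra_axioms hopf' pi_hom coquasi' zeta_nonzero r'_t])

lemma r'_unit: "r' 1 h = cou H' h" "r' h 1 = cou H' h"
proof -
  obtain a where "h = \<pi> a"
    using pi_surj by blast
  then show "r' 1 h = cou H' h" "r' h 1 = cou H' h"
    using frt_coquasi_unit[OF frt_bialgebra_axioms hopf' pi_hom coquasi' zeta_nonzero r'_t]
    by (simp_all add: piD(4))
qed

sublocale C': coquasi_unital H' T' r'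
  by unfold_locales (rule r'_unit)+

sublocale G': bicovariant_mat H' T' G'
  by unfold_locales (rule calculus')

lemma p_antip: "p (antip H h) = antip H' (p h)"
  by (rule antip_hom[OF p_hom C.hopf_axioms C'.hopf_axioms, symmetric])

lemma pi_det: "\<pi> det = 1"
proof -
  have "det - 1 = 1 * (det - 1) * 1"
    by simp
  then have "det - 1 \<in> {a. \<pi> a = 0}"
    unfolding pi_kernel by (intro M.span_base) blast
  then show ?thesis
    by (simp add: lin_diff[OF piD(1)] piD(2))
qed

lemma p_deti: "p deti = 1"
  using pD(3)[of "\<iota> det" deti] by (simp add: deti p_iota pi_det pD(2))

lemma p_frac: "p (\<iota> a * deti ^ m) = \<pi> a"
proof -
  have "p (deti ^ m) = 1"
    by (induction m) (simp_all add: pD p_deti)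
  then show ?thesis
    by (simp add: pD(3) p_iota)
qed

lemma p_surj: obtains h where "b = p h"
proof -
  obtain a where "b = \<pi> a"
    using pi_surj by blast
  then show ?thesis
    using that[of "\<iota> a"] by (simp add: p_iota)
qed

lemma p_adm: "p (C.adm k m n l) = C'.adm k m n l"
  by (simp add: C.adm_def C'.adm_def pD(3) p_iota p_antip)

text \<open>Valid for every R; it serves both the comparison with GL(n) and the standard
  R-matrix.\<close>

lemma tangent_mult_T:
  assumes x: "x \<in> tangent H' G'"
  shows "x (a * T' k l) = kd k l * x a + (SUM p q. C'.L p q k l a * x (T' p q))"
proof (rule C'.derivation_mult_T)
  show "lin (scl H') (*) x" "x 1 = 0"
    using x by (auto simp: tangent_def functionals_def)
  show "x (uprod H' r' a b) = 0" if "cou H' a = 0" "cou H' b = 0" for a b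
    using C'.uprod_left_ideal[OF calculus'_ideal that] x by (auto simp: tangent_def)
qed

end

section \<open>The quantum Lie algebra of SL(n) inside that of GL(n)\<close>

locale triangular_SL =
  quantum_SL R Rt M t det tt H \<iota> deti z r G \<zeta> rM H' \<pi> r' p G' +
  triangular_GL R Rt M t det tt H \<iota> deti z r G
  for R :: "('k::field, 'n::finite) rmat" and Rt :: "('k, 'n) rmat"
    and M :: "('k, 'm::ring_1) bialg" and t :: "'n \<Rightarrow> 'n \<Rightarrow> 'm" and det :: 'm
    and tt :: "'n \<Rightarrow> 'n \<Rightarrow> 'm" and H :: "('k, 'h::ring_1) hopf" and \<iota> :: "'m \<Rightarrow> 'h"
    and deti :: 'h and z :: 'k and r :: "'h \<Rightarrow> 'h \<Rightarrow> 'k"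
    and G :: "('k, 'h, 'g::ab_group_add) calculus"
    and \<zeta> :: 'k and rM :: "'m \<Rightarrow> 'm \<Rightarrow> 'k" and H' :: "('k, 's::ring_1) hopf"
    and \<pi> :: "'m \<Rightarrow> 's" and r' :: "'s \<Rightarrow> 's \<Rightarrow> 'k" and p :: "'h \<Rightarrow> 's"
    and G' :: "('k, 's, 'e::ab_group_add) calculus"
begin

abbreviation g_plus where "g_plus \<equiv> {x \<in> tangent H G. x (\<iota> qtr) = 0}"

text \<open>Descent to the quotient by det = 1 is governed by the value at det, whereas
  \<open>g_plus\<close> is cut out by the quantum trace; the standing assumption on R links the
  two.\<close>

lemma g_plus_iff: "y \<in> g_plus \<longleftrightarrow> y \<in> tangent H G \<and> y (\<iota> det) = 0"
  using det_qtr_zero by blast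

lemma g_plus_subspace: "fs.subspace g_plus"
proof (rule fs.subspaceI)
  show "0 \<in> g_plus"
    using subspace_zeroD[OF vector_space_fscale C.tangent_subspace] by simp
  show "x + y \<in> g_plus" if "x \<in> g_plus" "y \<in> g_plus" for x y
    using that subspace_addD[OF vector_space_fscale C.tangent_subspace, of x G y] by simp
  show "fscale c x \<in> g_plus" if "x \<in> g_plus" for c x
    using that subspace_scaleD[OF vector_space_fscale C.tangent_subspace, of x G c]
    by simp (simp add: fscale_def)
qed

text \<open>Since z and \<zeta> may differ, r need not be the pullback of r'. But L agrees on
  generators by \<open>L_T_triangular\<close>, is multiplicative, and ignores the inverse
  determinant.\<close>

lemma L_p: "C'.L m n k l (p h) = C.L m n k l h"
proof -
  have T: "C'.L m n k l (T' i j) = C.L m n k l (T i j)" for m n k l i j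
    by (simp add: L_T_R C'.L_T_triangular[OF zeta_nonzero r'_t triangular])
  \<comment> \<open>The indices are packed in pairs to fit \<open>subspace_equalizer\<close>. All
    entries are treated at once because multiplicativity of L sums over the intermediate
    ones.\<close>
  have "a \<in> {a. \<forall>mn kl. C'.L (fst mn) (snd mn) (fst kl) (snd kl) (\<pi> a) =
      C.L (fst mn) (snd mn) (fst kl) (snd kl) (\<iota> a)}" for a
  proof (rule frt_induct)
    show "M.subspace {a. \<forall>mn kl. C'.L (fst mn) (snd mn) (fst kl) (snd kl) (\<pi> a) =
        C.L (fst mn) (snd mn) (fst kl) (snd kl) (\<iota> a)}"
      by (rule subspace_equalizer[of "scl M" "(*)"]; intro lin_rules)
  qed (simp_all add: piD iotaD C.L_one C'.L_one C.L_mult C'.L_mult T)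
  then have "C'.L m n k l (\<pi> a) = C.L m n k l (\<iota> a)" for a
    by auto
  moreover obtain a N where "h = \<iota> a * deti ^ N"
    using fractions by blast
  ultimately show ?thesis
    by (simp add: p_frac L_mult_deti)
qed

lemma L_pi: "C'.L m n k l (\<pi> a) = C.L m n k l (\<iota> a)"
  using L_p[of m n k l "\<iota> a"] by (simp only: p_iota)

lemma tangent_pi:
  assumes x: "x \<in> tangent H' G'"
  shows "x (\<pi> a) = (SUM k l. x (T' k l) * chiM k l a)"
proof -
  have lin_x: "lin (scl H') (*) x" and x1: "x 1 = 0"
    using x by (auto simp: tangent_def functionals_def)
  \<comment> \<open>The two dummy indices give the equation the shape of
    \<open>subspace_equalizer\<close>.\<close>
  let ?f = "\<lambda>(_::'n) (_::'n) a. x (\<pi> a)"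
  let ?g = "\<lambda>(_::'n) (_::'n) a. SUM k l. x (T' k l) * chiM k l a"
  have "a \<in> {a. \<forall>m n. ?f m n a = ?g m n a}"
  proof (rule frt_induct_right)
    show "M.subspace {a. \<forall>m n. ?f m n a = ?g m n a}"
      by (rule subspace_equalizer[of "scl M" "(*)"]; intro lin_rules lin_comp[OF lin_x piD(1)])
  next
    show "1 \<in> {a. \<forall>m n. ?f m n a = ?g m n a}"
      by (simp add: piD(2) x1 chiM_one)
  next
    fix i j a assume "a \<in> {a. \<forall>m n. ?f m n a = ?g m n a}"
    then have IH: "x (\<pi> a) = (SUM k l. x (T' k l) * chiM k l a)"
      by simp
    have "x (\<pi> (a * t i j)) = kd i j * (SUM k l. x (T' k l) * chiM k l a) +
        (SUM k l. C.L k l i j (\<iota> a) * x (T' k l))"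
      unfolding piD(3) tangent_mult_T[OF x] IH by (simp add: L_pi)
    also have "\<dots> = (SUM k l. x (T' k l) * (chiM k l a * kd i j + C.L k l i j (\<iota> a)))"
      by (simp add: sum_distrib_left distrib_left sum.distrib mult_ac)
    also have "\<dots> = (SUM k l. x (T' k l) * chiM k l (a * t i j))"
      by (simp add: chiM_mult chiM_t cou_t sum_kd2)
    finally show "a * t i j \<in> {a. \<forall>m n. ?f m n a = ?g m n a}"
      by simp
  qed
  then show ?thesis by simp
qed

lemma tangent_p:
  assumes x: "x \<in> tangent H' G'"
  shows "x (p h) = (SUM k l. x (T' k l) * chi k l h)" "x \<circ> p \<in> g_plus"
proof -
  have x1: "x 1 = 0"
    using x by (auto simp: tangent_def)
  have *: "x (p h) = (SUM k l. x (T' k l) * chi k l h)" for h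
  proof -
    obtain a m where h: "h = \<iota> a * deti ^ m"
      using fractions by blast
    \<comment> \<open>As \<pi> det = 1 and x(1) = 0, the determinant correction in
      \<open>chi_frac\<close> sums to zero.\<close>
    have "(SUM k l. x (T' k l) * chiM k l det) = 0"
      using tangent_pi[OF x, of det] by (simp add: pi_det x1)
    then have "(SUM k l. x (T' k l) * (of_nat m * (cou M a * chiM k l det))) = 0"
      by (simp add: mult.left_commute[of "x _"] flip: sum_distrib_left)
    then show ?thesis
      by (simp add: h p_frac chi_frac tangent_pi[OF x, of a] right_diff_distrib sum_subtractf)
  qed
  then show "x (p h) = (SUM k l. x (T' k l) * chi k l h)" .
  have "x \<circ> p = (SUM k l. fscale (x (T' k l)) (chi k l))"
    by (rule ext) (simp only: chi_span_eval * o_apply)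
  then have "x \<circ> p \<in> tangent H G"
    by (simp only: sum_chi_tangent)
  then show "x \<circ> p \<in> g_plus"
    unfolding g_plus_iff by (simp add: p_iota pi_det x1)
qed

text \<open>Inserting det changes \<chi>(gh) by \<epsilon>(g) \<epsilon>(h) \<chi>(det), because
  L(det) = 1 and \<chi>(det) is L-invariant; pairing with y makes this a multiple of y(det) =
  0.\<close>

lemma tangent_mult_det:
  assumes y: "y \<in> tangent H G" and y_det: "y (\<iota> det) = 0"
  shows "y (g * \<iota> det * h) = y (g * h)" "y (\<iota> a * deti ^ m) = y (\<iota> a)"
proof -
  note ex = tangent_expand[OF y]
  have y0: "(SUM k l. y (T k l) * chiM k l det) = 0"
    using ex[of "\<iota> det"] by (simp add: y_det chi_iota)
  have chi_gdet: "chi k l (g * \<iota> det) = chi k l g + cou H g * chiM k l det" for k l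
    by (simp add: chi_mult iotaD(4) cou_det chi_iota chi_det_invariant)
  have L_gdet: "C.L k l p q (g * \<iota> det) = C.L k l p q g" for k l p q
    using sum_kd2(4)[of "\<lambda>x y. C.L k l x y g" p q]
    by (simp add: C.L_mult L_det kd_commute[of _ q])
  have chi_gdeth: "chi k l (g * \<iota> det * h) = chi k l (g * h) + cou H g * cou H h * chiM k l det" for k l
    unfolding chi_mult[of _ _ "g * \<iota> det" h] chi_mult[of _ _ g h] chi_gdet L_gdet
    by (simp add: algebra_simps)
  have 1: "(SUM k l. y (T k l) * (c * chiM k l det)) = 0" for c
    using y0 by (simp add: mult.left_commute[of "y _"] flip: sum_distrib_left)
  have "(SUM k l. y (T k l) * (c * (d * chiM k l det))) = 0" for c d
    using 1[of "c * d"] by (simp only: mult.assoc)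
  with 1 show "y (g * \<iota> det * h) = y (g * h)" "y (\<iota> a * deti ^ m) = y (\<iota> a)"
    unfolding ex[of "g * \<iota> det * h"] ex[of "g * h"] ex[of "\<iota> a * deti ^ m"] ex[of "\<iota> a"]
    by (simp_all add: chi_gdeth chi_frac chi_iota distrib_left right_diff_distrib sum.distrib
        sum_subtractf)
qed

text \<open>A tangent vector vanishing at det kills the ideal generated by det - 1 and so factors
  through \<pi>. Tangency of the factor must be checked against r' rather than r; pulled back along
  p this is \<open>chi_uprod\<close> with another \<rho>.\<close>

lemma g_plus_descends:
  assumes y: "y \<in> g_plus"
  obtains x where "x \<in> tangent H' G'" "y = x \<circ> p"
proof -
  have y_tan: "y \<in> tangent H G" and y_det: "y (\<iota> det) = 0"
    using y unfolding g_plus_iff by auto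
  note lin_y = tangent_lin[OF y_tan]
  define x where "x b = y (\<iota> (SOME a. \<pi> a = b))" for b
  have lin_yi: "lin (scl M) (*) (\<lambda>a. y (\<iota> a))"
    by (rule lin_comp[OF lin_y iotaD(1)])
  have "{a * (det - 1) * b | a b. True} \<subseteq> {a. y (\<iota> a) \<in> {0}}"
  proof
    fix c assume "c \<in> {a * (det - 1) * b | a b. True}"
    then obtain a b where c: "c = a * (det - 1) * b"
      by blast
    have "\<iota> (a * (det - 1) * b) = \<iota> a * \<iota> det * \<iota> b - \<iota> a * \<iota> b"
      by (simp add: iotaD lin_diff[OF iotaD(1)] algebra_simps)
    then show "c \<in> {a. y (\<iota> a) \<in> {0}}"
      by (simp add: c lin_diff[OF lin_y] tangent_mult_det[OF y_tan y_det])
  qed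
  then have "{a. \<pi> a = 0} \<subseteq> {a. y (\<iota> a) \<in> {0}}"
    unfolding pi_kernel
    by (rule M.span_minimal[OF _ subspace_vimage[OF lin_yi subspace_zero_set[OF vector_space_times]]])
  then have ker: "y (\<iota> a) = y (\<iota> b)" if "\<pi> a = \<pi> b" for a b
    using that lin_diff[OF piD(1), of a b] lin_diff[OF lin_yi, of a b] by auto
  have x_pi: "x (\<pi> a) = y (\<iota> a)" for a
    unfolding x_def by (rule ker) (rule someI[where x = a], simp)
  have x_p: "x (p h) = y h" for h
  proof -
    obtain a m where "h = \<iota> a * deti ^ m"
      using fractions by blast
    then show ?thesis
      by (simp add: p_frac x_pi tangent_mult_det[OF y_tan y_det])
  qed
  have lin_x: "lin (scl H') (*) x"
  proof (rule linI[OF C'.vs vector_space_times])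
    fix b c
    obtain b' c' where "b = \<pi> b'" "c = \<pi> c'"
      using pi_surj by (metis surjD)
    then show "x (b + c) = x b + x c"
      using x_pi[of "b' + c'"] by (simp add: x_pi lin_add[OF piD(1)] lin_add[OF lin_yi])
  next
    fix c b
    obtain b' where "b = \<pi> b'"
      using pi_surj by (metis surjD)
    then show "x (scl H' c b) = c * x b"
      using x_pi[of "scl M c b'"] by (simp add: x_pi lin_scale[OF piD(1)] lin_scale[OF lin_yi])
  qed
  have "x \<in> tangent H' G'"
  proof (rule C'.tangentI[OF lin_x _ calculus'_ideal])
    show "x 1 = 0"
      using x_p[of 1] y_tan by (simp add: pD(2) tangent_def)
    fix a' b' assume eps: "cou H' a' = 0" "cou H' b' = 0"
    obtain a b where ab: "a' = p a" "b' = p b"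
      using p_surj by metis
    let ?\<rho> = "\<lambda>c d. r' (p c) (p d)"
    have "x (uprod H' r' a' b') = sw H' (\<lambda>a1 a2. sw3 H' (\<lambda>b1 b2 b3.
        r' (b1 * C'.S b3) (C'.S a2) * x (a1 * b2)) b') a'"
      by (simp add: uprod_def lin_sw[OF lin_x] lin_sw3[OF lin_x] lin_scale[OF lin_x])
    also have "\<dots> = sw H (\<lambda>a1 a2. sw3 H' (\<lambda>b1 b2 b3.
        r' (b1 * C'.S b3) (C'.S (p a2)) * x (p a1 * b2)) (p b)) a"
      unfolding ab
      by (rule sw_hom[OF p_hom C.bialg_axioms C'.bialg_axioms, of "(*)"])
        (intro lin_rules lin_comp[OF lin_x])+
    also have "\<dots> = sw H (\<lambda>a1 a2. sw3 H (\<lambda>b1 b2 b3.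
        r' (p b1 * C'.S (p b3)) (C'.S (p a2)) * x (p a1 * p b2)) b) a"
      by (subst sw3_hom[OF p_hom C.bialg_axioms C'.bialg_axioms, of "(*)"])
        (intro lin_rules lin_comp[OF lin_x] refl)+
    also have "\<dots> = sw H (\<lambda>a1 a2. sw3 H (\<lambda>b1 b2 b3. ?\<rho> (b1 * C.S b3) (C.S a2) * y (a1 * b2)) b) a"
      by (simp add: pD(3) p_antip flip: x_p)
    also have "\<dots> = (SUM k l. y (T k l) * sw H (\<lambda>a1 a2. sw3 H (\<lambda>b1 b2 b3.
        ?\<rho> (b1 * C.S b3) (C.S a2) * chi k l (a1 * b2)) b) a)"
    proof -
      have lin_times_left: "lin (*) (*) (\<lambda>x. c * x)" for c :: 'k
        by (rule lin_smult[OF lin_ident[OF vector_space_times]])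
      have "?\<rho> (b1 * C.S b3) (C.S a2) * y (a1 * b2) = (SUM k l.
          y (T k l) * (?\<rho> (b1 * C.S b3) (C.S a2) * chi k l (a1 * b2)))" for b1 b3 a2 a1 b2
        unfolding tangent_expand[OF y_tan, of "a1 * b2"] by (simp add: sum_distrib_left mult_ac)
      then show ?thesis
        by (simp only: sw3_sum sw_sum lin_sw3[OF lin_times_left, symmetric] lin_sw[OF lin_times_left, symmetric])
    qed
    also have "\<dots> = (SUM k l. y (T k l) * (chi k l a * cou H b + cou H a * chi k l b))"
    proof -
      have "sw H (\<lambda>a1 a2. sw3 H (\<lambda>b1 b2 b3. ?\<rho> (b1 * C.S b3) (C.S a2) * chi k l (a1 * b2)) b) a =
          chi k l a * cou H b + cou H a * chi k l b" for k l
      proof (rule chi_uprod)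
        show "?\<rho> (C.adm m n k l) a = C.L n k m l a" for m n k l a
          by (simp add: p_adm C'.L_def[symmetric] L_p)
        show "?\<rho> 1 a = cou H a" for a
          by (simp add: pD r'_unit)
      qed (intro lin_rules lin_ident C.vs)+
      then show ?thesis by simp
    qed
    also have "\<dots> = 0"
      using eps by (simp add: ab pD(4))
    finally show "x (uprod H' r' a' b') = 0" .
  qed
  moreover have "y = x \<circ> p"
    by (simp add: fun_eq_iff x_p)
  ultimately show ?thesis
    by (rule that)
qed

lemma tangent_SL_image: "(\<lambda>x. x \<circ> p) ` tangent H' G' = g_plus"
proof
  show "(\<lambda>x. x \<circ> p) ` tangent H' G' \<subseteq> g_plus"
    using tangent_p(2) by blast
  show "g_plus \<subseteq> (\<lambda>x. x \<circ> p) ` tangent H' G'"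
    using g_plus_descends by blast
qed

lemma comp_p_inj: "x \<circ> p = y \<circ> p \<Longrightarrow> x = y"
proof
  fix b assume eq: "x \<circ> p = y \<circ> p"
  obtain h where "b = p h"
    by (rule p_surj)
  then show "x b = y b"
    using fun_cong[OF eq, of h] by simp
qed

text \<open>Tangency for SL(n) is tested on GL(n), where a basis is available.\<close>

lemma tangent'_iff: "x \<in> tangent H' G' \<longleftrightarrow> x \<circ> p \<in> g_plus"
proof
  assume "x \<circ> p \<in> g_plus"
  then obtain x' where "x' \<in> tangent H' G'" "x \<circ> p = x' \<circ> p"
    by (rule g_plus_descends)
  then show "x \<in> tangent H' G'"
    using comp_p_inj by blast
qed (rule tangent_p(2))

lemma br_p:
  assumes x: "lin (scl H') (*) x" and y: "lin (scl H') (*) y"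
  shows "C.br (x \<circ> p) (y \<circ> p) = C'.br x y \<circ> p"
proof
  fix h
  have "(C'.br x y \<circ> p) h = sw3 H (\<lambda>a1 a2 a3. x (p a1 * C'.S (p a3)) * y (p a2)) h"
    unfolding C'.br_def o_apply
    by (rule sw3_hom[OF p_hom C.bialg_axioms C'.bialg_axioms, of "(*)"])
      (intro lin_rules lin_comp[OF x] lin_comp[OF y] lin_ident C'.vs x y)+
  then show "C.br (x \<circ> p) (y \<circ> p) h = (C'.br x y \<circ> p) h"
    by (simp add: C.br_def pD(3) p_antip)
qed

text \<open>det is grouplike, so bracketing with f multiplies the value at det by f(1); tangency
  follows from the expansion \<open>br_chi\<close>.\<close>

lemma br_g_plus:
  assumes f: "lin (scl H) (*) f" and y: "y \<in> g_plus"
  shows "C.br f y \<in> g_plus"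
proof -
  have y_tan: "y \<in> tangent H G" and y_det: "y (\<iota> det) = 0"
    using y unfolding g_plus_iff by auto
  have "C.br f y = C.br f (SUM k l. fscale (y (T k l)) (chi k l))"
    by (rule arg_cong[OF tangent_chi[OF y_tan]])
  also have "\<dots> = (SUM k l. fscale (y (T k l)) (C.br f (chi k l)))"
    by (simp only: lin_sum[OF bilinD(2)[OF C.bilin_br]] lin_scale[OF bilinD(2)[OF C.bilin_br]])
  also have "\<dots> \<in> tangent H G"
    unfolding br_chi[OF f]
    by (intro C.tangent_sumI
        C.tangent_scaleI chi_tangent)
  finally have "C.br f y \<in> tangent H G" .
  moreover have "C.br f y (\<iota> det) = f (\<iota> det * C.S (\<iota> det)) * y (\<iota> det)"
    unfolding C.br_def
    by (rule C.sw3_grouplike[OF grouplike_iota_det, of "(*)"])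
      (intro lin_rules lin_comp[OF f] lin_comp[OF tangent_lin[OF y_tan]] lin_ident C.vs tangent_lin[OF y_tan])+
  ultimately show ?thesis
    unfolding g_plus_iff by (simp add: y_det)
qed

lemma tangent'_lin: "x \<in> tangent H' G' \<Longrightarrow> lin (scl H') (*) x"
  by (simp add: tangent_def functionals_def)

lemma br_tangent':
  assumes "lin (scl H') (*) x" "y \<in> tangent H' G'"
  shows "C'.br x y \<in> tangent H' G'"
  unfolding tangent'_iff br_p[OF assms(1) tangent'_lin[OF assms(2)], symmetric]
  by (rule br_g_plus[OF _ tangent_p(2)[OF assms(2)]]) (simp add: o_def, rule lin_comp[OF assms(1) pD(1)])

text \<open>The individual \<chi> need not descend to H', so the coproduct of x cannot be read off
  \<open>chi_mult\<close>. Instead the functionals x(a .) - x(a) \<epsilon> are shown to be tangent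
  vectors and are expanded in a finite basis chosen among them.\<close>

lemma tangent'_coproduct:
  assumes x: "x \<in> tangent H' G'"
  obtains B Mf where "finite B" "B \<subseteq> tangent H' G'" "\<And>b. lin (scl H') (*) (Mf b)"
    "\<And>a c. x (a * c) = x a * cou H' c + (\<Sum>b\<in>B. Mf b a * b c)"
proof -
  note lin_x = tangent'_lin[OF x]
  have lin_xz: "lin s (scl H') g \<Longrightarrow> lin s (*) (\<lambda>z. x (g z))" for s g
    by (rule lin_comp[OF lin_x])
  define \<beta> where "\<beta> a = (\<lambda>c. x (a * c) - x a * cou H' c)" for a
  have lin_\<beta>: "lin (scl H') fscale \<beta>"
    unfolding \<beta>_def by (rule lin_fun_pointwise[OF C'.vs]) (intro lin_rules lin_xz lin_x)
  have \<beta>_tangent: "\<beta> a' \<in> tangent H' G'" for a'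
  proof -
    obtain a where a: "a' = p a"
      by (rule p_surj)
    let ?c = "\<lambda>m n. SUM k l. x (T' k l) * C.L k l m n a"
    have eq: "\<beta> a' \<circ> p = (SUM m n. fscale (?c m n) (chi m n))"
    proof
      fix h
      have "(\<beta> a' \<circ> p) h = x (p (a * h)) - x (p a) * cou H h"
        by (simp add: \<beta>_def a pD)
      also have "\<dots> = (SUM k l. x (T' k l) * (SUM m n. C.L k l m n a * chi m n h))"
        unfolding tangent_p(1)[OF x] chi_mult
        by (simp add: distrib_left sum.distrib sum_distrib_right mult.assoc)
      also have "\<dots> = (SUM m n. ?c m n * chi m n h)"
        by (simp add: sum_distrib_left sum_distrib_right mult.assoc) (rule sum_swap4)
      finally show "(\<beta> a' \<circ> p) h = (SUM m n. fscale (?c m n) (chi m n)) h"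
        by (simp only: chi_span_eval)
    qed
    have "(\<beta> a' \<circ> p) (\<iota> det) = 0"
      using x by (simp add: \<beta>_def p_iota pi_det C'.cou_one)
    then show ?thesis
      unfolding tangent'_iff g_plus_iff using sum_chi_tangent[of ?c] by (simp only: eq)
  qed
  \<comment> \<open>A set-theoretic section of p; composing the \<chi> with it gives finitely many
    functions whose span contains all values of \<beta>.\<close>
  define s where "s b = \<iota> (SOME a. \<pi> a = b)" for b
  have p_s: "p (s b) = b" for b
    unfolding s_def p_iota using pi_surj by (metis (mono_tags, lifting) someI_ex surjD)
  let ?W = "(\<lambda>(k, l) b. chi k l (s b)) ` UNIV"
  have "range \<beta> \<subseteq> fs.span ?W"
  proof
    fix v assume "v \<in> range \<beta>"
    then have v: "v \<in> tangent H' G'"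
      using \<beta>_tangent by blast
    have "v = (SUM k l. fscale (v (T' k l)) (\<lambda>b. chi k l (s b)))"
    proof
      fix b
      have "v b = (SUM k l. v (T' k l) * chi k l (s b))"
        using tangent_p(1)[OF v, of "s b"] by (simp add: p_s)
      then show "v b = (SUM k l. fscale (v (T' k l)) (\<lambda>b. chi k l (s b))) b"
        by (simp only: sum_fun_apply fscale_def)
    qed
    moreover have "(SUM k l. fscale (v (T' k l)) (\<lambda>b. chi k l (s b))) \<in> fs.span ?W"
      by (intro fs.span_sum fs.span_scale fs.span_base) (auto simp: image_iff)
    ultimately show "v \<in> fs.span ?W"
      by simp
  qed
  then obtain B \<phi> where B: "finite B" "B \<subseteq> range \<beta>" "\<And>b. lin fscale (*) (\<phi> b)"
    "\<And>a. \<beta> a = (\<Sum>b\<in>B. fscale (\<phi> b (\<beta> a)) b)"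
    by (rule finite_rank) auto
  show ?thesis
  proof (rule that[of B "\<lambda>b a. \<phi> b (\<beta> a)"])
    show "B \<subseteq> tangent H' G'"
      using B(2) \<beta>_tangent by blast
    show "lin (scl H') (*) (\<lambda>a. \<phi> b (\<beta> a))" for b
      by (rule lin_comp[OF B(3) lin_\<beta>])
    show "x (a * c) = x a * cou H' c + (\<Sum>b\<in>B. \<phi> b (\<beta> a) * b c)" for a c
      using fun_cong[OF B(4)[of a], of c]
      by (simp add: sum_fun_apply) (simp add: \<beta>_def fscale_def algebra_simps)
  qed (rule B)
qed

text \<open>An expansion of the coproduct of x over H', composed with p, is one for x o p over H, so
  \<open>braiding_br\<close> applies to matching data on both sides.\<close>

lemma bracket_braiding_SL:
  assumes x: "x \<in> tangent H' G'" and y: "y \<in> tangent H' G'"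
  shows "bracket H (x \<circ> p) (y \<circ> p) = bracket H' x y \<circ> p"
    and "bracket H' x y \<in> tangent H' G'"
    and "braiding H (x \<circ> p) (y \<circ> p) =
      tlift fscale fscale (tangent H' G') (tangent H' G')
        (\<lambda>u v. tens fscale fscale (u \<circ> p) (v \<circ> p)) (braiding H' x y)"
    and "braiding H (x \<circ> p) (y \<circ> p) \<in> tensor_space fscale fscale g_plus g_plus"
proof -
  obtain B Mf where B: "finite B" "B \<subseteq> tangent H' G'" "\<And>b. lin (scl H') (*) (Mf b)"
    "\<And>a c. x (a * c) = x a * cou H' c + (\<Sum>b\<in>B. Mf b a * b c)"
    by (rule tangent'_coproduct[OF x]) blast
  have comp: "lin (scl H) (*) (f \<circ> p)" if "lin (scl H') (*) f" for f
    unfolding o_def by (rule lin_comp[OF that pD(1)])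
  note lin_B = tangent'_lin[OF subsetD[OF B(2)]]
  have b': "x \<in> hopf_dual H'" "braiding H' x y = (\<Sum>b\<in>B. tens fscale fscale (C'.br (Mf b) y) b)"
    using C'.braiding_br[of x B Mf "\<lambda>b. b", OF _ _ _ B(1,4)] B(3) lin_B tangent'_lin[OF x]
    by (simp_all add: C'.functionals_iff)
  have b: "x \<circ> p \<in> hopf_dual H"
    "braiding H (x \<circ> p) (y \<circ> p) = (\<Sum>b\<in>B. tens fscale fscale (C.br (Mf b \<circ> p) (y \<circ> p)) (b \<circ> p))"
  proof -
    have "(x \<circ> p) (a * c) = (x \<circ> p) a * cou H c + (\<Sum>b\<in>B. (Mf b \<circ> p) a * (b \<circ> p) c)" for a c
      by (simp add: pD B(4))
    note * = C.braiding_br[of "x \<circ> p" B "\<lambda>b. Mf b \<circ> p" "\<lambda>b. b \<circ> p", OF _ _ _ B(1) this]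
    show "x \<circ> p \<in> hopf_dual H"
      by (rule *(1)) (auto simp: C.functionals_iff intro: comp B(3) lin_B tangent'_lin[OF x])
    show "braiding H (x \<circ> p) (y \<circ> p) = (\<Sum>b\<in>B. tens fscale fscale (C.br (Mf b \<circ> p) (y \<circ> p)) (b \<circ> p))"
      by (rule *(2)) (auto simp: C.functionals_iff intro: comp B(3) lin_B tangent'_lin[OF x])
  qed
  show "bracket H (x \<circ> p) (y \<circ> p) = bracket H' x y \<circ> p"
    by (simp add: C.bracket_br[OF b(1)] C'.bracket_br[OF b'(1)] br_p tangent'_lin x y)
  show "bracket H' x y \<in> tangent H' G'"
    by (simp add: C'.bracket_br[OF b'(1)] br_tangent' tangent'_lin x y)
  have br_eq: "C.br (Mf b \<circ> p) (y \<circ> p) = C'.br (Mf b) y \<circ> p" for b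
    by (rule br_p[OF B(3) tangent'_lin[OF y]])
  have br_in: "C'.br (Mf b) y \<in> tangent H' G'" for b
    by (rule br_tangent'[OF B(3) y])
  have lin_o: "lin fscale fscale (\<lambda>u :: 's \<Rightarrow> 'k. u \<circ> p)"
    by (rule linI) (auto simp: vector_space_fscale fun_eq_iff fscale_def)
  have bil: "bil_on fscale fscale fscale (tangent H' G') (tangent H' G')
      (\<lambda>u v. tens fscale fscale (u \<circ> p) (v \<circ> p))"
    by (intro bil_onI bilinI C'.tangent_subspace tens_linear vector_space_fscale lin_o)
  show "braiding H (x \<circ> p) (y \<circ> p) =
      tlift fscale fscale (tangent H' G') (tangent H' G')
        (\<lambda>u v. tens fscale fscale (u \<circ> p) (v \<circ> p)) (braiding H' x y)"
    unfolding b(2) b'(2) br_eq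
    by (rule tlift_sum_tens[OF bil, symmetric]) (use br_in B(2) in auto)
  show "braiding H (x \<circ> p) (y \<circ> p) \<in> tensor_space fscale fscale g_plus g_plus"
    unfolding b(2) br_eq
    by (intro tensor_space_sumI tens_in_tensor_space tangent_p(2))
      (use br_in B(2) in auto)
qed

lemma bracket_braiding_g_plus:
  assumes "x \<in> g_plus" "y \<in> g_plus"
  shows "bracket H x y \<in> g_plus" "braiding H x y \<in> tensor_space fscale fscale g_plus g_plus"
proof -
  obtain x' where x': "x' \<in> tangent H' G'" "x = x' \<circ> p"
    using assms(1) by (rule g_plus_descends)
  obtain y' where y': "y' \<in> tangent H' G'" "y = y' \<circ> p"
    using assms(2) by (rule g_plus_descends)
  note * = bracket_braiding_SL[OF x'(1) y'(1)]
  show "bracket H x y \<in> g_plus"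
    unfolding x'(2) y'(2) *(1) by (rule tangent_p(2)[OF *(2)])
  show "braiding H x y \<in> tensor_space fscale fscale g_plus g_plus"
    unfolding x'(2) y'(2) by (rule *(4))
qed

lemma dim_g_plus: "fs.dim g_plus = CARD('n)\<^sup>2 - 1"
proof -
  have "chi k l (\<iota> qtr) = (SUM a. Rt a k l a)" for k l
    by (simp add: chi_iota qtr_def lin_sum[OF chiM(1)] lin_scale[OF chiM(1)] chiM_t sum_kd2)
  moreover have "cou M qtr = (SUM k a. Rt a k k a)"
    by (simp add: qtr_def lin_sum[OF M.lin_cou'] lin_scale[OF M.lin_cou'] cou_t sum_kd)
  \<comment> \<open>The counit of the quantum trace is the sum of its pairings with the diagonal
    \<chi>. As it is nonzero, some diagonal \<chi> lies outside \<open>g_plus\<close>, which is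
    therefore a hyperplane.\<close>
  ultimately have cou_qtr: "cou M qtr = (SUM k. chi k k (\<iota> qtr))"
    by simp
  have "\<not> (\<forall>k. chi k k (\<iota> qtr) = 0)"
  proof
    assume "\<forall>k. chi k k (\<iota> qtr) = 0"
    then show False
      using qtr_nonzero unfolding cou_qtr by simp
  qed
  then obtain k where k: "chi k k (\<iota> qtr) \<noteq> 0"
    by blast
  let ?x = "chi k k"
  obtain B where B: "B \<subseteq> g_plus" "fs.independent B" "g_plus \<subseteq> fs.span B"
    using fs.maximal_independent_subset by blast
  have span_B: "fs.span B = g_plus"
    using B by (intro antisym fs.span_minimal g_plus_subspace)
  have "finite {chi i j | i j. True}"
    unfolding chi_set by simp
  then have fin: "finite B"
    using fs.independent_span_bound[OF _ B(2)] B(1) unfolding span_chi[symmetric] by blast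
  have x_notin: "?x \<notin> fs.span B"
    using k by (simp add: span_B)
  have indep: "fs.independent (insert ?x B)"
    by (rule fs.independent_insertI[OF x_notin B(2)])
  have "?x \<notin> B"
    using x_notin fs.span_base by blast
  have "fs.span (insert ?x B) = tangent H G"
  proof
    show "fs.span (insert ?x B) \<subseteq> tangent H G"
      using B(1) chi_tangent by (intro fs.span_minimal C.tangent_subspace) blast
    show "tangent H G \<subseteq> fs.span (insert ?x B)"
    proof
      fix y assume y: "y \<in> tangent H G"
      let ?c = "y (\<iota> qtr) / ?x (\<iota> qtr)"
      have "y - fscale ?c ?x \<in> tangent H G"
        by (intro subspace_diffD[OF vector_space_fscale C.tangent_subspace]
            C.tangent_scaleI y chi_tangent)
      moreover have "(y - fscale ?c ?x) (\<iota> qtr) = 0"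
        using k by simp (simp add: fscale_def)
      ultimately have "y - fscale ?c ?x \<in> fs.span B"
        by (simp add: span_B)
      then show "y \<in> fs.span (insert ?x B)"
        using fs.span_breakdown_eq by blast
    qed
  qed
  then have "fs.dim (tangent H G) = card (insert ?x B)"
    using fs.dim_span_eq_card_independent[OF indep] by simp
  then have "card B = CARD('n)\<^sup>2 - 1"
    using fin \<open>?x \<notin> B\<close> by (simp add: dim_tangent)
  then show ?thesis
    using fs.dim_span_eq_card_independent[OF B(2)] by (simp add: span_B)
qed

end

section \<open>The standard quantum group\<close>

lemma sum_dj_rmat:
  fixes f :: "'n::{finite,linorder} \<Rightarrow> 'n \<Rightarrow> complex"
  shows "(SUM a b. dj_rmat c q i a k b * f a b) =
    c * ((if i = k then q else 1) * f i k + (if i < k then (q - inverse q) * f k i else 0))"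
proof -
  have "dj_rmat c q i a k b * f a b =
      kd a i * kd b k * (c * (if i = k then q else 1) * f i k) +
      kd a k * kd b i * (if i < k then c * (q - inverse q) * f k i else 0)" for a b
    by (auto simp: dj_rmat_def kd_def)
  then have "(SUM a b. dj_rmat c q i a k b * f a b) =
      (SUM a b. kd a i * kd b k * (c * (if i = k then q else 1) * f i k)) +
      (SUM a b. kd a k * kd b i * (if i < k then c * (q - inverse q) * f k i else 0))"
    by (simp add: sum.distrib)
  then show ?thesis
    using sum_kd2_scale[OF vector_space_times, of i k "\<lambda>_ _. c * (if i = k then q else 1) * f i k"]
      sum_kd2_scale[OF vector_space_times, of k i "\<lambda>_ _. if i < k then c * (q - inverse q) * f k i else 0"]
    by (simp add: algebra_simps)
qed

text \<open>The Hecke relation \<open>R P R = c^2 P + c (q - 1/q) R\<close>, with P the flip. It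
  reduces the reflection equation, quadratic in R, to one linear in R as soon as c (q - 1/q) is
  nonzero.\<close>

lemma dj_rmat_hecke:
  fixes i s k p :: "'n::{finite,linorder}"
  assumes "q \<noteq> 0"
  shows "(SUM a b. dj_rmat c q i a k b * dj_rmat c q b p a s) =
    c\<^sup>2 * (kd i s * kd k p) + c * (q - inverse q) * dj_rmat c q i p k s"
  unfolding sum_dj_rmat
  using assms by (auto simp: dj_rmat_def kd_def power2_eq_square field_simps)

section \<open>The linearised reflection equation\<close>

context quantum_SL
begin

lemma FRT': "(SUM a b. scl H' (R i a k b) (T' a j * T' b l)) =
      (SUM a b. scl H' (R a j b l) (T' k b * T' i a))"
  using arg_cong[OF FRT[of i k j l], of \<pi>]
  by (simp add: lin_sum[OF piD(1)] lin_scale[OF piD(1)] piD(3))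

text \<open>A tangent vector satisfies the linearised reflection equation: its matrix commutes, in the
  second leg, with \<open>R R\<^sub>2\<^sub>1\<close>.\<close>

lemma tangent_reflection:
  assumes x: "x \<in> tangent H' G'"
  shows "(SUM w. (SUM a b. R i a k b * R b w a s) * x (T' w q)) =
    (SUM w. x (T' k w) * (SUM a b. R i a w b * R b q a s))"
proof -
  have lin_x: "lin (scl H') (*) x"
    using x by (simp add: tangent_def functionals_def)
  define y where "y w v = x (T' w v)" for w v
  \<comment> \<open>The factor \<zeta> is absorbed so that Y inverts R itself.\<close>
  define Y where "Y i j k l = \<zeta> * r' (C'.S (T' i j)) (T' k l)" for i j k l
  define Q where "Q i s k w = (SUM a b. R i a k b * R b w a s)" for i s k w
  have YR: "(SUM a b. Y i a k b * R a j b l) = kd i j * kd k l" for i j k l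
  proof -
    from rmat_cong[of _ _ i j k l, OF C'.r_antip_left_inverse]
    show ?thesis
      by (simp add: Y_def r'_t rmat_mult_def rmat_one_def mult_ac)
  qed
  have L_T: "C'.L m n k l (T' i j) = (SUM s. R k m i s * Y n l s j)" for m n k l i j
    by (simp add: C'.L_T r'_t Y_def mult_ac)
  have x_TT: "x (T' a j * T' b l) = kd b l * y a j +
      (SUM w v s. R b w a s * Y v l s j * y w v)" for a j b l
    unfolding tangent_mult_T[OF x] L_T y_def by (simp add: sum_distrib_right)
  \<comment> \<open>Here x is applied to an FRT relation. The sum of the terms
    \<open>R i a k l * y a j\<close> occurs on both sides and cancels; contracting the rest with R
    then removes Y.\<close>
  have F: "(SUM w v s. Q i s k w * Y v l s j * y w v) =
      (SUM b. R i j b l * y k b)" for i j k l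
  proof -
    have "(SUM a b. R i a k b * x (T' a j * T' b l)) =
        (SUM a b. R a j b l * x (T' k b * T' i a))"
      using arg_cong[OF FRT'[of i k j l], of x] by (simp add: lin_sum[OF lin_x] lin_scale[OF lin_x])
    moreover have "(SUM a b. R i a k b * x (T' a j * T' b l)) =
        (SUM a. R i a k l * y a j) + (SUM w v s. Q i s k w * Y v l s j * y w v)"
    proof -
      have "(SUM a b. R i a k b * (kd b l * y a j)) = (SUM a. R i a k l * y a j)"
      proof -
        have "(SUM a b. R i a k b * (kd b l * y a j)) =
            (SUM a. (SUM b. R i a k b * kd b l) * y a j)"
          by (simp add: sum_distrib_right mult.assoc)
        then show ?thesis
          by (simp add: sum_kd)
      qed
      moreover have "(SUM a b. R i a k b *
          (SUM w v s. R b w a s * Y v l s j * y w v)) =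
          (SUM w v s. Q i s k w * Y v l s j * y w v)"
        unfolding Q_def sum_distrib_left sum_distrib_right
        by (subst sum_swap5) (simp only: mult.assoc)
      ultimately show ?thesis
        unfolding x_TT by (simp add: distrib_left sum.distrib)
    qed
    moreover have "(SUM a b. R a j b l * x (T' k b * T' i a)) =
        (SUM b. R i j b l * y k b) + (SUM a. R i a k l * y a j)"
    proof -
      have "(SUM a b. R a j b l * (kd i a * y k b)) = (SUM b. R i j b l * y k b)"
      proof -
        have "(SUM a b. R a j b l * (kd i a * y k b)) =
            (SUM a. kd i a * (SUM b. R a j b l * y k b))"
          by (simp add: sum_distrib_left mult_ac)
        then show ?thesis
          by (simp add: sum_kd)
      qed
      moreover have "(SUM a b. R a j b l *
          (SUM w v s. R i w k s * Y v a s b * y w v)) =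
          (SUM a. R i a k l * y a j)"
      proof -
        have "(SUM a b. R a j b l *
            (SUM w v s. R i w k s * Y v a s b * y w v)) =
            (SUM a b w v s. R i w k s * y w v * (Y v a s b * R a j b l))"
          by (simp add: sum_distrib_left mult_ac)
        also have "\<dots> = (SUM w v s a b. R i w k s * y w v * (Y v a s b * R a j b l))"
          by (rule sum_swap5)
        also have "\<dots> = (SUM w v s. R i w k s * y w v * (kd v j * kd s l))"
          by (simp add: YR flip: sum_distrib_left)
        finally show ?thesis
          by (simp add: sum_kd2)
      qed
      ultimately show ?thesis
        unfolding x_TT by (simp add: distrib_left sum.distrib)
    qed
    ultimately show ?thesis
      by simp
  qed
  have "(SUM l j. (SUM w v s'. Q i s' k w * Y v l s' j * y w v) * R l q j s) =
      (SUM w. Q i s k w * y w q)"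
  proof -
    have "(SUM l j. (SUM w v s'. Q i s' k w * Y v l s' j * y w v) * R l q j s) =
        (SUM l j w v s'. Q i s' k w * y w v * (Y v l s' j * R l q j s))"
      unfolding sum_distrib_right by (simp only: mult_ac)
    also have "\<dots> = (SUM w v s' l j. Q i s' k w * y w v * (Y v l s' j * R l q j s))"
      by (rule sum_swap5)
    also have "\<dots> = (SUM w v s'. Q i s' k w * y w v * (kd v q * kd s' s))"
      by (simp add: YR flip: sum_distrib_left)
    finally show ?thesis
      by (simp add: sum_kd2)
  qed
  moreover have "(SUM l j. (SUM b. R i j b l * y k b) * R l q j s) =
      (SUM w. y k w * Q i s w q)"
  proof -
    have "(SUM l j. (SUM b. R i j b l * y k b) * R l q j s) =
        (SUM l j b. y k b * (R i j b l * R l q j s))"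
      unfolding sum_distrib_right by (simp only: mult_ac)
    also have "\<dots> = (SUM b j l. y k b * (R i j b l * R l q j s))"
      unfolding sum.cartesian_product
      by (rule sum.reindex_bij_witness[of _ "\<lambda>(b, j, l). (l, j, b)" "\<lambda>(l, j, b). (b, j, l)"]) auto
    finally show ?thesis
      by (simp add: Q_def sum_distrib_left)
  qed
  ultimately show ?thesis
    unfolding F by (simp add: Q_def y_def)
qed

text \<open>A scalar matrix is L-invariant by \<open>L_trace\<close>, so on a word x is \<mu> times
  the length times \<epsilon>. The quotient identifies det, homogeneous of degree n, with 1, where x
  vanishes.\<close>

lemma tangent_scalar:
  assumes x: "x \<in> tangent H' G'" and scalar: "\<And>i j. x (T' i j) = \<mu> * kd i j"
    and char: "of_nat CARD('n) \<noteq> (0 :: 'k)"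
  shows "x = (\<lambda>_. 0)"
proof -
  have lin_x: "lin (scl H') (*) x" and x1: "x 1 = 0"
    using x by (auto simp: tangent_def functionals_def)
  have word: "x (\<pi> (word w)) = of_nat (length w) * \<mu> * cou M (word w)" for w
  proof (induction w rule: rev_induct)
    case Nil
    show ?case
      by (simp add: word_simps piD(2) x1)
  next
    case (snoc ij w)
    obtain i j where ij: "ij = (i, j)"
      by (cases ij)
    have "(SUM p q. C'.L p q i j (\<pi> (word w)) * (\<mu> * kd p q)) =
        \<mu> * (SUM p q. C'.L p q i j (\<pi> (word w)) * kd p q)"
      by (simp add: sum_distrib_left mult_ac)
    also have "\<dots> = \<mu> * (cou M (word w) * kd i j)"
      unfolding C'.L_trace by (simp add: piD(4))
    finally have "x (\<pi> (word w) * T' i j) = kd i j * x (\<pi> (word w)) + \<mu> * (cou M (word w) * kd i j)"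
      unfolding tangent_mult_T[OF x] scalar by simp
    then show ?case
      by (simp add: ij word_simps piD(3) snoc M.cou_mult cou_t algebra_simps)
  qed
  have lin_xpi: "lin (scl M) (*) (\<lambda>a. x (\<pi> a))"
    by (rule lin_comp[OF lin_x piD(1)])
  obtain f where f: "finite {w. f w \<noteq> 0}" "\<And>w. f w \<noteq> 0 \<Longrightarrow> length w = CARD('n)"
    "fext (scl M) word f = det"
    using det_degree unfolding eval_free_fext by blast
  have "x (\<pi> det) = (\<Sum>w | f w \<noteq> 0. f w * (of_nat CARD('n) * \<mu> * cou M (word w)))"
    unfolding f(3)[symmetric] fext_def
    using f(2) by (simp add: lin_sum[OF lin_xpi] lin_scale[OF lin_xpi] word)
  also have "\<dots> = of_nat CARD('n) * \<mu> * cou M det"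
    unfolding f(3)[symmetric] fext_def
    by (simp add: lin_sum[OF M.lin_cou'] lin_scale[OF M.lin_cou'] sum_distrib_left mult_ac)
  finally have "\<mu> = 0"
    using char by (simp add: pi_det x1 cou_det)
  then have "x (\<pi> a) = 0" for a
    by (rule_tac lin_eq_on_words[OF lin_xpi lin_const_zero[OF M.vs vector_space_times]])
      (simp add: word)
  then show ?thesis
    using pi_surj by (metis ext surjD)
qed

end

lemma tangent_dj_zero:
  fixes Rq Rqt :: "(complex, 'nq::{finite,linorder}) rmat"
    and Mq :: "(complex, 'mq::ring_1) bialg" and tq :: "'nq \<Rightarrow> 'nq \<Rightarrow> 'mq"
    and Hq :: "(complex, 'hq::ring_1) hopf"
    and Gq :: "(complex, 'hq, 'gq::ab_group_add) calculus"
    and Hq' :: "(complex, 'sq::ring_1) hopf"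
    and Gq' :: "(complex, 'sq, 'eq::ab_group_add) calculus"
    and q c :: complex
  assumes SL: "quantum_SL Rq Rqt Mq tq detq ttq Hq \<iota>q detiq zq rq Gq \<zeta>q rMq Hq' \<pi>q rq' pq Gq'"
    and R: "Rq = dj_rmat c q" and c: "c \<noteq> 0" and q: "q \<noteq> 0" "q\<^sup>2 \<noteq> 1"
  shows "tangent Hq' Gq' = {\<lambda>_. 0}"
proof -
  interpret quantum_SL Rq Rqt Mq tq detq ttq Hq \<iota>q detiq zq rq Gq \<zeta>q rMq Hq' \<pi>q rq' pq Gq'
    by (rule SL)
  have h: "q - inverse q \<noteq> 0"
    using q by (simp add: field_simps power2_eq_square)
  have "x = (\<lambda>_. 0)" if x: "x \<in> tangent Hq' Gq'" for x
  proof -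
    \<comment> \<open>After the Hecke relation the flip terms contribute the same multiple of x(T k
      u) to both sides, leaving the part linear in R.\<close>
    have E: "(SUM w. Rq i w k s * x (T' w u)) = (SUM w. x (T' k w) * Rq i u w s)" for i k s u
    proof -
      have "(SUM w. (c\<^sup>2 * (kd i s * kd k w) + c * (q - inverse q) * Rq i w k s) * x (T' w u)) =
          (SUM w. x (T' k w) * (c\<^sup>2 * (kd i s * kd w u) + c * (q - inverse q) * Rq i u w s))"
        using tangent_reflection[OF x, of i k s u] unfolding R dj_rmat_hecke[OF q(1)] .
      moreover have "(SUM w. (c\<^sup>2 * (kd i s * kd k w) + c * (q - inverse q) * Rq i w k s) * x (T' w u)) =
          c\<^sup>2 * kd i s * (SUM w. kd k w * x (T' w u)) +
          c * (q - inverse q) * (SUM w. Rq i w k s * x (T' w u))"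
        unfolding sum_distrib_left sum.distrib[symmetric] by (intro sum.cong refl) (simp add: algebra_simps)
      moreover have "(SUM w. x (T' k w) * (c\<^sup>2 * (kd i s * kd w u) + c * (q - inverse q) * Rq i u w s)) =
          c\<^sup>2 * kd i s * (SUM w. x (T' k w) * kd w u) +
          c * (q - inverse q) * (SUM w. x (T' k w) * Rq i u w s)"
        unfolding sum_distrib_left sum.distrib[symmetric] by (intro sum.cong refl) (simp add: algebra_simps)
      ultimately show ?thesis
        using c h by (simp add: sum_kd)
    qed
    \<comment> \<open>In the equations with s = k and i \<noteq> k only diagonal entries of R
      survive, each equal to c.\<close>
    have diag: "x (T' i u) = kd i u * x (T' k k)" if "i \<noteq> k" for i k u
    proof -
      have "(SUM w. Rq i w k k * x (T' w u)) = c * x (T' i u)"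
      proof -
        have eq: "Rq i w k k * x (T' w u) = kd i w * (c * x (T' w u))" for w
          using that by (auto simp: R dj_rmat_def kd_def)
        show ?thesis
          by (simp only: eq sum_kd)
      qed
      moreover have "(SUM w. x (T' k w) * Rq i u w k) = kd i u * (c * x (T' k k))"
      proof -
        have eq: "x (T' k w) * Rq i u w k = kd k w * (kd i u * (c * x (T' k w)))" for w
          using that by (auto simp: R dj_rmat_def kd_def)
        show ?thesis
          by (simp only: eq sum_kd)
      qed
      ultimately show ?thesis
        using E[of i k k u] c by (simp add: mult.left_commute)
    qed
    obtain i0 :: 'nq where True by simp
    have "x (T' i j) = x (T' i0 i0) * kd i j" for i j
    proof (cases "i = j")
      case True
      then show ?thesis
        using diag[of i i0 i] by (cases "i = i0") (simp_all add: kd_def)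
    next
      case False
      then show ?thesis
        using diag[of i j j] by (simp add: kd_def)
    qed
    then show ?thesis
      by (rule tangent_scalar[OF x]) simp
  qed
  moreover have "(\<lambda>_. 0) \<in> tangent Hq' Gq'"
    using subspace_zeroD[OF vector_space_fscale C'.tangent_subspace] by (simp add: zero_fun_def)
  ultimately show ?thesis
    by blast
qed

theorem proposition4p12:
  fixes R Rt :: "('k::field, 'n::finite) rmat"
    and M :: "('k, 'm::ring_1) bialg" and t :: "'n \<Rightarrow> 'n \<Rightarrow> 'm" and det :: 'm
    and tt :: "'n \<Rightarrow> 'n \<Rightarrow> 'm"
    and H :: "('k, 'h::ring_1) hopf" and \<iota> :: "'m \<Rightarrow> 'h" and deti :: 'h and z :: 'k
    and r :: "'h \<Rightarrow> 'h \<Rightarrow> 'k" and G :: "('k, 'h, 'g::ab_group_add) calculus"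
    and \<zeta> :: 'k and rM :: "'m \<Rightarrow> 'm \<Rightarrow> 'k" and H' :: "('k, 's::ring_1) hopf" and \<pi> :: "'m \<Rightarrow> 's"
    and r' :: "'s \<Rightarrow> 's \<Rightarrow> 'k" and p :: "'h \<Rightarrow> 's" and G' :: "('k, 's, 'e::ab_group_add) calculus"
    and Rq Rqt :: "(complex, 'nq::{finite,linorder}) rmat"
    and Mq :: "(complex, 'mq::ring_1) bialg" and tq :: "'nq \<Rightarrow> 'nq \<Rightarrow> 'mq" and detq :: 'mq
    and ttq :: "'nq \<Rightarrow> 'nq \<Rightarrow> 'mq"
    and Hq :: "(complex, 'hq::ring_1) hopf" and \<iota>q :: "'mq \<Rightarrow> 'hq" and detiq :: 'hq
    and zq :: complex
    and rq :: "'hq \<Rightarrow> 'hq \<Rightarrow> complex" and Gq :: "(complex, 'hq, 'gq::ab_group_add) calculus"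
    and \<zeta>q :: complex and rMq :: "'mq \<Rightarrow> 'mq \<Rightarrow> complex" and Hq' :: "(complex, 'sq::ring_1) hopf"
    and \<pi>q :: "'mq \<Rightarrow> 'sq" and rq' :: "'sq \<Rightarrow> 'sq \<Rightarrow> complex" and pq :: "'hq \<Rightarrow> 'sq"
    and Gq' :: "(complex, 'sq, 'eq::ab_group_add) calculus"
    and q c :: complex
  shows
    "(quantum_GL R Rt M t det tt H \<iota> deti z r G \<and> rmat_mult (flip_rmat R) R = rmat_one \<longrightarrow>
       (let T = (\<lambda>i j. \<iota> (t i j));
            \<omega> = (\<lambda>i j. omega_R H G (T i j));
            W = R21_w2_R G R \<omega>;
            \<sigma> = braid_coeff R Rt
        in
          vector_space.dim fscale (tangent H G) = CARD('n)\<^sup>2 \<and>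
          module.span (gscl G) {\<omega> i j | i j. True} = right_invariant H G \<and>
          t_omega_relation H G R T \<and>
          (\<forall>i j. lco G (\<omega> i j) =
             (\<Sum>a\<in>UNIV. \<Sum>b\<in>UNIV. tens (scl H) (gscl G) (T i a * antip H (T b j)) (\<omega> a b))) \<and>
          (\<forall>i j k l.
             sigma_t H G (\<Sum>a\<in>UNIV. tens (gscl G) (gscl G) (\<omega> i a) (W a j k l)) =
             (\<Sum>a\<in>UNIV. tens (gscl G) (gscl G) (W i a k l) (\<omega> a j))) \<and>
          R_dt_relation G R T \<and>
          (\<forall>G0 :: ('k, 'h, 'g) calculus. bicovariant_fodc H G0 \<longrightarrow>
             (t_omega_relation H G0 R T \<longleftrightarrow> R_dt_relation G0 R T)) \<and>
          (\<exists>\<chi> :: 'n \<Rightarrow> 'n \<Rightarrow> 'h \<Rightarrow> 'k.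
             inj (\<lambda>(i, j). \<chi> i j) \<and>
             \<not> module.dependent fscale {\<chi> i j | i j. True} \<and>
             module.span fscale {\<chi> i j | i j. True} = tangent H G \<and>
             (\<forall>a b i j. \<chi> i j (T a b) = kd a i * kd j b) \<and>
             (\<forall>i j k l. braiding H (\<chi> i j) (\<chi> k l) =
                (\<Sum>a\<in>UNIV. \<Sum>b\<in>UNIV. \<Sum>c\<in>UNIV. \<Sum>d\<in>UNIV.
                   fscale (\<sigma> i j k l b a d c) (tens fscale fscale (\<chi> a b) (\<chi> c d)))) \<and>
             (\<forall>i j k l. bracket H (\<chi> i j) (\<chi> k l) =
                fscale (kd j k) (\<chi> i l)
                - (\<Sum>s\<in>UNIV. \<Sum>a\<in>UNIV. \<Sum>b\<in>UNIV. fscale (\<sigma> i j k l s a b s) (\<chi> a b)))))) \<and>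
     (quantum_SL R Rt M t det tt H \<iota> deti z r G \<zeta> rM H' \<pi> r' p G' \<and>
        rmat_mult (flip_rmat R) R = rmat_one \<longrightarrow>
       (let tr = \<iota> (frt_bialgebra.qtr Rt M t);
            g_plus = {x \<in> tangent H G. x tr = 0}
        in
          (\<lambda>x. x \<circ> p) ` tangent H' G' = g_plus \<and>
          (\<forall>x \<in> tangent H' G'. \<forall>y \<in> tangent H' G'.
             bracket H (x \<circ> p) (y \<circ> p) = bracket H' x y \<circ> p \<and>
             braiding H (x \<circ> p) (y \<circ> p) =
               tlift fscale fscale (tangent H' G') (tangent H' G')
                 (\<lambda>u v. tens fscale fscale (u \<circ> p) (v \<circ> p)) (braiding H' x y)) \<and>
          (\<forall>x \<in> g_plus. \<forall>y \<in> g_plus.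
             bracket H x y \<in> g_plus \<and>
             braiding H x y \<in> tensor_space fscale fscale g_plus g_plus) \<and>
          vector_space.dim fscale g_plus = CARD('n)\<^sup>2 - 1)) \<and>
     (quantum_SL Rq Rqt Mq tq detq ttq Hq \<iota>q detiq zq rq Gq \<zeta>q rMq Hq' \<pi>q rq' pq Gq' \<and>
        Rq = dj_rmat c q \<and> c \<noteq> 0 \<and> q \<noteq> 0 \<and> (\<forall>m \<ge> 1. q ^ m \<noteq> 1) \<longrightarrow>
       tangent Hq' Gq' = {\<lambda>_. 0})"
proof (intro conjI impI, goal_cases)
  case 1
  then interpret triangular_GL R Rt M t det tt H \<iota> deti z r G
    unfolding triangular_GL_def triangular_GL_axioms_def by blast
  show ?case
    unfolding Let_def
  proof (intro conjI allI impI exI[of _ chi])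
    show "R_dt_relation G R T"
      using t_omega t_omega_iff[OF calculus] by blast
    show "chi i j (T a b) = kd a i * kd j b" for a b i j
      by (simp add: chi_T kd_commute)
  qed (fact dim_tangent span_omega t_omega G.lco_omega_T sigma_t_omega t_omega_iff inj_chi
      independent_chi span_chi braiding_chi bracket_chi)+
next
  case 2
  then interpret triangular_SL R Rt M t det tt H \<iota> deti z r G \<zeta> rM H' \<pi> r' p G'
    unfolding triangular_SL_def triangular_GL_def triangular_GL_axioms_def quantum_SL_def by blast
  show ?case
    unfolding Let_def
    by (intro conjI ballI tangent_SL_image bracket_braiding_SL(1,3) bracket_braiding_g_plus dim_g_plus)
next
  case 3
  then have "q\<^sup>2 \<noteq> 1"
    by simp
  with 3 show ?case
    by (intro tangent_dj_zero[of Rq Rqt Mq tq detq ttq Hq \<iota>q detiq zq rq Gq \<zeta>q rMq Hq' \<pi>q rq' pq Gq' c q]) auto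
qed

end
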